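(* Let $\mathbf{CDA}$ be the operad of commutative associative (not necessarily unitary) differential algebras, i.e. the operad generated by $\partial\in\mathbf{CDA}(1)$ and $m\in\mathbf{CDA}(2)$ subject to the relations $$m^{(12)}=m,\qquad m\circ_1 m=m\circ_2 m,\qquad \partial\circ m=m\circ_1\partial+m\circ_2\partial.$$ Let $\mathbf{NMI}$ be the operad of noncommutative multi-indices described below. Then there exists a unique operad isomorphism $\theta:\mathbf{CDA}\to\mathbf{NMI}$ sending $\partial$ to $X_1$ and $m$ to $X_0X_0$.
   Context: $\mathbb{K}$ is a field of characteristic $0$. Let $(X_i)_{i\in\mathbb{N}}$ be non-commuting indeterminates. For $n\geq1$, $\mathbf{NMI}(n)$ is the vector space with basis the words $X_{i_1}\cdots X_{i_n}$ ($i_1,\dots,i_n\in\mathbb{N}$) of length $n$, so that $\bigoplus_{n\geq1}\mathbf{NMI}(n)=\mathbb{K}\langle X_i\mid i\in\mathbb{N}\rangle_+$ (non-unitary free associative algebra under concatenation). Let $D$ be the derivation of this algebra with $D(X_i)=X_{i+1}$ for all $i$. The operad structure on $\mathbf{NMI}$ is: composition $X_{i_1}\cdots X_{i_n}\circ(P_1,\dots,P_n)=D^{i_1}(P_1)\cdots D^{i_n}(P_n)$ (extended multilinearly), unit $X_0\in\mathbf{NMI}(1)$, and right $\mathfrak{S}_n$-action $(X_{i_1}\cdots X_{i_n})^\sigma=X_{i_{\sigma(1)}}\cdots X_{i_{\sigma(n)}}$. Partial compositions are $p\circ_i q=p\circ(I,\dots,I,q,I,\dots,I)$ with $q$ in position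 $i$ and $I$ the unit. *)

theory Defs
  imports
    "HOL-Algebra.Algebraic_Closure_Type"
    "HOL-Combinatorics.Permutations"
    "HOL-Library.Poly_Mapping"
begin

section \<open>Linear operads\<close>

abbreviation scalars :: "'k::field ring"
  where "scalars \<equiv> ring_of_type_algebra"

definition linear_maps :: "('k::field, 'a) module \<Rightarrow> ('k, 'b) module \<Rightarrow> ('a \<Rightarrow> 'b) set"
  where "linear_maps M N = {f \<in> carrier M \<rightarrow> carrier N.
    (\<forall>x\<in>carrier M. \<forall>y\<in>carrier M. f (x \<oplus>\<^bsub>M\<^esub> y) = f x \<oplus>\<^bsub>N\<^esub> f y) \<and>
    (\<forall>c. \<forall>x\<in>carrier M. f (c \<odot>\<^bsub>M\<^esub> x) = c \<odot>\<^bsub>N\<^esub> f x)}"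

text \<open>
  All positions are numbered from \<open>0\<close>: the \<open>n\<close> inputs of an operation of arity \<open>n\<close> are
  \<open>0, \<dots>, n - 1\<close>, and a permutation in the symmetric group on \<open>n\<close> letters is a function \<open>\<sigma>\<close> with
  \<open>\<sigma> permutes {..<n}\<close>.

  \<open>op_comp P ks p qs\<close> is the total composition of \<open>p\<close>, of arity \<open>length ks\<close>, with operations
  \<open>qs ! i\<close> of arity \<open>ks ! i\<close>; the result has arity \<open>sum_list ks\<close>.  The arities are passed
  explicitly since the carriers of different arities may overlap.
  \<open>op_act P n p \<sigma>\<close> is the right action, written \<open>p\<^sup>\<sigma>\<close> in mathematical notation.
\<close>

record ('k, 'a) operad =
  op_space :: "nat \<Rightarrow> ('k, 'a) module"
  op_unit :: "'a"
  op_comp :: "nat list \<Rightarrow> 'a \<Rightarrow> 'a list \<Rightarrow> 'a"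
  op_act :: "nat \<Rightarrow> 'a \<Rightarrow> (nat \<Rightarrow> nat) \<Rightarrow> 'a"

abbreviation op_carrier :: "('k, 'a) operad \<Rightarrow> nat \<Rightarrow> 'a set"
  where "op_carrier P n \<equiv> carrier (op_space P n)"

definition op_args :: "('k, 'a) operad \<Rightarrow> nat list \<Rightarrow> 'a list set"
  where "op_args P ks = {qs. list_all2 (\<lambda>k q. q \<in> op_carrier P k) ks qs}"

text \<open>
  Cut \<open>{..<sum_list ks}\<close> into consecutive blocks of lengths \<open>ks ! 0, ks ! 1, \<dots>\<close>.
  \<open>block_perm ks \<sigma> \<tau>\<close> moves block \<open>i\<close> to the place of block \<open>\<sigma> i\<close> (the blocks then have
  lengths \<open>permute_list (inv \<sigma>) ks\<close>) and permutes its entries by \<open>\<tau> i\<close>.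
\<close>

definition offset :: "nat list \<Rightarrow> nat \<Rightarrow> nat"
  where "offset ks i = sum_list (take i ks)"

definition block_perm :: "nat list \<Rightarrow> (nat \<Rightarrow> nat) \<Rightarrow> (nat \<Rightarrow> nat \<Rightarrow> nat) \<Rightarrow> nat \<Rightarrow> nat"
  where "block_perm ks \<sigma> \<tau> x =
    (if x < sum_list ks
     then let i = (LEAST i. x < offset ks (Suc i))
          in offset (permute_list (Hilbert_Choice.inv \<sigma>) ks) (\<sigma> i) + \<tau> i (x - offset ks i)
     else x)"

locale operad =
  fixes P :: "('k::field, 'a) operad"
  assumes space: "module scalars (op_space P n)"
    and unit_closed: "op_unit P \<in> op_carrier P 1"
    and comp_linear: "qs \<in> op_args P ks \<Longrightarrow>
      (\<lambda>p. op_comp P ks p qs) \<in>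
        linear_maps (op_space P (length ks)) (op_space P (sum_list ks))"
    and comp_multilinear: "\<lbrakk>p \<in> op_carrier P (length ks); qs \<in> op_args P ks; i < length ks\<rbrakk> \<Longrightarrow>
      (\<lambda>q. op_comp P ks p (qs[i := q])) \<in>
        linear_maps (op_space P (ks ! i)) (op_space P (sum_list ks))"
    and comp_unit_left: "p \<in> op_carrier P n \<Longrightarrow> op_comp P [n] (op_unit P) [p] = p"
    and comp_unit_right: "p \<in> op_carrier P n \<Longrightarrow>
      op_comp P (replicate n 1) p (replicate n (op_unit P)) = p"
    and comp_assoc: "\<lbrakk>p \<in> op_carrier P (length lss); qs \<in> op_args P (map length lss);
        list_all2 (\<lambda>ls rs. rs \<in> op_args P ls) lss rss\<rbrakk> \<Longrightarrow>
      op_comp P (concat lss) (op_comp P (map length lss) p qs) (concat rss) =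
      op_comp P (map sum_list lss) p
        (map (\<lambda>i. op_comp P (lss ! i) (qs ! i) (rss ! i)) [0..<length lss])"
    and act_linear: "\<sigma> permutes {..<n} \<Longrightarrow>
      (\<lambda>p. op_act P n p \<sigma>) \<in> linear_maps (op_space P n) (op_space P n)"
    and act_id: "p \<in> op_carrier P n \<Longrightarrow> op_act P n p id = p"
    and act_comp: "\<lbrakk>p \<in> op_carrier P n; \<sigma> permutes {..<n}; \<tau> permutes {..<n}\<rbrakk> \<Longrightarrow>
      op_act P n (op_act P n p \<sigma>) \<tau> = op_act P n p (\<sigma> \<circ> \<tau>)"
    and equivariance_outer: "\<lbrakk>p \<in> op_carrier P (length ks); qs \<in> op_args P ks;
        \<sigma> permutes {..<length ks}\<rbrakk> \<Longrightarrow>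
      op_comp P ks (op_act P (length ks) p \<sigma>) qs =
      op_act P (sum_list ks)
        (op_comp P (permute_list (Hilbert_Choice.inv \<sigma>) ks) p (permute_list (Hilbert_Choice.inv \<sigma>) qs))
        (block_perm ks \<sigma> (\<lambda>_. id))"
    and equivariance_inner: "\<lbrakk>p \<in> op_carrier P (length ks); qs \<in> op_args P ks;
        \<And>i. i < length ks \<Longrightarrow> \<tau>s i permutes {..<ks ! i}\<rbrakk> \<Longrightarrow>
      op_comp P ks p (map (\<lambda>i. op_act P (ks ! i) (qs ! i) (\<tau>s i)) [0..<length ks]) =
      op_act P (sum_list ks) (op_comp P ks p qs) (block_perm ks id \<tau>s)"

text \<open>
  A morphism is a family indexed by the arity; each component is extensional (it is
  \<open>undefined\<close> outside the carrier), so that equality of families is equality of morphisms.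
\<close>

locale operad_hom = P: operad P + Q: operad Q
  for P :: "('k::field, 'a) operad" and Q :: "('k, 'b) operad" +
  fixes \<theta> :: "nat \<Rightarrow> 'a \<Rightarrow> 'b"
  assumes hom_extensional: "\<theta> n \<in> extensional (op_carrier P n)"
    and hom_linear: "\<theta> n \<in> linear_maps (op_space P n) (op_space Q n)"
    and hom_unit: "\<theta> 1 (op_unit P) = op_unit Q"
    and hom_comp: "\<lbrakk>p \<in> op_carrier P (length ks); qs \<in> op_args P ks\<rbrakk> \<Longrightarrow>
      \<theta> (sum_list ks) (op_comp P ks p qs) =
      op_comp Q ks (\<theta> (length ks) p) (map2 \<theta> ks qs)"
    and hom_act: "\<lbrakk>p \<in> op_carrier P n; \<sigma> permutes {..<n}\<rbrakk> \<Longrightarrow>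
      \<theta> n (op_act P n p \<sigma>) = op_act Q n (\<theta> n p) \<sigma>"

locale operad_iso = operad_hom +
  assumes iso_bij: "bij_betw (\<theta> n) (op_carrier P n) (op_carrier Q n)"

text \<open>
  The partial composition \<open>p \<circ>\<^sub>i q\<close> for \<open>p\<close> of arity \<open>n\<close> and \<open>q\<close> of arity \<open>k\<close>; here
  \<open>i \<in> {1..n}\<close> as in the usual notation.
\<close>

definition partial_comp :: "('k, 'a) operad \<Rightarrow> nat \<Rightarrow> nat \<Rightarrow> 'a \<Rightarrow> nat \<Rightarrow> 'a \<Rightarrow> 'a"
  where "partial_comp P n k p i q =
    op_comp P (replicate (i - 1) 1 @ [k] @ replicate (n - i) 1) p
      (replicate (i - 1) (op_unit P) @ [q] @ replicate (n - i) (op_unit P))"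


section \<open>Ideals and quotients\<close>

locale operad_ideal =
  fixes P :: "('k::field, 'a) operad" and I :: "nat \<Rightarrow> 'a set"
  assumes submodule: "submodule (I n) scalars (op_space P n)"
    and act_in: "\<lbrakk>x \<in> I n; \<sigma> permutes {..<n}\<rbrakk> \<Longrightarrow> op_act P n x \<sigma> \<in> I n"
    and comp_in_left: "\<lbrakk>x \<in> I (length ks); qs \<in> op_args P ks\<rbrakk> \<Longrightarrow>
      op_comp P ks x qs \<in> I (sum_list ks)"
    and comp_in_right: "\<lbrakk>p \<in> op_carrier P (length ks); qs \<in> op_args P ks; i < length ks;
        qs ! i \<in> I (ks ! i)\<rbrakk> \<Longrightarrow> op_comp P ks p qs \<in> I (sum_list ks)"

text \<open>A relation \<open>(n, r) \<in> R\<close> is an element \<open>r\<close> of arity \<open>n\<close>.\<close>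

definition generated_ideal :: "('k::field, 'a) operad \<Rightarrow> (nat \<times> 'a) set \<Rightarrow> nat \<Rightarrow> 'a set"
  where "generated_ideal P R n =
    {x \<in> op_carrier P n. \<forall>I. operad_ideal P I \<and> (\<forall>(m, r)\<in>R. r \<in> I m) \<longrightarrow> x \<in> I n}"

text \<open>The \<open>mult\<close> and \<open>one\<close> fields of a module record are not used by \<^locale>\<open>module\<close>.\<close>

definition quotient_space :: "('k, 'a) module \<Rightarrow> 'a set \<Rightarrow> ('k, 'a set) module"
  where "quotient_space M H =
    \<lparr>carrier = a_rcosets\<^bsub>M\<^esub> H,
     monoid.mult = undefined, one = undefined,
     zero = H,
     add = set_add M,
     module.smult = (\<lambda>c A. \<Union>a\<in>A. H +>\<^bsub>M\<^esub> (c \<odot>\<^bsub>M\<^esub> a))\<rparr>"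

definition quotient_operad :: "('k, 'a) operad \<Rightarrow> (nat \<Rightarrow> 'a set) \<Rightarrow> ('k, 'a set) operad"
  where "quotient_operad P I =
    \<lparr>op_space = (\<lambda>n. quotient_space (op_space P n) (I n)),
     op_unit = I 1 +>\<^bsub>op_space P 1\<^esub> op_unit P,
     op_comp = (\<lambda>ks A Bs. \<Union>a\<in>A. \<Union>bs\<in>listset Bs.
        I (sum_list ks) +>\<^bsub>op_space P (sum_list ks)\<^esub> op_comp P ks a bs),
     op_act = (\<lambda>n A \<sigma>. \<Union>a\<in>A. I n +>\<^bsub>op_space P n\<^esub> op_act P n a \<sigma>)\<rparr>"


section \<open>Free operads and presentations\<close>

definition scale :: "'k::field \<Rightarrow> ('b \<Rightarrow>\<^sub>0 'k) \<Rightarrow> ('b \<Rightarrow>\<^sub>0 'k)"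
  where "scale c x = Poly_Mapping.map ((*) c) x"

definition linear_extension ::
    "('b \<Rightarrow> ('c \<Rightarrow>\<^sub>0 'k)) \<Rightarrow> ('b \<Rightarrow>\<^sub>0 'k::field) \<Rightarrow> ('c \<Rightarrow>\<^sub>0 'k)"
  where "linear_extension f x = (\<Sum>b\<in>Poly_Mapping.keys x. scale (Poly_Mapping.lookup x b) (f b))"

text \<open>The vector space with basis \<open>B\<close>.\<close>

definition span_space :: "'b set \<Rightarrow> ('k::field, 'b \<Rightarrow>\<^sub>0 'k) module"
  where "span_space B =
    \<lparr>carrier = {x. Poly_Mapping.keys x \<subseteq> B},
     monoid.mult = undefined, one = undefined,
     zero = 0, add = (+), module.smult = scale\<rparr>"

text \<open>
  The tree monomials of arity \<open>n\<close> over generators \<open>g\<close> of arity \<open>ar g\<close> are the planar trees whose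
  vertices are labelled by generators and whose leaves are labelled bijectively by \<open>{..<n}\<close>.
  No symmetry is imposed on the generators: the symmetric group acts freely on the basis of tree
  monomials, by relabelling the leaves.
\<close>

datatype 'g tree = Leaf nat | Node 'g "'g tree list"

fun leaves :: "'g tree \<Rightarrow> nat list"
  where
    "leaves (Leaf i) = [i]"
  | "leaves (Node g ts) = concat (map leaves ts)"

fun well_formed :: "('g \<Rightarrow> nat) \<Rightarrow> 'g tree \<Rightarrow> bool"
  where
    "well_formed ar (Leaf i) = True"
  | "well_formed ar (Node g ts) = (length ts = ar g \<and> (\<forall>t\<in>set ts. well_formed ar t))"

fun graft :: "(nat \<Rightarrow> 'g tree) \<Rightarrow> 'g tree \<Rightarrow> 'g tree"
  where
    "graft s (Leaf i) = s i"
  | "graft s (Node g ts) = Node g (map (graft s) ts)"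

definition relabel :: "(nat \<Rightarrow> nat) \<Rightarrow> 'g tree \<Rightarrow> 'g tree"
  where "relabel f = graft (\<lambda>i. Leaf (f i))"

definition tree_monomials :: "('g \<Rightarrow> nat) \<Rightarrow> nat \<Rightarrow> 'g tree set"
  where "tree_monomials ar n =
    {t. well_formed ar t \<and> distinct (leaves t) \<and> set (leaves t) = {..<n}}"

definition tree_comp :: "nat list \<Rightarrow> 'g tree \<Rightarrow> 'g tree list \<Rightarrow> 'g tree"
  where "tree_comp ks t ss = graft (\<lambda>i. relabel (\<lambda>j. offset ks i + j) (ss ! i)) t"

text \<open>
  A tree \<open>t\<close> is read as the operation taking \<open>(x\<^sub>0, \<dots>, x\<^sub>n\<^sub>-\<^sub>1)\<close> to the value of \<open>t\<close> with
  \<open>x\<^sub>i\<close> at leaf \<open>i\<close>.  Since \<open>t\<^sup>\<sigma>\<close> takes \<open>(x\<^sub>0, \<dots>, x\<^sub>n\<^sub>-\<^sub>1)\<close> to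
  \<open>t (x\<^bsub>inv \<sigma> 0\<^esub>, \<dots>, x\<^bsub>inv \<sigma> (n - 1)\<^esub>)\<close>, leaf \<open>i\<close> is relabelled by \<open>inv \<sigma> i\<close>.
\<close>

definition free_operad :: "('g \<Rightarrow> nat) \<Rightarrow> ('k::field, 'g tree \<Rightarrow>\<^sub>0 'k) operad"
  where "free_operad ar =
    \<lparr>op_space = (\<lambda>n. span_space (tree_monomials ar n)),
     op_unit = Poly_Mapping.single (Leaf 0) 1,
     op_comp = (\<lambda>ks p qs.
        \<Sum>t\<in>Poly_Mapping.keys p. \<Sum>ss\<in>listset (map Poly_Mapping.keys qs).
          Poly_Mapping.single (tree_comp ks t ss)
            (Poly_Mapping.lookup p t * prod_list (map2 Poly_Mapping.lookup qs ss))),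
     op_act = (\<lambda>n p \<sigma>.
        linear_extension (\<lambda>t. Poly_Mapping.single (relabel (Hilbert_Choice.inv \<sigma>) t) 1) p)\<rparr>"

definition free_gen :: "('g \<Rightarrow> nat) \<Rightarrow> 'g \<Rightarrow> ('g tree \<Rightarrow>\<^sub>0 'k::field)"
  where "free_gen ar g = Poly_Mapping.single (Node g (map Leaf [0..<ar g])) 1"

definition presented_operad ::
    "('g \<Rightarrow> nat) \<Rightarrow> (nat \<times> ('g tree \<Rightarrow>\<^sub>0 'k::field)) set \<Rightarrow> ('k, ('g tree \<Rightarrow>\<^sub>0 'k) set) operad"
  where "presented_operad ar R =
    quotient_operad (free_operad ar) (generated_ideal (free_operad ar) R)"

definition presented_gen ::
    "('g \<Rightarrow> nat) \<Rightarrow> (nat \<times> ('g tree \<Rightarrow>\<^sub>0 'k::field)) set \<Rightarrow> 'g \<Rightarrow> ('g tree \<Rightarrow>\<^sub>0 'k) set"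
  where "presented_gen ar R g =
    generated_ideal (free_operad ar) R (ar g)
      +>\<^bsub>op_space (free_operad ar :: ('k, 'g tree \<Rightarrow>\<^sub>0 'k) operad) (ar g)\<^esub> free_gen ar g"


section \<open>The operad of commutative associative differential algebras\<close>

datatype cda_generator = Deriv | Mult

fun cda_arity :: "cda_generator \<Rightarrow> nat"
  where
    "cda_arity Deriv = 1"
  | "cda_arity Mult = 2"

definition cda_relations :: "(nat \<times> (cda_generator tree \<Rightarrow>\<^sub>0 'k::field)) set"
  where "cda_relations =
    (let F = free_operad cda_arity; d = free_gen cda_arity Deriv; m = free_gen cda_arity Mult in
     {(2, op_act F 2 m (Transposition.transpose 0 1) - m),
      (3, partial_comp F 2 2 m 1 m - partial_comp F 2 2 m 2 m),
      (2, partial_comp F 1 2 d 1 m - (partial_comp F 2 1 m 1 d + partial_comp F 2 1 m 2 d))})"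

definition CDA :: "('k::field, (cda_generator tree \<Rightarrow>\<^sub>0 'k) set) operad"
  where "CDA = presented_operad cda_arity cda_relations"

definition CDA_deriv :: "(cda_generator tree \<Rightarrow>\<^sub>0 'k::field) set"
  where "CDA_deriv = presented_gen cda_arity cda_relations Deriv"

definition CDA_mult :: "(cda_generator tree \<Rightarrow>\<^sub>0 'k::field) set"
  where "CDA_mult = presented_gen cda_arity cda_relations Mult"


section \<open>The operad of noncommutative multi-indices\<close>

text \<open>
  The word \<open>X\<^bsub>i\<^sub>1\<^esub> \<cdots> X\<^bsub>i\<^sub>n\<^esub>\<close> is the list \<open>[i\<^sub>1, \<dots>, i\<^sub>n]\<close>.  Words form a monoid under concatenation,
  written additively as required by the convolution product of \<^typ>\<open>'a \<Rightarrow>\<^sub>0 'b\<close>; thus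
  \<^typ>\<open>nat list \<Rightarrow>\<^sub>0 'k\<close> is the (unitary) free associative algebra on the \<open>X\<^sub>i\<close>.
\<close>

instantiation list :: (type) monoid_add
begin

definition zero_list :: "'a list" where "zero_list = []"

definition plus_list :: "'a list \<Rightarrow> 'a list \<Rightarrow> 'a list" where "plus_list = (@)"

instance
  by intro_classes (simp_all add: zero_list_def plus_list_def)

end

definition indet :: "nat \<Rightarrow> (nat list \<Rightarrow>\<^sub>0 'k::field)"
  where "indet i = Poly_Mapping.single [i] 1"

fun D_word :: "nat list \<Rightarrow> (nat list \<Rightarrow>\<^sub>0 'k::field)"
  where
    "D_word [] = 0"
  | "D_word (i # w) = indet (Suc i) * Poly_Mapping.single w 1 + indet i * D_word w"

text \<open>
  The derivation \<open>D\<close> of the free algebra with \<open>D X\<^sub>i = X\<^bsub>i + 1\<^esub>\<close>; see \<open>D_indet\<close>, \<open>D_add\<close>,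
  \<open>D_scale\<close> and \<open>D_mult\<close> below.
\<close>

definition D :: "(nat list \<Rightarrow>\<^sub>0 'k::field) \<Rightarrow> (nat list \<Rightarrow>\<^sub>0 'k)"
  where "D = linear_extension D_word"

lemma lookup_scale: "Poly_Mapping.lookup (scale c x) b = c * Poly_Mapping.lookup x b"
  by (auto simp: scale_def map.rep_eq when_def)

lemma scale_conv_mult_left: "scale c x = Poly_Mapping.single 0 c * x"
  for x :: "'b::monoid_add \<Rightarrow>\<^sub>0 'k::field"
  by (simp add: scale_def mult_map_scale_conv_mult)

lemma scale_add: "scale c (x + y) = scale c x + scale c y"
  by (rule poly_mapping_eqI) (simp add: lookup_scale lookup_add algebra_simps)

lemma scale_add_left: "scale (a + b) x = scale a x + scale b x"
  by (rule poly_mapping_eqI) (simp add: lookup_scale lookup_add algebra_simps)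

lemma scale_zero [simp]: "scale 0 x = 0"
  by (rule poly_mapping_eqI) (simp add: lookup_scale)

lemma scale_zero_right [simp]: "scale c 0 = 0"
  by (rule poly_mapping_eqI) (simp add: lookup_scale)

lemma scale_scale: "scale a (scale b x) = scale (a * b) x"
  by (rule poly_mapping_eqI) (simp add: lookup_scale algebra_simps)

lemma scale_commute: "scale a (scale b x) = scale b (scale a x)"
  by (simp add: scale_scale mult.commute)

lemma scale_one [simp]: "scale 1 x = x"
  by (rule poly_mapping_eqI) (simp add: lookup_scale)

lemma scale_single: "scale c (Poly_Mapping.single b d) = Poly_Mapping.single b (c * d)"
  by (rule poly_mapping_eqI) (simp add: lookup_scale lookup_single when_def)

lemma linear_extension_superset:
  assumes "finite B" "Poly_Mapping.keys x \<subseteq> B"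
  shows "linear_extension f x = (\<Sum>b\<in>B. scale (Poly_Mapping.lookup x b) (f b))"
  unfolding linear_extension_def using assms
  by (intro sum.mono_neutral_left) (auto simp: in_keys_iff)

lemma linear_extension_add:
  "linear_extension f (x + y) = linear_extension f x + linear_extension f y"
proof -
  let ?B = "Poly_Mapping.keys x \<union> Poly_Mapping.keys y"
  have "Poly_Mapping.keys (x + y) \<subseteq> ?B" by (rule Poly_Mapping.keys_add)
  then show ?thesis
    by (simp add: linear_extension_superset [of ?B] lookup_add scale_add_left sum.distrib)
qed

lemma linear_extension_single:
  "linear_extension f (Poly_Mapping.single b c) = scale c (f b)"
  by (simp add: linear_extension_superset [of "{b}"])

lemma poly_mapping_add_induct [case_names zero single add]:
  assumes "P 0" "\<And>b c. P (Poly_Mapping.single b c)" "\<And>x y. P x \<Longrightarrow> P y \<Longrightarrow> P (x + y)"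
  shows "P (x :: 'b \<Rightarrow>\<^sub>0 'k::field)"
proof (induction x rule: update_induct)
  case (update f a b)
  have "Poly_Mapping.update a b f = f + Poly_Mapping.single a b"
    using update(1)
    by (intro poly_mapping_eqI) (auto simp: lookup_update lookup_add lookup_single when_def in_keys_iff)
  then show ?case using update(3) assms by simp
qed (rule assms(1))

lemma single_zero_commute:
  "x * Poly_Mapping.single 0 c = Poly_Mapping.single 0 c * x"
  for x :: "'b::monoid_add \<Rightarrow>\<^sub>0 'k::field"
  by (induction x rule: poly_mapping_add_induct) (simp_all add: mult_single algebra_simps)

lemma scale_mult_left: "scale c (x * y) = scale c x * y"
  for x :: "'b::monoid_add \<Rightarrow>\<^sub>0 'k::field"
  by (simp add: scale_conv_mult_left mult.assoc)

lemma scale_mult_right: "scale c (x * y) = x * scale c y"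
  for x :: "'b::monoid_add \<Rightarrow>\<^sub>0 'k::field"
  by (metis scale_conv_mult_left mult.assoc single_zero_commute)

lemma D_add: "D (x + y) = D x + D y"
  by (simp add: D_def linear_extension_add)

lemma D_scale: "D (scale c x) = scale c (D x)"
proof (induction x rule: poly_mapping_add_induct)
  case (single b d)
  then show ?case by (simp add: D_def linear_extension_single scale_single scale_scale)
next
  case (add x y)
  then show ?case by (simp add: scale_add D_add)
qed (simp add: D_def linear_extension_def)

lemma D_indet: "D (indet i) = indet (Suc i)"
  by (simp add: D_def indet_def linear_extension_single mult_single plus_list_def)

lemma D_word_append:
  "D_word (u @ v) = D_word u * Poly_Mapping.single v 1 + Poly_Mapping.single u 1 * D_word v"
proof (induction u)
  case Nil
  have "Poly_Mapping.single ([] :: nat list) (1 :: 'a) = 1"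
    by (metis single_one zero_list_def)
  then show ?case by simp
next
  case (Cons i u)
  have "Poly_Mapping.single (i # u) 1 = indet i * Poly_Mapping.single u (1 :: 'a)"
       "Poly_Mapping.single (u @ v) 1 = Poly_Mapping.single u (1 :: 'a) * Poly_Mapping.single v 1"
    by (simp_all add: indet_def mult_single plus_list_def)
  then show ?case by (simp add: Cons algebra_simps)
qed

lemma D_mult: "D (x * y) = D x * y + x * D y"
proof (induction x rule: poly_mapping_add_induct)
  case (single u a)
  show ?case
  proof (induction y rule: poly_mapping_add_induct)
    case (single v b)
    have "scale a (scale b (D_word (u + v))) =
        scale a (D_word u) * scale b (Poly_Mapping.single v 1) +
        scale a (Poly_Mapping.single u 1) * scale b (D_word v)"
      by (simp add: plus_list_def D_word_append scale_add scale_commute [of b a]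
        flip: scale_mult_left scale_mult_right)
    then show ?case
      by (simp add: D_def mult_single linear_extension_single scale_single scale_scale)
  qed (simp_all add: D_add algebra_simps, simp add: D_def linear_extension_def)
qed (simp_all add: D_add algebra_simps, simp add: D_def linear_extension_def)

text \<open>There is nothing in arity \<open>0\<close>: the empty word is excluded.\<close>

definition NMI :: "('k::field, nat list \<Rightarrow>\<^sub>0 'k) operad"
  where "NMI =
    \<lparr>op_space = (\<lambda>n. span_space {w. length w = n \<and> w \<noteq> []}),
     op_unit = indet 0,
     op_comp = (\<lambda>ks p qs.
        linear_extension (\<lambda>w. prod_list (map2 (\<lambda>i q. (D ^^ i) q) w qs)) p),
     op_act = (\<lambda>n p \<sigma>. linear_extension (\<lambda>w. Poly_Mapping.single (permute_list \<sigma> w) 1) p)\<rparr>"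

end

theory Submission
  imports Defs
begin

text \<open>
  A tree over \<open>\<partial>\<close> and \<open>m\<close> is sent to the words recording how often each input is differentiated
  when \<open>\<partial>\<close> acts by the Leibniz rule.  Read along the leaves from left to right, this map replaces a
  leaf by \<open>X\<^sub>0\<close>, \<open>\<partial>\<close> by \<open>D\<close> and \<open>m\<close> by concatenation, so that it respects grafting because composing in
  \<open>NMI\<close> is multiplicative and commutes with \<open>D\<close>; the leaf labels are accounted for by equivariance.
  The map is onto \<open>NMI\<close>, so its kernel is an ideal whose quotient is isomorphic to \<open>NMI\<close>.
  The kernel contains the relations, and any ideal containing the relations identifies each tree with a
  combination of right combs \<open>\<partial>\<^bsup>i\<^sub>1\<^esup>x\<^sub>1 (\<partial>\<^bsup>i\<^sub>2\<^esup>x\<^sub>2 (\<cdots>))\<close>, one for each word; hence the kernel is the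
  generated ideal.  Uniqueness holds because \<open>X\<^sub>1\<close> and \<open>X\<^sub>0X\<^sub>0\<close> generate all words by composition.
\<close>

section \<open>Linear and multilinear maps on basis elements\<close>

text \<open>Two obstacles shape the proof. First, the operad axioms are never verified for the free
  operad: it is only shown closed under its operations. The quotient by the kernel takes its axioms
  from \<open>NMI\<close>, because its elements are the fibers of the value map and its operations
  on fibers are those of \<open>NMI\<close> on values. Second, an ideal contains only combinations
  of trees in which each label below \<open>n\<close> occurs once, whereas rewriting in a subtree
  meets arbitrary labels. The sets \<open>labelled l\<close> are images of the ideal under
  relabelling; closure under the symmetric group makes them depend only on the multiset of
  \<open>l\<close>, and closure under composition lets congruences pass into larger trees. Linear
  independence of the combs is not a separate step: the normal form of \<open>x\<close> is the
  linear map \<open>comb_poly\<close> applied to the value of \<open>x\<close>, so an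
  \<open>x\<close> of value zero is itself in the ideal. Inverse permutations occur because planar
  order lists places of leaves, while position \<open>i\<close> of a word belongs to input
  \<open>i\<close>: words are rearranged by the permutation taking an input to the place of its
  leaf.\<close>

definition is_linear :: "(('b \<Rightarrow>\<^sub>0 'k::field) \<Rightarrow> ('c \<Rightarrow>\<^sub>0 'k)) \<Rightarrow> bool"
  where "is_linear f \<longleftrightarrow> (\<forall>x y. f (x + y) = f x + f y) \<and> (\<forall>c x. f (scale c x) = scale c (f x))"

lemma is_linearI:
  "(\<And>x y. f (x + y) = f x + f y) \<Longrightarrow> (\<And>c x. f (scale c x) = scale c (f x)) \<Longrightarrow> is_linear f"
  by (simp add: is_linear_def)

lemma is_linear_add: "is_linear f \<Longrightarrow> f (x + y) = f x + f y"
  and is_linear_scale: "is_linear f \<Longrightarrow> f (scale c x) = scale c (f x)"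
  by (simp_all add: is_linear_def)

lemma is_linear_zero: "is_linear f \<Longrightarrow> f 0 = 0"
  using is_linear_scale [of f 0 0] by simp

lemma scale_uminus: "scale (- 1) x = - x"
  by (rule poly_mapping_eqI) (simp add: lookup_scale)

lemma is_linear_diff: "is_linear f \<Longrightarrow> f (x - y) = f x - f y"
  using is_linear_add [of f x "- y"] is_linear_scale [of f "- 1" y] by (simp add: scale_uminus)

lemma is_linear_sum: "is_linear f \<Longrightarrow> f (sum g A) = (\<Sum>a\<in>A. f (g a))"
  by (induction A rule: infinite_finite_induct) (simp_all add: is_linear_zero is_linear_add)

lemma is_linear_compose: "is_linear f \<Longrightarrow> is_linear g \<Longrightarrow> is_linear (\<lambda>x. f (g x))"
  by (simp add: is_linear_def)

lemma is_linear_id: "is_linear (\<lambda>x. x)"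
  by (simp add: is_linear_def)

lemma is_linear_scale_right: "is_linear (scale c)"
  by (simp add: is_linear_def scale_add scale_commute)

lemma is_linear_linear_extension: "is_linear (linear_extension f)"
proof (rule is_linearI)
  show "linear_extension f (scale c x) = scale c (linear_extension f x)" for c x
  proof (induction x rule: poly_mapping_add_induct)
    case zero
    show ?case by (simp add: linear_extension_def)
  qed (simp_all add: linear_extension_single scale_single scale_scale scale_add linear_extension_add)
qed (rule linear_extension_add)

lemma linear_extension_zero [simp]: "linear_extension f 0 = 0"
  by (simp add: linear_extension_def)

lemma linear_extension_basis [simp]:
  "linear_extension f (Poly_Mapping.single b 1) = f b"
  by (simp add: linear_extension_single)

lemma is_linear_conv_linear_extension:
  assumes "is_linear f"
  shows "f x = linear_extension (\<lambda>b. f (Poly_Mapping.single b 1)) x"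
proof (induction x rule: poly_mapping_add_induct)
  case (single b c)
  have "f (Poly_Mapping.single b c) = scale c (f (Poly_Mapping.single b 1))"
    using is_linear_scale [OF assms, of c "Poly_Mapping.single b 1"] by (simp add: scale_single)
  then show ?case by (simp add: linear_extension_single)
qed (simp_all add: assms is_linear_zero is_linear_add linear_extension_add)

lemma linear_extension_cong:
  "(\<And>b. b \<in> Poly_Mapping.keys x \<Longrightarrow> f b = g b) \<Longrightarrow> linear_extension f x = linear_extension g x"
  by (simp add: linear_extension_def)

text \<open>Agreement is only asked for on the support of the single element \<open>x\<close>, so
  facts about the words or trees occurring in \<open>x\<close>, such as their length, are available
  in the basis case.\<close>

lemma is_linear_ext:
  assumes "is_linear f" "is_linear g"
    and "\<And>b. b \<in> Poly_Mapping.keys x \<Longrightarrow> f (Poly_Mapping.single b 1) = g (Poly_Mapping.single b 1)"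
  shows "f x = g x"
  using assms(3) is_linear_conv_linear_extension [OF assms(1), of x]
    is_linear_conv_linear_extension [OF assms(2), of x]
  by (metis (mono_tags, lifting) linear_extension_cong)

lemma linear_extension_linear_extension:
  "is_linear f \<Longrightarrow> f (linear_extension g x) = linear_extension (\<lambda>b. f (g b)) x"
  by (rule is_linear_ext [where x = x]) (simp_all add: is_linear_compose is_linear_linear_extension)

lemma linear_extension_self: "linear_extension (\<lambda>b. Poly_Mapping.single b 1) x = x"
  by (rule is_linear_conv_linear_extension [OF is_linear_id, symmetric])

lemma linear_extension_fun_add:
  "linear_extension (\<lambda>b. f b + g b) x = linear_extension f x + linear_extension g x"
  by (simp add: linear_extension_def scale_add sum.distrib)

lemma linear_extension_fun_scale:
  "linear_extension (\<lambda>b. scale c (f b)) x = scale c (linear_extension f x)"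
  by (simp add: linear_extension_def scale_commute is_linear_sum [OF is_linear_scale_right])

lemma keys_scale: "Poly_Mapping.keys (scale c x) \<subseteq> Poly_Mapping.keys x"
  by (auto simp: in_keys_iff lookup_scale)

lemma keys_linear_extension:
  "Poly_Mapping.keys (linear_extension f x) \<subseteq> (\<Union>b\<in>Poly_Mapping.keys x. Poly_Mapping.keys (f b))"
proof -
  have "Poly_Mapping.keys (linear_extension f x) \<subseteq>
      (\<Union>b\<in>Poly_Mapping.keys x. Poly_Mapping.keys (scale (Poly_Mapping.lookup x b) (f b)))"
    unfolding linear_extension_def by (rule Poly_Mapping.keys_sum)
  then show ?thesis using keys_scale by fastforce
qed

text \<open>Arguments are replaced by basis elements one position at a time, starting from the last;
  \<open>B i\<close> carries what is known about the support of argument \<open>i\<close>.\<close>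

lemma multilinear_ext:
  fixes F G :: "('b \<Rightarrow>\<^sub>0 'k::field) list \<Rightarrow> ('c \<Rightarrow>\<^sub>0 'k)"
  assumes F: "\<And>qs i. length qs = n \<Longrightarrow> i < n \<Longrightarrow> is_linear (\<lambda>q. F (qs[i := q]))"
    and G: "\<And>qs i. length qs = n \<Longrightarrow> i < n \<Longrightarrow> is_linear (\<lambda>q. G (qs[i := q]))"
    and FG: "\<And>bs. length bs = n \<Longrightarrow> (\<And>i. i < n \<Longrightarrow> bs ! i \<in> B i) \<Longrightarrow>
      F (map (\<lambda>b. Poly_Mapping.single b 1) bs) = G (map (\<lambda>b. Poly_Mapping.single b 1) bs)"
    and qs: "length qs = n" "\<And>i. i < n \<Longrightarrow> Poly_Mapping.keys (qs ! i) \<subseteq> B i"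
  shows "F qs = G qs"
proof -
  \<comment> \<open>\<open>k\<close> counts the leading arguments that are still arbitrary, those
    from position \<open>k\<close> on being basis elements: \<open>k = n\<close> is the claim and
    \<open>k = 0\<close> is the hypothesis \<open>FG\<close>.\<close>
  have "F qs = G qs" if "k \<le> n" "length qs = n" "\<And>i. i < n \<Longrightarrow> Poly_Mapping.keys (qs ! i) \<subseteq> B i"
    "\<And>i. k \<le> i \<Longrightarrow> i < n \<Longrightarrow> \<exists>b. qs ! i = Poly_Mapping.single b 1" for k qs
    using that
  proof (induction k arbitrary: qs)
    case 0
    from 0(4) obtain b where b: "\<And>i. i < n \<Longrightarrow> qs ! i = Poly_Mapping.single (b i) 1"
      by (metis le0)
    have "b i \<in> B i" if "i < n" for i
      using 0(3) [OF that] b [OF that] by simp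
    moreover have "qs = map (\<lambda>b. Poly_Mapping.single b 1) (map b [0..<n])"
      using 0(2) b by (intro nth_equalityI) auto
    ultimately show ?case using FG [of "map b [0..<n]"] by simp
  next
    case (Suc k)
    then have k: "k < n" by simp
    \<comment> \<open>Inserting the entry that is already there exposes position \<open>k\<close> as
      the linear variable.\<close>
    have "F (qs[k := qs ! k]) = G (qs[k := qs ! k])"
    proof (rule is_linear_ext [where f = "\<lambda>q. F (qs[k := q])" and g = "\<lambda>q. G (qs[k := q])"])
      show "F (qs[k := Poly_Mapping.single b 1]) = G (qs[k := Poly_Mapping.single b 1])"
        if "b \<in> Poly_Mapping.keys (qs ! k)" for b
      proof (rule Suc.IH)
        show "Poly_Mapping.keys (qs[k := Poly_Mapping.single b 1] ! i) \<subseteq> B i" if "i < n" for i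
          using Suc.prems(2) Suc.prems(3) [OF that] k \<open>b \<in> _\<close> by (cases "i = k") auto
        show "\<exists>c. qs[k := Poly_Mapping.single b 1] ! i = Poly_Mapping.single c 1"
          if "k \<le> i" "i < n" for i
          using Suc.prems(2) Suc.prems(4) [of i] k that by (cases "i = k") auto
      qed (use k Suc.prems in auto)
    qed (use F G k Suc.prems in auto)
    then show ?case by simp
  qed
  from this [of n] qs show ?thesis by auto
qed

lemma is_linear_prod_list_update:
  fixes xs :: "('b::monoid_add \<Rightarrow>\<^sub>0 'k::field) list"
  assumes "i < length xs"
  shows "is_linear (\<lambda>q. prod_list (xs[i := q]))"
  using assms
proof (induction xs arbitrary: i)
  case (Cons x xs)
  show ?case
  proof (cases i)
    case 0
    then show ?thesis by (auto intro!: is_linearI simp: algebra_simps scale_mult_left)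
  next
    case (Suc j)
    then have "is_linear (\<lambda>q. prod_list (xs[j := q]))" using Cons by simp
    then show ?thesis using Suc by (auto intro!: is_linearI simp: is_linear_def algebra_simps scale_mult_right)
  qed
qed simp

lemma is_linear_mult_left: "is_linear (\<lambda>x. x * y)"
  and is_linear_mult_right: "is_linear (\<lambda>x. y * x)"
  for y :: "'b::monoid_add \<Rightarrow>\<^sub>0 'k::field"
  by (auto intro!: is_linearI simp: algebra_simps scale_mult_left, metis scale_mult_right scale_mult_left)

section \<open>Vector spaces with a basis\<close>

lemma carrier_span_space [simp]: "carrier (span_space B) = {x. Poly_Mapping.keys x \<subseteq> B}"
  and add_span_space [simp]: "x \<oplus>\<^bsub>span_space B\<^esub> y = x + y"
  and zero_span_space [simp]: "\<zero>\<^bsub>span_space B\<^esub> = 0"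
  and smult_span_space [simp]: "c \<odot>\<^bsub>span_space B\<^esub> x = scale c x"
  by (simp_all add: span_space_def)

lemma keys_add_subset: "Poly_Mapping.keys x \<subseteq> B \<Longrightarrow> Poly_Mapping.keys y \<subseteq> B \<Longrightarrow> Poly_Mapping.keys (x + y) \<subseteq> B"
  using Poly_Mapping.keys_add [of x y] by blast

lemma keys_scale_subset: "Poly_Mapping.keys x \<subseteq> B \<Longrightarrow> Poly_Mapping.keys (scale c x) \<subseteq> B"
  using keys_scale [of c x] by blast

lemma keys_diff_subset:
  fixes x y :: "'b \<Rightarrow>\<^sub>0 'k::field"
  shows "Poly_Mapping.keys x \<subseteq> B \<Longrightarrow> Poly_Mapping.keys y \<subseteq> B \<Longrightarrow> Poly_Mapping.keys (x - y) \<subseteq> B"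
  using keys_add_subset [of x B "scale (- 1) y"] by (simp add: keys_scale_subset scale_uminus)

lemma keys_linear_extension_subset:
  "(\<And>b. b \<in> Poly_Mapping.keys x \<Longrightarrow> Poly_Mapping.keys (f b) \<subseteq> B) \<Longrightarrow>
    Poly_Mapping.keys (linear_extension f x) \<subseteq> B"
  using keys_linear_extension [of f x] by blast

lemma module_scalars_iff_abelian_group:
  "module (scalars :: 'k::field ring) M \<longleftrightarrow> abelian_group M \<and>
    (\<forall>(a :: 'k). \<forall>x\<in>carrier M. a \<odot>\<^bsub>M\<^esub> x \<in> carrier M) \<and>
    (\<forall>(a :: 'k) b. \<forall>x\<in>carrier M. (a + b) \<odot>\<^bsub>M\<^esub> x = a \<odot>\<^bsub>M\<^esub> x \<oplus>\<^bsub>M\<^esub> b \<odot>\<^bsub>M\<^esub> x) \<and>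
    (\<forall>(a :: 'k). \<forall>x\<in>carrier M. \<forall>y\<in>carrier M.
       a \<odot>\<^bsub>M\<^esub> (x \<oplus>\<^bsub>M\<^esub> y) = a \<odot>\<^bsub>M\<^esub> x \<oplus>\<^bsub>M\<^esub> a \<odot>\<^bsub>M\<^esub> y) \<and>
    (\<forall>(a :: 'k) b. \<forall>x\<in>carrier M. (a * b) \<odot>\<^bsub>M\<^esub> x = a \<odot>\<^bsub>M\<^esub> (b \<odot>\<^bsub>M\<^esub> x)) \<and>
    (\<forall>x\<in>carrier M. (1 :: 'k) \<odot>\<^bsub>M\<^esub> x = x)"
proof -
  have "cring (scalars :: 'k ring)" by (rule cring_from_type_algebra)
  then show ?thesis
    unfolding module_def module_axioms_def by (simp add: ring_of_type_algebra_def Ball_def)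
qed

lemma module_span_space: "module scalars (span_space B :: ('k::field, 'b \<Rightarrow>\<^sub>0 'k) module)"
proof -
  have "abelian_group (span_space B :: ('k, 'b \<Rightarrow>\<^sub>0 'k) module)"
  proof (rule abelian_groupI)
    fix x :: "'b \<Rightarrow>\<^sub>0 'k" assume "x \<in> carrier (span_space B)"
    then show "\<exists>y\<in>carrier (span_space B :: ('k, 'b \<Rightarrow>\<^sub>0 'k) module). y \<oplus>\<^bsub>span_space B\<^esub> x = \<zero>\<^bsub>span_space B\<^esub>"
      by (intro bexI [of _ "- x"]) auto
  qed (auto simp: keys_add_subset algebra_simps)
  then show ?thesis
    unfolding module_scalars_iff_abelian_group
    by (auto simp: keys_scale_subset scale_add scale_add_left scale_scale)
qed

lemma linear_maps_span_spaceI: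
  assumes "\<And>x y. Poly_Mapping.keys x \<subseteq> B \<Longrightarrow> Poly_Mapping.keys y \<subseteq> B \<Longrightarrow> f (x + y) = f x + f y"
    and "\<And>c x. Poly_Mapping.keys x \<subseteq> B \<Longrightarrow> f (scale c x) = scale c (f x)"
    and "\<And>x. Poly_Mapping.keys x \<subseteq> B \<Longrightarrow> Poly_Mapping.keys (f x) \<subseteq> C"
  shows "f \<in> linear_maps (span_space B) (span_space C)"
  using assms by (auto simp: linear_maps_def)

lemma is_linear_imp_linear_maps:
  assumes "is_linear f" "\<And>x. Poly_Mapping.keys x \<subseteq> B \<Longrightarrow> Poly_Mapping.keys (f x) \<subseteq> C"
  shows "f \<in> linear_maps (span_space B) (span_space C)"
  using assms by (intro linear_maps_span_spaceI) (auto simp: is_linear_def)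

section \<open>Block permutations\<close>

lemma offset_0 [simp]: "offset ks 0 = 0"
  by (simp add: offset_def)

lemma offset_Suc: "i < length ks \<Longrightarrow> offset ks (Suc i) = offset ks i + ks ! i"
  by (simp add: offset_def take_Suc_conv_app_nth)

lemma offset_mono: "i \<le> j \<Longrightarrow> offset ks i \<le> offset ks j"
proof (induction j)
  case (Suc j)
  have "offset ks j \<le> offset ks (Suc j)"
    by (cases "j < length ks") (auto simp: offset_Suc, simp add: offset_def)
  with Suc show ?case by (cases "i = Suc j") auto
qed simp

lemma offset_length: "offset ks (length ks) = sum_list ks"
  by (simp add: offset_def)

lemma offset_less:
  assumes "i < length ks" "r < ks ! i"
  shows "offset ks i + r < sum_list ks"
  using offset_mono [of "Suc i" "length ks" ks] assms by (simp add: offset_Suc offset_length)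

lemma offset_Cons_Suc: "offset (k # ks) (Suc i) = k + offset ks i"
  by (simp add: offset_def)

lemma offsetE:
  assumes "x < sum_list ks"
  obtains i r where "i < length ks" "r < ks ! i" "x = offset ks i + r"
proof -
  have "\<exists>i r. i < length ks \<and> r < ks ! i \<and> x = offset ks i + r"
    using assms
  proof (induction ks arbitrary: x)
    case (Cons k ks)
    show ?case
    proof (cases "x < k")
      case True
      then show ?thesis by (intro exI [of _ 0] exI [of _ x]) simp
    next
      case False
      with Cons.prems have "x - k < sum_list ks" by simp
      then obtain i r where "i < length ks" "r < ks ! i" "x - k = offset ks i + r"
        using Cons.IH by blast
      with False show ?thesis
        by (intro exI [of _ "Suc i"] exI [of _ r]) (simp add: offset_Cons_Suc)
    qed
  qed simp
  then show ?thesis using that by blast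
qed

text \<open>By \<open>offsetE\<close> every position below \<open>sum_list ks\<close> has the form
  \<open>offset ks i + r\<close>. On this form the \<open>LEAST\<close> in \<open>block_perm\<close>
  can be evaluated, and later reasoning about positions in range goes through this equation.\<close>

lemma block_perm_offset:
  assumes "i < length ks" "r < ks ! i"
  shows "block_perm ks \<sigma> \<tau> (offset ks i + r) =
    offset (permute_list (Hilbert_Choice.inv \<sigma>) ks) (\<sigma> i) + \<tau> i r"
proof -
  have "(LEAST j. offset ks i + r < offset ks (Suc j)) = i"
  proof (rule Least_equality)
    show "offset ks i + r < offset ks (Suc i)" using assms by (simp add: offset_Suc)
    show "i \<le> j" if "offset ks i + r < offset ks (Suc j)" for j
      using offset_mono [of "Suc j" i ks] that by (cases "i \<le> j") auto
  qed
  then show ?thesis using offset_less [OF assms] by (simp add: block_perm_def Let_def)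
qed

lemma nth_concat_offset:
  assumes "i < length xss" "r < length (xss ! i)" "map length xss = ks"
  shows "concat xss ! (offset ks i + r) = xss ! i ! r"
  using assms
proof (induction xss arbitrary: i ks)
  case (Cons xs xss)
  then show ?case
    by (cases i) (auto simp: nth_append offset_Cons_Suc)
qed simp

lemma length_concat_sum_list: "length (concat xss) = sum_list (map length xss)"
  by (simp add: length_concat)

lemma permutes_lessThan_iff: "\<sigma> permutes {..<n} \<Longrightarrow> \<sigma> i < n \<longleftrightarrow> i < n"
  by (metis lessThan_iff permutes_in_image)

lemma sum_list_permute_list:
  fixes ks :: "nat list"
  assumes "\<sigma> permutes {..<length ks}"
  shows "sum_list (permute_list \<sigma> ks) = sum_list ks"
  using mset_permute_list [OF assms] by (metis sum_mset_sum_list)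

lemma permute_list_update:
  assumes "\<sigma> permutes {..<length xs}" "i < length xs"
  shows "permute_list \<sigma> (xs[i := x]) = (permute_list \<sigma> xs)[Hilbert_Choice.inv \<sigma> i := x]"
proof (rule nth_equalityI)
  fix j assume "j < length (permute_list \<sigma> (xs[i := x]))"
  then have j: "j < length xs" by simp
  have "\<sigma> j = i \<longleftrightarrow> Hilbert_Choice.inv \<sigma> i = j"
    using assms(1) by (auto simp: permutes_inv_eq)
  then show "permute_list \<sigma> (xs[i := x]) ! j = (permute_list \<sigma> xs)[Hilbert_Choice.inv \<sigma> i := x] ! j"
    using assms j by (auto simp: permute_list_nth nth_list_update permutes_lessThan_iff)
qed simp

text \<open>On a finite set a surjective self-map suffices. Position \<open>r\<close> of target
  block \<open>j\<close> comes from source block \<open>inv \<sigma> j\<close>, at the place where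
  the inner permutation takes the value \<open>r\<close>.\<close>

lemma block_perm_permutes:
  assumes "\<sigma> permutes {..<length ks}" "\<And>i. i < length ks \<Longrightarrow> \<tau> i permutes {..<ks ! i}"
  shows "block_perm ks \<sigma> \<tau> permutes {..<sum_list ks}"
proof -
  let ?ks = "permute_list (Hilbert_Choice.inv \<sigma>) ks"
  let ?b = "block_perm ks \<sigma> \<tau>"
  note inv = permutes_inv [OF assms(1)]
  have nth: "?ks ! \<sigma> i = ks ! i" if "i < length ks" for i
    using assms(1) inv that
    by (simp add: permute_list_nth permutes_lessThan_iff permutes_inverses)
  have less: "?b x < sum_list ks" if "x < sum_list ks" for x
    using that
  proof (cases rule: offsetE)
    case (1 i r)
    then have "\<tau> i r < ?ks ! \<sigma> i" using assms(2) by (simp add: nth permutes_lessThan_iff)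
    moreover have "\<sigma> i < length ?ks" using 1 assms(1) by (simp add: permutes_lessThan_iff)
    ultimately show ?thesis
      using offset_less [of "\<sigma> i" ?ks "\<tau> i r"] 1 inv
      by (simp add: block_perm_offset sum_list_permute_list)
  qed
  have surj: "\<exists>x<sum_list ks. ?b x = y" if "y < sum_list ks" for y
  proof -
    from that have "y < sum_list ?ks" using inv by (simp add: sum_list_permute_list)
    then obtain j r where jr: "j < length ?ks" "r < ?ks ! j" "y = offset ?ks j + r"
      by (rule offsetE)
    let ?i = "Hilbert_Choice.inv \<sigma> j" let ?r = "Hilbert_Choice.inv (\<tau> ?i) r"
    have i: "?i < length ks" using jr inv by (simp add: permutes_lessThan_iff)
    have "r < ks ! ?i" using jr inv by (simp add: permute_list_nth)
    then have r: "?r < ks ! ?i" using permutes_inv [OF assms(2) [OF i]] by (simp add: permutes_lessThan_iff)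
    have "?b (offset ks ?i + ?r) = y"
      using jr permutes_inverses [OF assms(1)] permutes_inverses [OF assms(2) [OF i]]
      by (simp add: block_perm_offset [OF i r])
    with offset_less [OF i r] show ?thesis by blast
  qed
  have "?b ` {..<sum_list ks} = {..<sum_list ks}"
    using less surj by (force simp: image_iff)
  then have "bij_betw ?b {..<sum_list ks} {..<sum_list ks}"
    by (simp add: bij_betw_def eq_card_imp_inj_on)
  moreover have "?b x = x" if "x \<notin> {..<sum_list ks}" for x
    using that by (simp add: block_perm_def)
  ultimately show ?thesis by (rule bij_imp_permutes)
qed

section \<open>The operad of multi-indices\<close>

abbreviation word_act :: "(nat \<Rightarrow> nat) \<Rightarrow> (nat list \<Rightarrow>\<^sub>0 'k::field) \<Rightarrow> (nat list \<Rightarrow>\<^sub>0 'k)"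
  where "word_act \<sigma> \<equiv> linear_extension (\<lambda>w. Poly_Mapping.single (permute_list \<sigma> w) 1)"

text \<open>The composition of \<open>NMI\<close> stripped of the arities, on which it does not
  depend. Since \<open>map2\<close> truncates, most facts about it require every word of
  \<open>p\<close> to have as many letters as there are arguments.\<close>

definition word_comp :: "(nat list \<Rightarrow>\<^sub>0 'k::field) \<Rightarrow> (nat list \<Rightarrow>\<^sub>0 'k) list \<Rightarrow> (nat list \<Rightarrow>\<^sub>0 'k)"
  where "word_comp p qs = linear_extension (\<lambda>w. prod_list (map2 (\<lambda>i q. (D ^^ i) q) w qs)) p"

abbreviation words :: "nat \<Rightarrow> nat list set"
  where "words n \<equiv> {w. length w = n}"

lemma NMI_simps:
  "op_space NMI n = span_space {w. length w = n \<and> w \<noteq> []}"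
  "op_unit NMI = indet 0"
  "op_comp NMI ks p qs = word_comp p qs"
  "op_act NMI n p \<sigma> = word_act \<sigma> p"
  by (simp_all add: NMI_def word_comp_def)

section \<open>Substitution into words and its compatibility with products and
  \<open>D\<close>\<close>

lemma is_linear_D: "is_linear D"
  by (simp add: is_linearI D_add D_scale)

lemma is_linear_D_funpow: "is_linear (D ^^ n)"
proof (induction n)
  case (Suc n)
  then show ?case using is_linear_compose [OF is_linear_D] by (simp add: comp_def)
qed (simp add: is_linear_def)

lemma is_linear_word_comp: "is_linear (\<lambda>p. word_comp p qs)"
  unfolding word_comp_def by (rule is_linear_linear_extension)

lemma word_comp_single:
  "word_comp (Poly_Mapping.single w 1) qs = prod_list (map2 (\<lambda>i q. (D ^^ i) q) w qs)"
  by (simp add: word_comp_def)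

lemma D_single: "D (Poly_Mapping.single w 1) = D_word w"
  by (simp add: D_def)

lemma single_Cons:
  "Poly_Mapping.single (i # w) 1 = (indet i * Poly_Mapping.single w 1 :: _ \<Rightarrow>\<^sub>0 'k::field)"
  by (simp add: indet_def mult_single plus_list_def)

lemma single_append:
  "Poly_Mapping.single (u @ v) 1 =
    (Poly_Mapping.single u 1 * Poly_Mapping.single v 1 :: 'b list \<Rightarrow>\<^sub>0 'k::field)"
  by (simp add: mult_single plus_list_def)

lemma single_Nil: "Poly_Mapping.single [] 1 = (1 :: 'b list \<Rightarrow>\<^sub>0 'k::field)"
  by (metis single_one zero_list_def)

text \<open>As a sum over positions, \<open>D\<close> visibly preserves the length and treats all
  positions alike, which is what commuting with permutations of the letters rests on.\<close>

lemma D_word_eq_sum: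
  "D_word w = (\<Sum>i<length w. Poly_Mapping.single (w[i := Suc (w ! i)]) (1 :: 'k::field))"
proof (induction w)
  case (Cons a w)
  show ?case
    by (simp add: Cons sum.lessThan_Suc_shift single_Cons sum_distrib_left del: sum.lessThan_Suc)
qed simp

lemma keys_D_word: "Poly_Mapping.keys (D_word w :: _ \<Rightarrow>\<^sub>0 'k::field) \<subseteq> words (length w)"
proof -
  have "Poly_Mapping.keys (D_word w :: _ \<Rightarrow>\<^sub>0 'k) \<subseteq>
    (\<Union>i<length w. Poly_Mapping.keys (Poly_Mapping.single (w[i := Suc (w ! i)]) (1 :: 'k)))"
    unfolding D_word_eq_sum by (rule Poly_Mapping.keys_sum)
  then show ?thesis by auto
qed

lemma keys_D:
  assumes "Poly_Mapping.keys p \<subseteq> words n"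
  shows "Poly_Mapping.keys (D p) \<subseteq> words n"
  unfolding D_def
proof (rule keys_linear_extension_subset)
  fix w assume "w \<in> Poly_Mapping.keys p"
  then show "Poly_Mapping.keys (D_word w) \<subseteq> words n" using assms keys_D_word [of w] by auto
qed

lemma keys_D_funpow:
  "Poly_Mapping.keys p \<subseteq> words n \<Longrightarrow> Poly_Mapping.keys ((D ^^ i) p) \<subseteq> words n"
  by (induction i) (simp_all add: keys_D)

lemma keys_times_words:
  assumes "Poly_Mapping.keys p \<subseteq> words m" "Poly_Mapping.keys q \<subseteq> words n"
  shows "Poly_Mapping.keys (p * q) \<subseteq> words (m + n)"
  using assms keys_mult [of p q] by (fastforce simp: plus_list_def)

lemma keys_prod_list_words:
  "list_all2 (\<lambda>k q. Poly_Mapping.keys q \<subseteq> words k) ks qs \<Longrightarrow>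
    Poly_Mapping.keys (prod_list qs) \<subseteq> words (sum_list ks)"
proof (induction rule: list_all2_induct)
  case Nil
  show ?case by (simp add: zero_list_def)
next
  case (Cons k ks q qs)
  then show ?case by (simp add: keys_times_words)
qed

lemma keys_word_comp:
  assumes "Poly_Mapping.keys p \<subseteq> words (length ks)" "list_all2 (\<lambda>k q. Poly_Mapping.keys q \<subseteq> words k) ks qs"
  shows "Poly_Mapping.keys (word_comp p qs) \<subseteq> words (sum_list ks)"
  unfolding word_comp_def
proof (intro keys_linear_extension_subset keys_prod_list_words)
  fix w assume "w \<in> Poly_Mapping.keys p"
  then have "length w = length ks" using assms(1) by auto
  then show "list_all2 (\<lambda>k q. Poly_Mapping.keys q \<subseteq> words k) ks (map2 (\<lambda>i q. (D ^^ i) q) w qs)"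
    using assms(2) by (simp add: list_all2_conv_all_nth keys_D_funpow)
qed

text \<open>A word with at most \<open>i\<close> letters would ignore argument \<open>i\<close> and
  contribute a constant; hence the hypothesis on \<open>keys p\<close>.\<close>

lemma is_linear_word_comp_update:
  assumes "Poly_Mapping.keys p \<subseteq> words (length qs)" "i < length qs"
  shows "is_linear (\<lambda>q. word_comp p (qs[i := q]))"
proof -
  have *: "is_linear (\<lambda>q. prod_list (map2 (\<lambda>i q. (D ^^ i) q) w (qs[i := q])))"
    if "w \<in> Poly_Mapping.keys p" for w
  proof -
    have w: "length w = length qs" using assms that by auto
    have "map2 (\<lambda>i q. (D ^^ i) q) w (qs[i := q]) = (map2 (\<lambda>i q. (D ^^ i) q) w qs)[i := (D ^^ (w ! i)) q]" for q
      using w assms(2) by (intro nth_equalityI) (auto simp: nth_list_update)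
    then show ?thesis
      using is_linear_compose [OF is_linear_prod_list_update is_linear_D_funpow,
          of i "map2 (\<lambda>i q. (D ^^ i) q) w qs" "w ! i"] w assms(2)
      by simp
  qed
  show ?thesis
  proof (rule is_linearI)
    show "word_comp p (qs[i := x + y]) = word_comp p (qs[i := x]) + word_comp p (qs[i := y])" for x y
      unfolding word_comp_def linear_extension_fun_add [symmetric]
      by (rule linear_extension_cong) (simp add: is_linear_add [OF *])
    show "word_comp p (qs[i := scale c x]) = scale c (word_comp p (qs[i := x]))" for c x
      unfolding word_comp_def linear_extension_fun_scale [symmetric]
      by (rule linear_extension_cong) (simp add: is_linear_scale [OF *])
  qed
qed

text \<open>Composition is multiplicative once it is known where the arguments split: the words of
  \<open>p\<close> have length \<open>length rs\<close>, so they consume exactly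
  \<open>rs\<close>.\<close>

lemma word_comp_times:
  assumes "Poly_Mapping.keys p \<subseteq> words (length rs)"
  shows "word_comp (p * q) (rs @ rs') = word_comp p rs * word_comp q rs'"
proof (rule is_linear_ext [where x = p])
  show "is_linear (\<lambda>p. word_comp (p * q) (rs @ rs'))"
    by (intro is_linear_compose [OF is_linear_word_comp] is_linear_mult_left)
  show "is_linear (\<lambda>p. word_comp p rs * word_comp q rs')"
    by (intro is_linear_compose [OF is_linear_mult_left] is_linear_word_comp)
  fix u assume "u \<in> Poly_Mapping.keys p"
  then have u: "length u = length rs" using assms by auto
  show "word_comp (Poly_Mapping.single u 1 * q) (rs @ rs') =
    word_comp (Poly_Mapping.single u 1) rs * word_comp q rs'"
  proof (rule is_linear_ext [where x = q])
    show "is_linear (\<lambda>q. word_comp (Poly_Mapping.single u 1 * q) (rs @ rs'))"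
      by (intro is_linear_compose [OF is_linear_word_comp] is_linear_mult_right)
    show "is_linear (\<lambda>q. word_comp (Poly_Mapping.single u 1) rs * word_comp q rs')"
      by (intro is_linear_compose [OF is_linear_mult_right] is_linear_word_comp)
    show "word_comp (Poly_Mapping.single u 1 * Poly_Mapping.single v 1) (rs @ rs') =
      word_comp (Poly_Mapping.single u 1) rs * word_comp (Poly_Mapping.single v 1) rs'" for v
      using u by (simp add: word_comp_single flip: single_append)
  qed
qed

lemma keys_indet: "Poly_Mapping.keys (indet i :: _ \<Rightarrow>\<^sub>0 'k::field) = {[i]}"
  by (simp add: indet_def)

lemma word_comp_indet: "word_comp (indet i) [q] = (D ^^ i) q"
  by (simp add: indet_def word_comp_single)

text \<open>Substituting \<open>r\<close> sends the letter \<open>X_j\<close> to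
  \<open>D^j r\<close>, hence its derivative \<open>X_(j+1)\<close> to \<open>D\<close> of that.
  Both sides then obey the Leibniz rule, so words are treated letter by letter.\<close>

lemma word_comp_D:
  assumes "Poly_Mapping.keys p \<subseteq> words (length rs)"
  shows "word_comp (D p) rs = D (word_comp p rs)"
proof (rule is_linear_ext [where x = p])
  show "is_linear (\<lambda>p. word_comp (D p) rs)" "is_linear (\<lambda>p. D (word_comp p rs))"
    by (intro is_linear_compose [OF is_linear_word_comp] is_linear_compose [OF is_linear_D]
        is_linear_D is_linear_word_comp)+
  fix w assume "w \<in> Poly_Mapping.keys p"
  then have "length w = length rs" using assms by auto
  then show "word_comp (D (Poly_Mapping.single w 1)) rs = D (word_comp (Poly_Mapping.single w 1) rs)"
    unfolding D_single
  proof (induction w rs rule: list_induct2)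
    case Nil
    have "D (1 :: nat list \<Rightarrow>\<^sub>0 'a) = 0"
      using D_single [of "[]"] by (simp add: single_Nil)
    then show ?case by (simp add: word_comp_def)
  next
    case (Cons i w r rs)
    have [simp]: "word_comp (indet j * q) (r # rs) = (D ^^ j) r * word_comp q rs" for j q
      using word_comp_times [of "indet j" "[r]" q rs] by (simp add: keys_indet word_comp_indet)
    show ?case
      by (simp add: is_linear_add [OF is_linear_word_comp] single_Cons D_mult Cons.IH)
  qed
qed

lemma word_comp_D_funpow:
  "Poly_Mapping.keys p \<subseteq> words (length rs) \<Longrightarrow> word_comp ((D ^^ i) p) rs = (D ^^ i) (word_comp p rs)"
  by (induction i) (simp_all add: word_comp_D keys_D_funpow)

lemma word_comp_one: "word_comp 1 [] = 1"
  using word_comp_single [of "[]" "[]"] by (simp add: single_Nil)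

text \<open>Letter by letter: the factor \<open>D^i q\<close> composed with its share
  \<open>rs\<close> of the inner arguments is \<open>D^i\<close> of the composite, because
  composition commutes with \<open>D\<close>.\<close>

lemma word_comp_assoc:
  assumes "Poly_Mapping.keys p \<subseteq> words (length qs)"
    and "list_all2 (\<lambda>q rs. Poly_Mapping.keys q \<subseteq> words (length rs)) qs rss"
  shows "word_comp (word_comp p qs) (concat rss) = word_comp p (map2 word_comp qs rss)"
proof (rule is_linear_ext [where x = p])
  show "is_linear (\<lambda>p. word_comp (word_comp p qs) (concat rss))"
    by (intro is_linear_compose [OF is_linear_word_comp] is_linear_word_comp)
  show "is_linear (\<lambda>p. word_comp p (map2 word_comp qs rss))"
    by (rule is_linear_word_comp)
  fix w assume "w \<in> Poly_Mapping.keys p"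
  then have "length w = length qs" using assms(1) by auto
  with assms(2) show "word_comp (word_comp (Poly_Mapping.single w 1) qs) (concat rss) =
    word_comp (Poly_Mapping.single w 1) (map2 word_comp qs rss)"
    unfolding word_comp_single
  proof (induction qs rss arbitrary: w rule: list_all2_induct)
    case Nil
    then show ?case by (simp add: word_comp_one)
  next
    case (Cons q qs rs rss)
    then obtain i v where w: "w = i # v" "length v = length qs" by (cases w) auto
    with Cons show ?case
      by (simp add: word_comp_times keys_D_funpow word_comp_D_funpow)
  qed
qed

lemma word_comp_unit_right:
  assumes "Poly_Mapping.keys p \<subseteq> words n"
  shows "word_comp p (replicate n (indet 0)) = p"
proof -
  have D: "(D ^^ i) (indet j) = indet (i + j)" for i j
    by (induction i) (simp_all add: D_indet)
  have "prod_list (map2 (\<lambda>i q. (D ^^ i) q) w (replicate (length w) (indet 0))) = Poly_Mapping.single w 1" for w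
    by (induction w) (simp_all add: single_Nil single_Cons D)
  then have "word_comp p (replicate n (indet 0)) = linear_extension (\<lambda>w. Poly_Mapping.single w 1) p"
    unfolding word_comp_def using assms by (intro linear_extension_cong) auto
  then show ?thesis by (simp add: linear_extension_self)
qed

section \<open>The right action on words and its equivariance\<close>

lemma keys_word_act:
  "Poly_Mapping.keys p \<subseteq> words n \<Longrightarrow> Poly_Mapping.keys (word_act \<sigma> p) \<subseteq> words n"
  by (rule keys_linear_extension_subset) auto

text \<open>\<open>D\<close> raises each position in turn. Raising position \<open>i\<close> before
  permuting is raising position \<open>inv \<sigma> i\<close> afterwards, which only reindexes the
  sum over positions.\<close>

lemma word_act_D:
  fixes p :: "nat list \<Rightarrow>\<^sub>0 'k::field"
  assumes "Poly_Mapping.keys p \<subseteq> words n" "\<sigma> permutes {..<n}"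
  shows "word_act \<sigma> (D p) = D (word_act \<sigma> p)"
proof (rule is_linear_ext [where x = p])
  show "is_linear (\<lambda>p. word_act \<sigma> (D p))" "is_linear (\<lambda>p. D (word_act \<sigma> p))"
    by (intro is_linear_compose [OF is_linear_linear_extension] is_linear_compose [OF is_linear_D]
        is_linear_D is_linear_linear_extension)+
  fix w assume "w \<in> Poly_Mapping.keys p"
  then have w: "length w = n" using assms(1) by auto
  note inv = permutes_inv [OF assms(2)]
  have "word_act \<sigma> (D_word w) =
    (\<Sum>i<n. Poly_Mapping.single (permute_list \<sigma> (w[i := Suc (w ! i)])) (1 :: 'k))"
    by (simp add: D_word_eq_sum w is_linear_sum [OF is_linear_linear_extension])
  also have "\<dots> = (\<Sum>i<n. Poly_Mapping.single ((permute_list \<sigma> w)[Hilbert_Choice.inv \<sigma> i :=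
      Suc (permute_list \<sigma> w ! Hilbert_Choice.inv \<sigma> i)]) 1)"
    using w assms(2) inv permutes_inverses [OF assms(2)]
    by (intro sum.cong) (simp_all add: permute_list_update permute_list_nth permutes_lessThan_iff)
  also have "\<dots> = D_word (permute_list \<sigma> w)"
    unfolding D_word_eq_sum length_permute_list w
    by (rule sum.reindex_bij_betw [OF permutes_imp_bij [OF inv]])
  finally show "word_act \<sigma> (D (Poly_Mapping.single w (1 :: 'k))) = D (word_act \<sigma> (Poly_Mapping.single w 1))"
    by (simp add: D_single)
qed

lemma word_act_D_funpow:
  "Poly_Mapping.keys p \<subseteq> words n \<Longrightarrow> \<sigma> permutes {..<n} \<Longrightarrow>
    word_act \<sigma> ((D ^^ i) p) = (D ^^ i) (word_act \<sigma> p)"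
  by (induction i) (simp_all add: word_act_D [of _ n] keys_D_funpow)

text \<open>Both equivariance axioms reduce to this identity of words: the outer one with every
  \<open>\<tau> i\<close> trivial, the inner one with \<open>\<sigma> = id\<close>.\<close>

lemma permute_list_block_perm:
  assumes "\<sigma> permutes {..<length ks}" "\<And>i. i < length ks \<Longrightarrow> \<tau> i permutes {..<ks ! i}"
    and "map length ws = ks"
  shows "permute_list (block_perm ks \<sigma> \<tau>) (concat (permute_list (Hilbert_Choice.inv \<sigma>) ws)) =
    concat (map (\<lambda>i. permute_list (\<tau> i) (ws ! i)) [0..<length ks])"
    (is "permute_list ?b (concat ?ws) = concat ?vs")
proof (rule nth_equalityI)
  note inv = permutes_inv [OF assms(1)]
  have len: "length ws = length ks" "\<And>i. i < length ks \<Longrightarrow> length (ws ! i) = ks ! i"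
    using assms(3) by (auto simp: list_eq_iff_nth_eq)
  have ws: "map length ?ws = permute_list (Hilbert_Choice.inv \<sigma>) ks"
    using assms(3) inv len by (metis permute_list_map)
  have vs: "map length ?vs = ks"
    by (intro nth_equalityI) (simp_all add: len)
  have len_ws: "length (concat ?ws) = sum_list ks"
    using inv by (simp add: length_concat_sum_list ws sum_list_permute_list)
  then show "length (permute_list ?b (concat ?ws)) = length (concat ?vs)"
    unfolding length_permute_list by (simp only: length_concat_sum_list [of ?vs] vs)
  fix x assume "x < length (permute_list ?b (concat ?ws))"
  then have "x < sum_list ks" using len_ws by simp
  then obtain i r where x: "i < length ks" "r < ks ! i" "x = offset ks i + r" by (rule offsetE)
  have \<sigma>i: "?ws ! \<sigma> i = ws ! i" "\<sigma> i < length ks"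
    using inv assms(1) x len by (simp_all add: permute_list_nth permutes_lessThan_iff permutes_inverses)
  have r: "\<tau> i r < length (?ws ! \<sigma> i)"
    using assms(2) [OF x(1)] x by (simp add: \<sigma>i len permutes_lessThan_iff)
  have "permute_list ?b (concat ?ws) ! x = concat ?ws ! (?b x)"
    using block_perm_permutes [OF assms(1,2)] len_ws \<open>x < sum_list ks\<close>
    by (intro permute_list_nth) auto
  also have "\<dots> = ws ! i ! \<tau> i r"
    using x r \<sigma>i len nth_concat_offset [OF _ _ ws, of "\<sigma> i" "\<tau> i r"]
    by (simp add: block_perm_offset)
  also have "\<dots> = concat ?vs ! x"
    using x len assms(2) [OF x(1)] nth_concat_offset [OF _ _ vs, of i r]
    by (simp add: permute_list_nth)
  finally show "permute_list ?b (concat ?ws) ! x = concat ?vs ! x" .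
qed

lemma prod_list_single:
  "prod_list (map (\<lambda>w. Poly_Mapping.single w 1) ws) = (Poly_Mapping.single (concat ws) 1 :: 'b list \<Rightarrow>\<^sub>0 'k::field)"
  by (induction ws) (simp_all add: single_Nil single_append)

lemma word_act_block_perm:
  fixes qs :: "(nat list \<Rightarrow>\<^sub>0 'k::field) list"
  assumes \<sigma>: "\<sigma> permutes {..<length ks}" and \<tau>: "\<And>i. i < length ks \<Longrightarrow> \<tau> i permutes {..<ks ! i}"
    and qs: "list_all2 (\<lambda>k q. Poly_Mapping.keys q \<subseteq> words k) ks qs"
  shows "prod_list (map (\<lambda>i. word_act (\<tau> i) (qs ! i)) [0..<length ks]) =
    word_act (block_perm ks \<sigma> \<tau>) (prod_list (permute_list (Hilbert_Choice.inv \<sigma>) qs))"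
proof (rule multilinear_ext [where qs = qs and n = "length ks" and B = "\<lambda>i. words (ks ! i)"])
  note inv = permutes_inv [OF \<sigma>]
  show "is_linear (\<lambda>q. prod_list (map (\<lambda>j. word_act (\<tau> j) (qs[i := q] ! j)) [0..<length ks]))"
    if "length qs = length ks" "i < length ks" for qs :: "(nat list \<Rightarrow>\<^sub>0 'k) list" and i
  proof -
    have "map (\<lambda>j. word_act (\<tau> j) (qs[i := q] ! j)) [0..<length ks] =
      (map (\<lambda>j. word_act (\<tau> j) (qs ! j)) [0..<length ks])[i := word_act (\<tau> i) q]" for q
      using that by (intro nth_equalityI) (auto simp: nth_list_update)
    then show ?thesis
      using that by (simp add: is_linear_compose [OF is_linear_prod_list_update is_linear_linear_extension])
  qed
  show "is_linear (\<lambda>q. word_act (block_perm ks \<sigma> \<tau>) (prod_list (permute_list (Hilbert_Choice.inv \<sigma>) (qs[i := q]))))"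
    if "length qs = length ks" "i < length ks" for qs :: "(nat list \<Rightarrow>\<^sub>0 'k) list" and i
    using that inv permutes_inv_inv [OF \<sigma>] \<sigma>
    by (auto simp: permute_list_update permutes_lessThan_iff
      intro!: is_linear_compose [OF is_linear_linear_extension] is_linear_prod_list_update)
  fix ws :: "nat list list"
  assume ws: "length ws = length ks" "\<And>i. i < length ks \<Longrightarrow> ws ! i \<in> words (ks ! i)"
  then have "map length ws = ks" by (intro nth_equalityI) auto
  note block = permute_list_block_perm [of \<sigma> ks \<tau>, OF \<sigma> \<tau> this]
  have "map (\<lambda>i. word_act (\<tau> i) (map (\<lambda>w. Poly_Mapping.single w 1) ws ! i)) [0..<length ks] =
    map (\<lambda>w. Poly_Mapping.single w (1 :: 'k)) (map (\<lambda>i. permute_list (\<tau> i) (ws ! i)) [0..<length ks])"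
    using ws by simp
  moreover have "permute_list (Hilbert_Choice.inv \<sigma>) (map (\<lambda>w. Poly_Mapping.single w (1 :: 'k)) ws) =
    map (\<lambda>w. Poly_Mapping.single w 1) (permute_list (Hilbert_Choice.inv \<sigma>) ws)"
    using ws inv by (simp add: permute_list_map)
  ultimately show "prod_list (map (\<lambda>i. word_act (\<tau> i) (map (\<lambda>w. Poly_Mapping.single w (1 :: 'k)) ws ! i)) [0..<length ks]) =
    word_act (block_perm ks \<sigma> \<tau>)
      (prod_list (permute_list (Hilbert_Choice.inv \<sigma>) (map (\<lambda>w. Poly_Mapping.single w 1) ws)))"
    by (simp only: prod_list_single block linear_extension_basis)
qed (use qs in \<open>auto simp: list_all2_conv_all_nth\<close>)


text \<open>Since \<open>D\<close> commutes with the action, the powers of \<open>D\<close>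
  prescribed by the letters of \<open>w\<close> can be applied before the inner permutations; what
  remains is the block identity.\<close>

lemma word_comp_inner:
  assumes p: "Poly_Mapping.keys p \<subseteq> words (length ks)"
    and \<tau>: "\<And>i. i < length ks \<Longrightarrow> \<tau> i permutes {..<ks ! i}"
    and qs: "list_all2 (\<lambda>k q. Poly_Mapping.keys q \<subseteq> words k) ks qs"
  shows "word_comp p (map (\<lambda>i. word_act (\<tau> i) (qs ! i)) [0..<length ks]) =
    word_act (block_perm ks id \<tau>) (word_comp p qs)"
proof (rule is_linear_ext [where x = p])
  fix w assume "w \<in> Poly_Mapping.keys p"
  then have w: "length w = length ks" using p by auto
  let ?qs = "map2 (\<lambda>i q. (D ^^ i) q) w qs"
  have len: "length qs = length ks" "\<And>i. i < length ks \<Longrightarrow> Poly_Mapping.keys (qs ! i) \<subseteq> words (ks ! i)"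
    using qs by (auto simp: list_all2_conv_all_nth)
  have "map2 (\<lambda>i q. (D ^^ i) q) w (map (\<lambda>i. word_act (\<tau> i) (qs ! i)) [0..<length ks]) =
    map (\<lambda>i. word_act (\<tau> i) (?qs ! i)) [0..<length ks]"
    using w len(1) by (intro nth_equalityI) (simp_all add: word_act_D_funpow [OF len(2) \<tau>])
  moreover have "list_all2 (\<lambda>k q. Poly_Mapping.keys q \<subseteq> words k) ks ?qs"
    using w len by (simp add: list_all2_conv_all_nth keys_D_funpow)
  ultimately show "word_comp (Poly_Mapping.single w 1) (map (\<lambda>i. word_act (\<tau> i) (qs ! i)) [0..<length ks]) =
    word_act (block_perm ks id \<tau>) (word_comp (Poly_Mapping.single w 1) qs)"
    using word_act_block_perm [of id ks \<tau> ?qs] \<tau> by (simp add: word_comp_single permutes_id)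
qed (intro is_linear_word_comp is_linear_compose [OF is_linear_linear_extension])+

text \<open>In the permuted word, argument \<open>j\<close> meets the letter
  \<open>w ! \<sigma> j\<close>. Permuting these pairs by \<open>inv \<sigma>\<close> restores
  \<open>w\<close> and permutes the arguments, so the two sides differ by a move of whole
  blocks.\<close>

lemma word_comp_outer:
  assumes p: "Poly_Mapping.keys p \<subseteq> words (length ks)" and \<sigma>: "\<sigma> permutes {..<length ks}"
    and qs: "list_all2 (\<lambda>k q. Poly_Mapping.keys q \<subseteq> words k) ks qs"
  shows "word_comp (word_act \<sigma> p) qs =
    word_act (block_perm ks \<sigma> (\<lambda>_. id)) (word_comp p (permute_list (Hilbert_Choice.inv \<sigma>) qs))"
proof (rule is_linear_ext [where x = p])
  show "is_linear (\<lambda>p. word_comp (word_act \<sigma> p) qs)"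
    "is_linear (\<lambda>p. word_act (block_perm ks \<sigma> (\<lambda>_. id)) (word_comp p (permute_list (Hilbert_Choice.inv \<sigma>) qs)))"
    by (intro is_linear_compose [OF is_linear_word_comp] is_linear_compose [OF is_linear_linear_extension]
        is_linear_word_comp is_linear_linear_extension)+
  fix w assume "w \<in> Poly_Mapping.keys p"
  then have w: "length w = length ks" using p by auto
  have len: "length qs = length ks" "\<And>i. i < length ks \<Longrightarrow> Poly_Mapping.keys (qs ! i) \<subseteq> words (ks ! i)"
    using qs by (auto simp: list_all2_conv_all_nth)
  let ?qs = "map2 (\<lambda>i q. (D ^^ i) q) (permute_list \<sigma> w) qs"
  note inv = permutes_inv [OF \<sigma>]
  have "permute_list (Hilbert_Choice.inv \<sigma>) ?qs = map2 (\<lambda>i q. (D ^^ i) q) w (permute_list (Hilbert_Choice.inv \<sigma>) qs)"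
    using w len inv \<sigma> permutes_inverses [OF \<sigma>]
    by (intro nth_equalityI) (simp_all add: permute_list_nth permutes_lessThan_iff)
  moreover have "list_all2 (\<lambda>k q. Poly_Mapping.keys q \<subseteq> words k) ks ?qs"
    using w len by (simp add: list_all2_conv_all_nth keys_D_funpow)
  moreover have "map (\<lambda>i. word_act id (?qs ! i)) [0..<length ks] = ?qs"
    using w len by (intro nth_equalityI) (simp_all add: linear_extension_self)
  ultimately show "word_comp (word_act \<sigma> (Poly_Mapping.single w 1)) qs =
    word_act (block_perm ks \<sigma> (\<lambda>_. id))
      (word_comp (Poly_Mapping.single w 1) (permute_list (Hilbert_Choice.inv \<sigma>) qs))"
    using word_act_block_perm [of \<sigma> ks "\<lambda>_. id" ?qs] \<sigma>
    by (simp add: word_comp_single permutes_id)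
qed

section \<open>Exclusion of the empty word, and the operad axioms for \<open>NMI\<close>\<close>

lemma NMI_carrier_iff:
  "p \<in> op_carrier NMI n \<longleftrightarrow> Poly_Mapping.keys p \<subseteq> words n \<and> [] \<notin> Poly_Mapping.keys p"
  by (auto simp: NMI_simps)

lemma length_op_args: "qs \<in> op_args P ks \<Longrightarrow> length qs = length ks"
  by (auto simp: op_args_def dest: list_all2_lengthD)

lemma NMI_args_iff:
  "qs \<in> op_args NMI ks \<longleftrightarrow>
    list_all2 (\<lambda>k q. Poly_Mapping.keys q \<subseteq> words k) ks qs \<and> (\<forall>q\<in>set qs. [] \<notin> Poly_Mapping.keys q)"
  unfolding op_args_def mem_Collect_eq NMI_carrier_iff
  by (auto simp: list_all2_conv_all_nth all_set_conv_all_nth)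

lemma Nil_notin_keys_D:
  assumes "[] \<notin> Poly_Mapping.keys p"
  shows "[] \<notin> Poly_Mapping.keys (D p)"
  using keys_linear_extension [of D_word p] assms keys_D_word unfolding D_def by fastforce

lemma Nil_notin_keys_D_funpow: "[] \<notin> Poly_Mapping.keys p \<Longrightarrow> [] \<notin> Poly_Mapping.keys ((D ^^ i) p)"
  by (induction i) (simp_all add: Nil_notin_keys_D)

lemma Nil_notin_keys_times:
  fixes p q :: "'b list \<Rightarrow>\<^sub>0 'k::field"
  assumes "[] \<notin> Poly_Mapping.keys p"
  shows "[] \<notin> Poly_Mapping.keys (p * q)"
  using keys_mult [of p q] assms by (auto simp: plus_list_def)

text \<open>A word of \<open>p\<close> has a first letter, and a product whose first factor avoids
  the empty word avoids it too.\<close>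

lemma word_comp_in_carrier:
  assumes p: "p \<in> op_carrier NMI (length ks)" and qs: "qs \<in> op_args NMI ks"
  shows "word_comp p qs \<in> op_carrier NMI (sum_list ks)"
proof -
  have "[] \<notin> Poly_Mapping.keys (prod_list (map2 (\<lambda>i q. (D ^^ i) q) w qs))"
    if w: "w \<in> Poly_Mapping.keys p" for w
  proof -
    have "w \<noteq> []" using p w by (auto simp: NMI_carrier_iff)
    moreover have "length w = length qs"
      using p w length_op_args [OF qs] by (auto simp: NMI_carrier_iff)
    ultimately obtain i v q rs where "w = i # v" "qs = q # rs" by (cases w; cases qs) auto
    moreover have "[] \<notin> Poly_Mapping.keys q" using qs \<open>qs = q # rs\<close> by (simp add: NMI_args_iff)
    ultimately show ?thesis by (simp add: Nil_notin_keys_times Nil_notin_keys_D_funpow)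
  qed
  then have "[] \<notin> Poly_Mapping.keys (word_comp p qs)"
    using keys_linear_extension [of "\<lambda>w. prod_list (map2 (\<lambda>i q. (D ^^ i) q) w qs)" p]
    unfolding word_comp_def by blast
  then show ?thesis
    using assms keys_word_comp [of p ks qs] by (simp add: NMI_carrier_iff NMI_args_iff)
qed

lemma permute_list_eq_Nil_iff [simp]: "permute_list \<sigma> w = [] \<longleftrightarrow> w = []"
  by (metis length_0_conv length_permute_list)

lemma word_act_in_carrier:
  assumes "p \<in> op_carrier NMI n"
  shows "word_act \<sigma> p \<in> op_carrier NMI n"
proof -
  have "Poly_Mapping.keys (word_act \<sigma> p) \<subseteq> {w. length w = n \<and> w \<noteq> []}"
  proof (rule keys_linear_extension_subset)
    fix w assume "w \<in> Poly_Mapping.keys p"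
    then show "Poly_Mapping.keys (Poly_Mapping.single (permute_list \<sigma> w) 1) \<subseteq> {w. length w = n \<and> w \<noteq> []}"
      using assms by (auto simp: NMI_carrier_iff)
  qed
  then show ?thesis by (simp add: NMI_simps)
qed

lemma word_act_comp:
  assumes "Poly_Mapping.keys p \<subseteq> words n" "\<tau> permutes {..<n}"
  shows "word_act \<tau> (word_act \<sigma> p) = word_act (\<sigma> \<circ> \<tau>) p"
proof -
  have "word_act \<tau> (word_act \<sigma> p) =
    linear_extension (\<lambda>w. Poly_Mapping.single (permute_list \<tau> (permute_list \<sigma> w)) 1) p"
    by (simp add: linear_extension_linear_extension [OF is_linear_linear_extension])
  also have "\<dots> = word_act (\<sigma> \<circ> \<tau>) p"
    using assms by (intro linear_extension_cong) (auto simp: permute_list_compose)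
  finally show ?thesis .
qed

theorem operad_NMI: "operad (NMI :: ('k::field, nat list \<Rightarrow>\<^sub>0 'k) operad)"
proof (rule operad.intro)
  show "module scalars (op_space (NMI :: ('k, _) operad) n)" for n
    by (simp add: NMI_simps module_span_space)
  show "op_unit NMI \<in> op_carrier (NMI :: ('k, _) operad) 1"
    by (simp add: NMI_simps keys_indet)
  fix qs :: "(nat list \<Rightarrow>\<^sub>0 'k) list" and ks
  assume qs: "qs \<in> op_args NMI ks"
  note len = length_op_args [OF qs]
  show "(\<lambda>p. op_comp NMI ks p qs) \<in>
    linear_maps (op_space NMI (length ks)) (op_space (NMI :: ('k, _) operad) (sum_list ks))"
    unfolding NMI_simps
    by (rule is_linear_imp_linear_maps [OF is_linear_word_comp])
      (use word_comp_in_carrier [OF _ qs] in \<open>simp add: NMI_simps\<close>)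
  fix p :: "nat list \<Rightarrow>\<^sub>0 'k"
  assume p: "p \<in> op_carrier NMI (length ks)"
  show "(\<lambda>q. op_comp NMI ks p (qs[i := q])) \<in>
    linear_maps (op_space NMI (ks ! i)) (op_space (NMI :: ('k, _) operad) (sum_list ks))"
    if i: "i < length ks" for i
    unfolding NMI_simps
  proof (rule is_linear_imp_linear_maps)
    show "is_linear (\<lambda>q. word_comp p (qs[i := q]))"
      using p i len by (intro is_linear_word_comp_update) (simp_all add: NMI_carrier_iff)
    fix q :: "nat list \<Rightarrow>\<^sub>0 'k" assume "Poly_Mapping.keys q \<subseteq> {w. length w = ks ! i \<and> w \<noteq> []}"
    then have "qs[i := q] \<in> op_args NMI ks"
      using qs i len unfolding op_args_def
      by (auto simp: NMI_simps list_all2_conv_all_nth nth_list_update)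
    then show "Poly_Mapping.keys (word_comp p (qs[i := q])) \<subseteq> {w. length w = sum_list ks \<and> w \<noteq> []}"
      using word_comp_in_carrier [OF p] by (simp add: NMI_simps)
  qed
  show "op_comp NMI ks p (map (\<lambda>i. op_act NMI (ks ! i) (qs ! i) (\<tau>s i)) [0..<length ks]) =
      op_act NMI (sum_list ks) (op_comp NMI ks p qs) (block_perm ks id \<tau>s)"
    if "\<And>i. i < length ks \<Longrightarrow> \<tau>s i permutes {..<ks ! i}" for \<tau>s
    unfolding NMI_simps using p qs that by (intro word_comp_inner) (simp_all add: NMI_carrier_iff NMI_args_iff)
  show "op_comp NMI ks (op_act NMI (length ks) p \<sigma>) qs = op_act NMI (sum_list ks)
      (op_comp NMI (permute_list (Hilbert_Choice.inv \<sigma>) ks) p (permute_list (Hilbert_Choice.inv \<sigma>) qs))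
      (block_perm ks \<sigma> (\<lambda>_. id))"
    if "\<sigma> permutes {..<length ks}" for \<sigma>
    unfolding NMI_simps using p qs that by (intro word_comp_outer) (simp_all add: NMI_carrier_iff NMI_args_iff)
next
  fix p :: "nat list \<Rightarrow>\<^sub>0 'k" and n
  assume p: "p \<in> op_carrier NMI n"
  show "op_comp NMI [n] (op_unit NMI) [p] = p"
    by (simp add: NMI_simps word_comp_indet)
  show "op_comp NMI (replicate n 1) p (replicate n (op_unit NMI)) = p"
    unfolding NMI_simps using p by (intro word_comp_unit_right) (simp add: NMI_carrier_iff)
  show "op_act NMI n p id = p"
    by (simp add: NMI_simps linear_extension_self)
  show "op_act NMI n (op_act NMI n p \<sigma>) \<tau> = op_act NMI n p (\<sigma> \<circ> \<tau>)"
    if "\<sigma> permutes {..<n}" "\<tau> permutes {..<n}" for \<sigma> \<tau>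
    unfolding NMI_simps using p that by (intro word_act_comp) (simp_all add: NMI_carrier_iff)
next
  fix p :: "nat list \<Rightarrow>\<^sub>0 'k" and lss and qs :: "(nat list \<Rightarrow>\<^sub>0 'k) list" and rss
  assume *: "p \<in> op_carrier NMI (length lss)" "qs \<in> op_args NMI (map length lss)"
    "list_all2 (\<lambda>ls rs. rs \<in> op_args (NMI :: ('k, _) operad) ls) lss rss"
  then have len: "length qs = length lss" "length rss = length lss"
    by (auto dest: length_op_args list_all2_lengthD)
  have "length (rss ! i) = length (lss ! i)" if "i < length lss" for i
    using *(3) that by (auto simp: list_all2_conv_all_nth dest: length_op_args)
  with *(2) len have "list_all2 (\<lambda>q rs. Poly_Mapping.keys q \<subseteq> words (length rs)) qs rss"
    by (simp add: NMI_args_iff list_all2_conv_all_nth)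
  then have "word_comp (word_comp p qs) (concat rss) = word_comp p (map2 word_comp qs rss)"
    using *(1) len by (intro word_comp_assoc) (simp_all add: NMI_carrier_iff)
  moreover have "map (\<lambda>i. word_comp (qs ! i) (rss ! i)) [0..<length lss] = map2 word_comp qs rss"
    using len by (intro nth_equalityI) simp_all
  ultimately show "op_comp NMI (concat lss) (op_comp NMI (map length lss) p qs) (concat rss) =
    op_comp NMI (map sum_list lss) p
      (map (\<lambda>i. op_comp NMI (lss ! i) (qs ! i) (rss ! i)) [0..<length lss])"
    by (simp add: NMI_simps)
next
  show "(\<lambda>p. op_act NMI n p \<sigma>) \<in> linear_maps (op_space NMI n) (op_space (NMI :: ('k, _) operad) n)"
    for \<sigma> n
    unfolding NMI_simps
    by (rule is_linear_imp_linear_maps [OF is_linear_linear_extension])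
      (use word_act_in_carrier in \<open>simp add: NMI_simps\<close>)
qed

section \<open>Transport of structure and quotients\<close>

lemma (in operad) comp_closed:
  "p \<in> op_carrier P (length ks) \<Longrightarrow> qs \<in> op_args P ks \<Longrightarrow> op_comp P ks p qs \<in> op_carrier P (sum_list ks)"
  using comp_linear [of qs ks] by (auto simp: linear_maps_def)

lemma (in operad) act_closed:
  "p \<in> op_carrier P n \<Longrightarrow> \<sigma> permutes {..<n} \<Longrightarrow> op_act P n p \<sigma> \<in> op_carrier P n"
  using act_linear [of \<sigma> n] by (auto simp: linear_maps_def)

lemma op_args_nth: "qs \<in> op_args P ks \<Longrightarrow> i < length ks \<Longrightarrow> qs ! i \<in> op_carrier P (ks ! i)"
  by (auto simp: op_args_def list_all2_conv_all_nth)

lemma op_argsI: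
  "length qs = length ks \<Longrightarrow> (\<And>i. i < length ks \<Longrightarrow> qs ! i \<in> op_carrier P (ks ! i)) \<Longrightarrow> qs \<in> op_args P ks"
  by (auto simp: op_args_def list_all2_conv_all_nth)

lemma op_args_update:
  "qs \<in> op_args P ks \<Longrightarrow> i < length ks \<Longrightarrow> q \<in> op_carrier P (ks ! i) \<Longrightarrow> qs[i := q] \<in> op_args P ks"
  by (rule op_argsI) (auto simp: length_op_args op_args_nth nth_list_update)

lemma linear_mapsD:
  assumes "f \<in> linear_maps M N"
  shows "x \<in> carrier M \<Longrightarrow> f x \<in> carrier N"
    "x \<in> carrier M \<Longrightarrow> y \<in> carrier M \<Longrightarrow> f (x \<oplus>\<^bsub>M\<^esub> y) = f x \<oplus>\<^bsub>N\<^esub> f y"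
    "x \<in> carrier M \<Longrightarrow> f (c \<odot>\<^bsub>M\<^esub> x) = c \<odot>\<^bsub>N\<^esub> f x"
  using assms by (auto simp: linear_maps_def)

lemma linear_maps_zero:
  assumes "f \<in> linear_maps M N" "module scalars (M :: ('k::field, 'a) module)" "module scalars N"
  shows "f \<zero>\<^bsub>M\<^esub> = \<zero>\<^bsub>N\<^esub>"
proof -
  interpret M: module scalars M by fact
  interpret N: module scalars N by fact
  have "f (\<zero>\<^bsub>M\<^esub> \<oplus>\<^bsub>M\<^esub> \<zero>\<^bsub>M\<^esub>) = f \<zero>\<^bsub>M\<^esub> \<oplus>\<^bsub>N\<^esub> f \<zero>\<^bsub>M\<^esub>"
    using linear_mapsD(2) [OF assms(1)] M.M.zero_closed by blast
  then show ?thesis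
    using linear_mapsD(1) [OF assms(1) M.M.zero_closed] by (metis M.M.zero_closed M.M.l_zero N.M.add.l_cancel_one')
qed

lemma map2_concat:
  "list_all2 (\<lambda>xs ys. length xs = length ys) xss yss \<Longrightarrow>
    concat (map2 (map2 f) xss yss) = map2 f (concat xss) (concat yss)"
  by (induction rule: list_all2_induct) simp_all

text \<open>\<open>R\<close> is a mere record whose operations match those of \<open>Q\<close> along
  the bijections \<open>\<psi> n\<close>; that it is an operad is a consequence. In the application
  \<open>R\<close> is a quotient and \<open>\<psi>\<close> sends a value to its fiber.\<close>

locale operad_transport = Q: operad Q
  for Q :: "('k::field, 'b) operad" +
  fixes R :: "('k, 'c) operad" and \<psi> :: "nat \<Rightarrow> 'b \<Rightarrow> 'c"
  assumes bij: "bij_betw (\<psi> n) (op_carrier Q n) (op_carrier R n)"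
    and zero: "\<psi> n \<zero>\<^bsub>op_space Q n\<^esub> = \<zero>\<^bsub>op_space R n\<^esub>"
    and add: "x \<in> op_carrier Q n \<Longrightarrow> y \<in> op_carrier Q n \<Longrightarrow>
      \<psi> n (x \<oplus>\<^bsub>op_space Q n\<^esub> y) = \<psi> n x \<oplus>\<^bsub>op_space R n\<^esub> \<psi> n y"
    and smult: "x \<in> op_carrier Q n \<Longrightarrow> \<psi> n (c \<odot>\<^bsub>op_space Q n\<^esub> x) = c \<odot>\<^bsub>op_space R n\<^esub> \<psi> n x"
    and unit: "\<psi> 1 (op_unit Q) = op_unit R"
    and comp: "p \<in> op_carrier Q (length ks) \<Longrightarrow> qs \<in> op_args Q ks \<Longrightarrow>
      \<psi> (sum_list ks) (op_comp Q ks p qs) = op_comp R ks (\<psi> (length ks) p) (map2 \<psi> ks qs)"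
    and act: "p \<in> op_carrier Q n \<Longrightarrow> \<sigma> permutes {..<n} \<Longrightarrow>
      \<psi> n (op_act Q n p \<sigma>) = op_act R n (\<psi> n p) \<sigma>"
begin

lemma carrier_image: "op_carrier R n = \<psi> n ` op_carrier Q n"
  using bij by (simp add: bij_betw_def)

lemma closed: "x \<in> op_carrier Q n \<Longrightarrow> \<psi> n x \<in> op_carrier R n"
  by (simp add: carrier_image)

lemma argsE:
  assumes "rs \<in> op_args R ks"
  obtains qs where "qs \<in> op_args Q ks" "rs = map2 \<psi> ks qs"
proof -
  have "\<exists>q. \<forall>i<length ks. q i \<in> op_carrier Q (ks ! i) \<and> rs ! i = \<psi> (ks ! i) (q i)"
    using op_args_nth [OF assms] by (intro choice) (auto simp: carrier_image image_iff)
  then obtain q where q: "\<And>i. i < length ks \<Longrightarrow> q i \<in> op_carrier Q (ks ! i)"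
    "\<And>i. i < length ks \<Longrightarrow> rs ! i = \<psi> (ks ! i) (q i)"
    by blast
  show ?thesis
  proof (rule that)
    show "map q [0..<length ks] \<in> op_args Q ks" by (rule op_argsI) (simp_all add: q)
    show "rs = map2 \<psi> ks (map q [0..<length ks])"
      using length_op_args [OF assms] by (intro nth_equalityI) (simp_all add: q)
  qed
qed

lemma module_R: "module scalars (op_space R n)"
proof -
  interpret M: module scalars "op_space Q n" by (rule Q.space)
  have abelian: "abelian_group (op_space R n)"
  proof (rule abelian_groupI)
    fix x assume "x \<in> op_carrier R n"
    then obtain y where y: "y \<in> op_carrier Q n" "x = \<psi> n y" by (auto simp: carrier_image)
    have "\<psi> n (\<ominus>\<^bsub>op_space Q n\<^esub> y) \<oplus>\<^bsub>op_space R n\<^esub> x = \<zero>\<^bsub>op_space R n\<^esub>"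
      using y by (simp add: M.M.l_neg zero flip: add)
    then show "\<exists>z\<in>op_carrier R n. z \<oplus>\<^bsub>op_space R n\<^esub> x = \<zero>\<^bsub>op_space R n\<^esub>"
      using y closed by blast
  qed (auto simp: carrier_image M.M.add.m_ac simp flip: add zero)
  show ?thesis
    using Q.space [of n] abelian unfolding module_scalars_iff_abelian_group
    by (auto simp: carrier_image simp flip: add smult)
qed

lemma linear_maps_transport:
  assumes "f \<in> linear_maps (op_space Q m) (op_space Q n)"
    and "\<And>x. x \<in> op_carrier Q m \<Longrightarrow> g (\<psi> m x) = \<psi> n (f x)"
  shows "g \<in> linear_maps (op_space R m) (op_space R n)"
proof -
  interpret M: module scalars "op_space Q m" by (rule Q.space)
  note f = linear_mapsD [OF assms(1)]
  have c: "c \<odot>\<^bsub>op_space Q m\<^esub> x \<in> op_carrier Q m" if "x \<in> op_carrier Q m" for c x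
    using M.smult_closed [of c x] that by (simp add: ring_of_type_algebra_def)
  show ?thesis
    unfolding linear_maps_def using c
    by (auto simp: carrier_image assms(2) f simp flip: add smult)
qed

theorem operad_R: "operad R"
proof (rule operad.intro)
  show "module scalars (op_space R n)" for n by (rule module_R)
  show "op_unit R \<in> op_carrier R 1" using closed [OF Q.unit_closed] unfolding unit .
next
  fix rs ks
  assume "rs \<in> op_args R ks"
  then obtain qs where qs: "qs \<in> op_args Q ks" and rs: "rs = map2 \<psi> ks qs" by (rule argsE)
  note len = length_op_args [OF qs]
  show "(\<lambda>p. op_comp R ks p rs) \<in> linear_maps (op_space R (length ks)) (op_space R (sum_list ks))"
    by (rule linear_maps_transport [OF Q.comp_linear [OF qs]]) (simp add: rs comp qs)
  fix p assume "p \<in> op_carrier R (length ks)"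
  then obtain p' where p': "p' \<in> op_carrier Q (length ks)" and p: "p = \<psi> (length ks) p'"
    by (auto simp: carrier_image)
  show "(\<lambda>q. op_comp R ks p (rs[i := q])) \<in> linear_maps (op_space R (ks ! i)) (op_space R (sum_list ks))"
    if i: "i < length ks" for i
  proof (rule linear_maps_transport [OF Q.comp_multilinear [OF p' qs i]])
    fix x assume x: "x \<in> op_carrier Q (ks ! i)"
    have "rs[i := \<psi> (ks ! i) x] = map2 \<psi> ks (qs[i := x])"
      using i len unfolding rs by (intro nth_equalityI) (auto simp: nth_list_update)
    then show "op_comp R ks p (rs[i := \<psi> (ks ! i) x]) = \<psi> (sum_list ks) (op_comp Q ks p' (qs[i := x]))"
      by (simp add: p comp p' op_args_update qs i x)
  qed
  show "op_comp R ks (op_act R (length ks) p \<sigma>) rs = op_act R (sum_list ks)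
      (op_comp R (permute_list (Hilbert_Choice.inv \<sigma>) ks) p (permute_list (Hilbert_Choice.inv \<sigma>) rs))
      (block_perm ks \<sigma> (\<lambda>_. id))"
    if \<sigma>: "\<sigma> permutes {..<length ks}" for \<sigma>
  proof -
    note inv = permutes_inv [OF \<sigma>]
    let ?ks = "permute_list (Hilbert_Choice.inv \<sigma>) ks" and ?qs = "permute_list (Hilbert_Choice.inv \<sigma>) qs"
    have args: "?qs \<in> op_args Q ?ks"
      using inv len op_args_nth [OF qs]
      by (intro op_argsI) (simp_all add: permute_list_nth permutes_lessThan_iff)
    have perm_rs: "permute_list (Hilbert_Choice.inv \<sigma>) rs = map2 \<psi> ?ks ?qs"
      using inv len unfolding rs
      by (intro nth_equalityI) (simp_all add: permute_list_nth permutes_lessThan_iff)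
    have sum: "sum_list ?ks = sum_list ks" using inv by (rule sum_list_permute_list)
    have block: "block_perm ks \<sigma> (\<lambda>_. id) permutes {..<sum_list ks}"
      using \<sigma> by (intro block_perm_permutes) (simp_all add: permutes_id)
    have closed': "op_comp Q ?ks p' ?qs \<in> op_carrier Q (sum_list ks)"
      using Q.comp_closed [of p' ?ks ?qs] p' args sum by simp
    have "op_comp R ks (op_act R (length ks) p \<sigma>) rs =
      \<psi> (sum_list ks) (op_comp Q ks (op_act Q (length ks) p' \<sigma>) qs)"
      by (simp add: p rs p' qs \<sigma> Q.act_closed comp act)
    also have "\<dots> = \<psi> (sum_list ks) (op_act Q (sum_list ks) (op_comp Q ?ks p' ?qs) (block_perm ks \<sigma> (\<lambda>_. id)))"
      by (simp add: Q.equivariance_outer p' qs \<sigma>)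
    also have "\<dots> = op_act R (sum_list ks) (op_comp R ?ks p (map2 \<psi> ?ks ?qs)) (block_perm ks \<sigma> (\<lambda>_. id))"
      using comp [of p' ?ks ?qs] p' args by (simp add: act [OF closed' block] p sum)
    finally show ?thesis by (simp add: perm_rs)
  qed
  show "op_comp R ks p (map (\<lambda>i. op_act R (ks ! i) (rs ! i) (\<tau>s i)) [0..<length ks]) =
      op_act R (sum_list ks) (op_comp R ks p rs) (block_perm ks id \<tau>s)"
    if \<tau>s: "\<And>i. i < length ks \<Longrightarrow> \<tau>s i permutes {..<ks ! i}" for \<tau>s
  proof -
    let ?qs = "map (\<lambda>i. op_act Q (ks ! i) (qs ! i) (\<tau>s i)) [0..<length ks]"
    have args: "?qs \<in> op_args Q ks"
      by (rule op_argsI) (simp_all add: Q.act_closed op_args_nth qs \<tau>s)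
    have "map (\<lambda>i. op_act R (ks ! i) (rs ! i) (\<tau>s i)) [0..<length ks] = map2 \<psi> ks ?qs"
      using len unfolding rs by (intro nth_equalityI) (simp_all add: act op_args_nth qs \<tau>s)
    moreover have "block_perm ks id \<tau>s permutes {..<sum_list ks}"
      using \<tau>s by (intro block_perm_permutes) (simp_all add: permutes_id)
    ultimately show ?thesis
      by (simp add: p rs Q.equivariance_inner p' qs \<tau>s args Q.comp_closed flip: comp act)
  qed
next
  fix p n assume "p \<in> op_carrier R n"
  then obtain p' where p': "p' \<in> op_carrier Q n" and p: "p = \<psi> n p'"
    by (auto simp: carrier_image)
  show "op_comp R [n] (op_unit R) [p] = p"
    using comp [of "op_unit Q" "[n]" "[p']"] Q.unit_closed p'
    by (simp add: p unit [symmetric] op_args_def Q.comp_unit_left)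
  have "replicate n (op_unit Q) \<in> op_args Q (replicate n 1)"
    using Q.unit_closed by (intro op_argsI) simp_all
  then show "op_comp R (replicate n 1) p (replicate n (op_unit R)) = p"
    unfolding p unit [symmetric]
    using comp [of p' "replicate n 1" "replicate n (op_unit Q)"] p' Q.comp_unit_right [OF p']
    by (simp add: sum_list_replicate)
  show "op_act R n p id = p"
    using act [OF p' permutes_id] by (simp add: p Q.act_id p')
  show "op_act R n (op_act R n p \<sigma>) \<tau> = op_act R n p (\<sigma> \<circ> \<tau>)"
    if "\<sigma> permutes {..<n}" "\<tau> permutes {..<n}" for \<sigma> \<tau>
    using that by (simp add: p p' Q.act_comp Q.act_closed permutes_compose flip: act)
next
  fix p lss qs rss
  assume "p \<in> op_carrier R (length lss)" "qs \<in> op_args R (map length lss)"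
    and rss: "list_all2 (\<lambda>ls rs. rs \<in> op_args R ls) lss rss"
  then obtain p' where p': "p' \<in> op_carrier Q (length lss)" "p = \<psi> (length lss) p'"
    by (auto simp: carrier_image)
  obtain qs' where qs': "qs' \<in> op_args Q (map length lss)" "qs = map2 \<psi> (map length lss) qs'"
    using \<open>qs \<in> _\<close> by (rule argsE)
  have "\<exists>f. \<forall>i<length lss. f i \<in> op_args Q (lss ! i) \<and> rss ! i = map2 \<psi> (lss ! i) (f i)"
    using rss argsE by (intro choice) (metis list_all2_nthD)
  then obtain f where f: "\<And>i. i < length lss \<Longrightarrow> f i \<in> op_args Q (lss ! i)"
    "\<And>i. i < length lss \<Longrightarrow> rss ! i = map2 \<psi> (lss ! i) (f i)" by blast
  define rss' where "rss' = map f [0..<length lss]"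
  have rss': "list_all2 (\<lambda>ls rs. rs \<in> op_args Q ls) lss rss'"
    by (simp add: rss'_def list_all2_conv_all_nth f)
  have lens: "list_all2 (\<lambda>ls rs. length ls = length rs) lss rss'"
    using rss' by (rule list_all2_mono) (simp add: length_op_args)
  have "rss = map2 (map2 \<psi>) lss rss'"
    using list_all2_lengthD [OF rss] by (intro nth_equalityI) (simp_all add: f rss'_def)
  then have concat_rss: "concat rss = map2 \<psi> (concat lss) (concat rss')"
    by (simp add: map2_concat lens)
  have concat_args: "concat rss' \<in> op_args Q (concat lss)"
    using rss' unfolding op_args_def by (auto intro: concat_transfer [THEN rel_funD] simp: list_all2_lengthD)
  let ?q = "op_comp Q (map length lss) p' qs'"
  have q: "?q \<in> op_carrier Q (length (concat lss))"
    using Q.comp_closed [of p' "map length lss" qs'] p' qs' by (simp add: length_concat)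
  let ?qs = "map (\<lambda>i. op_comp Q (lss ! i) (qs' ! i) (rss' ! i)) [0..<length lss]"
  have qs_nth: "qs' ! i \<in> op_carrier Q (length (lss ! i))" if "i < length lss" for i
    using op_args_nth [OF qs'(1)] that by simp
  have rss_nth: "rss' ! i \<in> op_args Q (lss ! i)" if "i < length lss" for i
    using f that by (simp add: rss'_def)
  have qs_args: "?qs \<in> op_args Q (map sum_list lss)"
    by (rule op_argsI) (simp_all add: Q.comp_closed qs_nth rss_nth)
  have map_eq: "map (\<lambda>i. op_comp R (lss ! i) (qs ! i) (rss ! i)) [0..<length lss] =
    map2 \<psi> (map sum_list lss) ?qs"
    using qs' length_op_args [OF qs'(1)]
    by (intro nth_equalityI) (simp_all add: f rss'_def comp qs_nth)
  have sum: "sum_list (concat lss) = sum_list (map sum_list lss)"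
    by (induction lss) simp_all
  have "op_comp R (concat lss) (op_comp R (map length lss) p qs) (concat rss) =
    \<psi> (sum_list (concat lss)) (op_comp Q (concat lss) ?q (concat rss'))"
    using p' qs' comp [of p' "map length lss" qs'] comp [OF q concat_args]
    by (simp add: concat_rss length_concat)
  also have "\<dots> = op_comp R (map sum_list lss) p
        (map (\<lambda>i. op_comp R (lss ! i) (qs ! i) (rss ! i)) [0..<length lss])"
    using comp [of p' "map sum_list lss" ?qs] p' qs_args
    by (simp add: sum map_eq Q.comp_assoc [OF p'(1) qs'(1) rss'])
  finally show "op_comp R (concat lss) (op_comp R (map length lss) p qs) (concat rss) = \<dots>" .
next
  fix \<sigma> :: "nat \<Rightarrow> nat" and n assume \<sigma>: "\<sigma> permutes {..<n}"
  show "(\<lambda>p. op_act R n p \<sigma>) \<in> linear_maps (op_space R n) (op_space R n)"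
    by (rule linear_maps_transport [OF Q.act_linear [OF \<sigma>]]) (simp add: act \<sigma>)
qed

text \<open>The desired morphism runs from \<open>R\<close> to \<open>Q\<close>, against
  \<open>\<psi>\<close>. The restriction makes it \<open>undefined\<close> outside the carrier, as
  \<open>hom_extensional\<close> demands.\<close>

definition inverse :: "nat \<Rightarrow> 'c \<Rightarrow> 'b"
  where "inverse n = restrict (inv_into (op_carrier Q n) (\<psi> n)) (op_carrier R n)"

lemma inverse_image: "x \<in> op_carrier Q n \<Longrightarrow> inverse n (\<psi> n x) = x"
  using bij [of n] by (simp add: inverse_def closed bij_betw_def inv_into_f_f)

theorem operad_iso_inverse: "operad_iso R Q inverse"
proof -
  interpret R: operad R by (rule operad_R)
  note [simp] = inverse_image
  have c: "c \<odot>\<^bsub>op_space Q m\<^esub> x \<in> op_carrier Q m" if "x \<in> op_carrier Q m" for c x m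
    using Q.space [of m] that unfolding module_scalars_iff_abelian_group by blast
  have a: "x \<oplus>\<^bsub>op_space Q m\<^esub> y \<in> op_carrier Q m" if "x \<in> op_carrier Q m" "y \<in> op_carrier Q m" for x y m
    using Q.space [of m] that unfolding module_scalars_iff_abelian_group
    by (simp add: abelian_group_def abelian_monoid.a_closed)
  show ?thesis
  proof unfold_locales
    show "inverse n \<in> extensional (op_carrier R n)" for n
      by (simp add: inverse_def)
    show "inverse n \<in> linear_maps (op_space R n) (op_space Q n)" for n
      by (auto simp: linear_maps_def carrier_image a c simp flip: add smult)
    show "inverse 1 (op_unit R) = op_unit Q"
      using Q.unit_closed by (simp flip: unit)
    show "inverse (sum_list ks) (op_comp R ks p qs) =
        op_comp Q ks (inverse (length ks) p) (map2 inverse ks qs)"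
      if "p \<in> op_carrier R (length ks)" "qs \<in> op_args R ks" for p ks qs
    proof -
      from that(1) obtain p' where p': "p' \<in> op_carrier Q (length ks)" "p = \<psi> (length ks) p'"
        by (auto simp: carrier_image)
      from that(2) obtain qs' where "qs' \<in> op_args Q ks" "qs = map2 \<psi> ks qs'" by (rule argsE)
      note * = p' this
      have "map2 inverse ks qs = qs'"
        using * length_op_args [OF *(3)] by (intro nth_equalityI) (simp_all add: op_args_nth)
      with * show ?thesis by (simp add: Q.comp_closed flip: comp)
    qed
    show "inverse n (op_act R n p \<sigma>) = op_act Q n (inverse n p) \<sigma>"
      if "p \<in> op_carrier R n" "\<sigma> permutes {..<n}" for n p \<sigma>
      using that by (auto simp: carrier_image Q.act_closed simp flip: act)
    have "inj_on (inverse n) (op_carrier R n)" "inverse n ` op_carrier R n = op_carrier Q n" for n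
      by (auto simp: carrier_image inj_on_def image_image)
    then show "bij_betw (inverse n) (op_carrier R n) (op_carrier Q n)" for n
      by (simp add: bij_betw_def)
  qed
qed

end

section \<open>Quotients by the kernel of a surjection onto an operad\<close>

lemma mem_listset_iff: "xs \<in> listset As \<longleftrightarrow> list_all2 (\<in>) xs As"
  by (induction As arbitrary: xs) (auto simp: set_Cons_def list_all2_Cons2)

text \<open>For \<open>F\<close> only closure under the operations is assumed; the laws of the
  quotient come from \<open>Q\<close> by surjectivity of \<open>\<phi> n\<close>.\<close>

locale operad_cover = Q: operad Q
  for Q :: "('k::field, 'b) operad" +
  fixes F :: "('k, 'a) operad" and \<phi> :: "nat \<Rightarrow> 'a \<Rightarrow> 'b"
  assumes space: "module scalars (op_space F n)"
    and unit_closed: "op_unit F \<in> op_carrier F 1"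
    and comp_closed: "p \<in> op_carrier F (length ks) \<Longrightarrow> qs \<in> op_args F ks \<Longrightarrow>
      op_comp F ks p qs \<in> op_carrier F (sum_list ks)"
    and act_closed: "p \<in> op_carrier F n \<Longrightarrow> \<sigma> permutes {..<n} \<Longrightarrow> op_act F n p \<sigma> \<in> op_carrier F n"
    and linear: "\<phi> n \<in> linear_maps (op_space F n) (op_space Q n)"
    and surj: "\<phi> n ` op_carrier F n = op_carrier Q n"
    and unit: "\<phi> 1 (op_unit F) = op_unit Q"
    and comp: "p \<in> op_carrier F (length ks) \<Longrightarrow> qs \<in> op_args F ks \<Longrightarrow>
      \<phi> (sum_list ks) (op_comp F ks p qs) = op_comp Q ks (\<phi> (length ks) p) (map2 \<phi> ks qs)"
    and act: "p \<in> op_carrier F n \<Longrightarrow> \<sigma> permutes {..<n} \<Longrightarrow>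
      \<phi> n (op_act F n p \<sigma>) = op_act Q n (\<phi> n p) \<sigma>"
begin

text \<open>Fibers over the carrier of \<open>Q\<close> are the cosets of the kernel
  (\<open>coset_kernel\<close>), so they are the elements of the quotient, indexed by their common
  value instead of by representatives.\<close>

definition fiber :: "nat \<Rightarrow> 'b \<Rightarrow> 'a set"
  where "fiber n y = {x \<in> op_carrier F n. \<phi> n x = y}"

definition kernel :: "nat \<Rightarrow> 'a set"
  where "kernel n = fiber n \<zero>\<^bsub>op_space Q n\<^esub>"

lemma args_image: "qs \<in> op_args F ks \<Longrightarrow> map2 \<phi> ks qs \<in> op_args Q ks"
  by (rule op_argsI) (auto simp: length_op_args op_args_nth linear_mapsD(1) [OF linear])

lemma fiber_nonempty: "y \<in> op_carrier Q n \<Longrightarrow> \<exists>x. x \<in> fiber n y"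
  unfolding surj [of n, symmetric] fiber_def by blast

context
  fixes n :: nat
begin

interpretation MF: module scalars "op_space F n" by (rule space)
interpretation MQ: module scalars "op_space Q n" by (rule Q.space)

lemmas \<phi>_linear = linear_mapsD [OF linear [of n]]

lemma \<phi>_zero: "\<phi> n \<zero>\<^bsub>op_space F n\<^esub> = \<zero>\<^bsub>op_space Q n\<^esub>"
  by (rule linear_maps_zero [OF linear space Q.space])

lemma \<phi>_neg:
  assumes "x \<in> op_carrier F n"
  shows "\<phi> n (\<ominus>\<^bsub>op_space F n\<^esub> x) = \<ominus>\<^bsub>op_space Q n\<^esub> \<phi> n x"
  by (rule MQ.M.minus_equality [symmetric])
    (use assms in \<open>simp_all add: \<phi>_linear \<phi>_zero MF.M.l_neg flip: \<phi>_linear(2)\<close>)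

lemma fiber_add:
  assumes "y \<in> op_carrier Q n" "z \<in> op_carrier Q n"
  shows "fiber n (y \<oplus>\<^bsub>op_space Q n\<^esub> z) = fiber n y <+>\<^bsub>op_space F n\<^esub> fiber n z"
proof (intro equalityI subsetI)
  fix x assume x: "x \<in> fiber n (y \<oplus>\<^bsub>op_space Q n\<^esub> z)"
  \<comment> \<open>Any preimage \<open>a\<close> of \<open>z\<close> will do: \<open>x\<close>
    splits as \<open>(x - a) + a\<close>, and \<open>x - a\<close> lies over
    \<open>y\<close>.\<close>
  obtain a where a: "a \<in> fiber n z" using fiber_nonempty assms(2) by blast
  then have "x \<oplus>\<^bsub>op_space F n\<^esub> \<ominus>\<^bsub>op_space F n\<^esub> a \<in> fiber n y"
    using x assms by (simp add: fiber_def \<phi>_linear \<phi>_neg MQ.M.a_assoc MQ.M.r_neg)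
  moreover have "x = (x \<oplus>\<^bsub>op_space F n\<^esub> \<ominus>\<^bsub>op_space F n\<^esub> a) \<oplus>\<^bsub>op_space F n\<^esub> a"
    using x a by (simp add: fiber_def MF.M.a_assoc MF.M.l_neg)
  ultimately show "x \<in> fiber n y <+>\<^bsub>op_space F n\<^esub> fiber n z"
    using a unfolding set_add_def' by blast
qed (auto simp: set_add_def' fiber_def \<phi>_linear)

lemma coset_kernel:
  assumes "a \<in> op_carrier F n"
  shows "kernel n +>\<^bsub>op_space F n\<^esub> a = fiber n (\<phi> n a)"
proof (intro equalityI subsetI)
  fix x assume x: "x \<in> fiber n (\<phi> n a)"
  then have "x \<oplus>\<^bsub>op_space F n\<^esub> \<ominus>\<^bsub>op_space F n\<^esub> a \<in> kernel n"
    using assms by (simp add: kernel_def fiber_def \<phi>_linear \<phi>_neg MQ.M.r_neg)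
  moreover have "x = (x \<oplus>\<^bsub>op_space F n\<^esub> \<ominus>\<^bsub>op_space F n\<^esub> a) \<oplus>\<^bsub>op_space F n\<^esub> a"
    using x assms by (simp add: fiber_def MF.M.a_assoc MF.M.l_neg)
  ultimately show "x \<in> kernel n +>\<^bsub>op_space F n\<^esub> a"
    unfolding a_r_coset_def' by blast
qed (use assms in \<open>auto simp: a_r_coset_def' kernel_def fiber_def \<phi>_linear\<close>)

lemma smult_closed: "x \<in> op_carrier F n \<Longrightarrow> c \<odot>\<^bsub>op_space F n\<^esub> x \<in> op_carrier F n"
  using space [of n] unfolding module_scalars_iff_abelian_group by blast

lemma fiber_smult:
  assumes "y \<in> op_carrier Q n"
  shows "fiber n (c \<odot>\<^bsub>op_space Q n\<^esub> y) =
    (\<Union>a\<in>fiber n y. kernel n +>\<^bsub>op_space F n\<^esub> (c \<odot>\<^bsub>op_space F n\<^esub> a))"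
proof -
  have "kernel n +>\<^bsub>op_space F n\<^esub> (c \<odot>\<^bsub>op_space F n\<^esub> a) = fiber n (c \<odot>\<^bsub>op_space Q n\<^esub> y)"
    if "a \<in> fiber n y" for a
    using that by (simp add: fiber_def coset_kernel smult_closed \<phi>_linear)
  then show ?thesis using fiber_nonempty [OF assms] by auto
qed

lemma submodule_kernel: "submodule (kernel n) scalars (op_space F n)"
  by (rule MF.submoduleI)
    (auto simp: kernel_def fiber_def \<phi>_linear \<phi>_zero \<phi>_neg MF.M.zero_closed)

end

theorem operad_ideal_kernel: "operad_ideal F kernel"
proof (rule operad_ideal.intro)
  note zero = linear_maps_zero [OF _ Q.space Q.space]
  show "submodule (kernel n) scalars (op_space F n)" for n by (rule submodule_kernel)
  show "op_act F n x \<sigma> \<in> kernel n" if "x \<in> kernel n" "\<sigma> permutes {..<n}" for n x \<sigma>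
    using that zero [OF Q.act_linear] by (simp add: kernel_def fiber_def act act_closed)
  fix qs ks assume qs: "qs \<in> op_args F ks"
  show "op_comp F ks x qs \<in> kernel (sum_list ks)" if "x \<in> kernel (length ks)" for x
    using that qs zero [OF Q.comp_linear [OF args_image [OF qs]]]
    by (simp add: kernel_def fiber_def comp comp_closed)
  show "op_comp F ks p qs \<in> kernel (sum_list ks)"
    if p: "p \<in> op_carrier F (length ks)" and i: "i < length ks" and q: "qs ! i \<in> kernel (ks ! i)" for p i
  proof -
    \<comment> \<open>The argument in the kernel already has image zero. Writing it as an update
      exhibits the composite as a linear function of that argument, evaluated at zero.\<close>
    have "(map2 \<phi> ks qs)[i := \<zero>\<^bsub>op_space Q (ks ! i)\<^esub>] = map2 \<phi> ks qs"
      using q i length_op_args [OF qs]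
      by (intro nth_equalityI) (auto simp: nth_list_update kernel_def fiber_def)
    then have "op_comp Q ks (\<phi> (length ks) p) (map2 \<phi> ks qs) = \<zero>\<^bsub>op_space Q (sum_list ks)\<^esub>"
      using zero [OF Q.comp_multilinear [OF linear_mapsD(1) [OF linear p] args_image [OF qs] i]] by simp
    then show ?thesis using p qs by (simp add: kernel_def fiber_def comp comp_closed)
  qed
qed

text \<open>The composition, the action and the scalar multiples of a quotient are unions over all
  representatives. Each choice contributes the same coset, the fiber of the value computed in
  \<open>Q\<close>, and at least one choice exists, so the union is that fiber.\<close>

sublocale quotient: operad_transport Q "quotient_operad F kernel" fiber
proof
  have carrier: "op_carrier (quotient_operad F kernel) n = fiber n ` op_carrier Q n" for n
  proof -
    have "(\<lambda>a. kernel n +>\<^bsub>op_space F n\<^esub> a) ` op_carrier F n = fiber n ` \<phi> n ` op_carrier F n"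
      unfolding image_image by (intro image_cong) (simp_all add: coset_kernel)
    then show ?thesis
      by (simp add: quotient_operad_def quotient_space_def A_RCOSETS_def' UNION_singleton_eq_range surj)
  qed
  have "inj_on (fiber n) (op_carrier Q n)" for n
  proof (rule inj_onI)
    fix y z assume "y \<in> op_carrier Q n" "fiber n y = fiber n z"
    with fiber_nonempty [of y n] show "y = z" by (auto simp: fiber_def)
  qed
  then show "bij_betw (fiber n) (op_carrier Q n) (op_carrier (quotient_operad F kernel) n)" for n
    by (simp add: bij_betw_def carrier)
  show "fiber n \<zero>\<^bsub>op_space Q n\<^esub> = \<zero>\<^bsub>op_space (quotient_operad F kernel) n\<^esub>" for n
    by (simp add: quotient_operad_def quotient_space_def kernel_def)
  show "fiber n (x \<oplus>\<^bsub>op_space Q n\<^esub> y) = fiber n x \<oplus>\<^bsub>op_space (quotient_operad F kernel) n\<^esub> fiber n y"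
    if "x \<in> op_carrier Q n" "y \<in> op_carrier Q n" for x y n
    using that by (simp add: quotient_operad_def quotient_space_def fiber_add)
  show "fiber n (c \<odot>\<^bsub>op_space Q n\<^esub> x) = c \<odot>\<^bsub>op_space (quotient_operad F kernel) n\<^esub> fiber n x"
    if "x \<in> op_carrier Q n" for x c n
    using that by (simp add: quotient_operad_def quotient_space_def fiber_smult)
  show "fiber 1 (op_unit Q) = op_unit (quotient_operad F kernel)"
    unfolding unit [symmetric] by (simp add: quotient_operad_def coset_kernel [OF unit_closed] del: One_nat_def)
  show "fiber (sum_list ks) (op_comp Q ks p qs) =
      op_comp (quotient_operad F kernel) ks (fiber (length ks) p) (map2 fiber ks qs)"
    if p: "p \<in> op_carrier Q (length ks)" and qs: "qs \<in> op_args Q ks" for p qs ks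
  proof -
    note len = length_op_args [OF qs]
    have "kernel (sum_list ks) +>\<^bsub>op_space F (sum_list ks)\<^esub> op_comp F ks a bs =
      fiber (sum_list ks) (op_comp Q ks p qs)"
      if a: "a \<in> fiber (length ks) p" and bs: "bs \<in> listset (map2 fiber ks qs)" for a bs
    proof -
      from bs have len_bs: "length bs = length ks" and
        nth: "\<And>i. i < length ks \<Longrightarrow> bs ! i \<in> fiber (ks ! i) (qs ! i)"
        using len by (auto simp: mem_listset_iff list_all2_conv_all_nth)
      then have "bs \<in> op_args F ks" by (intro op_argsI) (auto simp: fiber_def)
      moreover have "map2 \<phi> ks bs = qs"
        using len len_bs nth by (intro nth_equalityI) (auto simp: fiber_def)
      ultimately show ?thesis
        using a by (simp add: coset_kernel comp_closed comp fiber_def)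
    qed
    moreover obtain a where "a \<in> fiber (length ks) p" using fiber_nonempty [OF p] by blast
    moreover obtain bs where "bs \<in> listset (map2 fiber ks qs)"
    proof -
      obtain b where "\<And>i. i < length ks \<Longrightarrow> b i \<in> fiber (ks ! i) (qs ! i)"
        using fiber_nonempty [OF op_args_nth [OF qs]] by metis
      then show ?thesis
        using that [of "map b [0..<length ks]"] len by (simp add: mem_listset_iff list_all2_conv_all_nth)
    qed
    ultimately show ?thesis by (force simp: quotient_operad_def)
  qed
  show "fiber n (op_act Q n p \<sigma>) = op_act (quotient_operad F kernel) n (fiber n p) \<sigma>"
    if p: "p \<in> op_carrier Q n" and \<sigma>: "\<sigma> permutes {..<n}" for p n \<sigma>
  proof -
    have "kernel n +>\<^bsub>op_space F n\<^esub> op_act F n a \<sigma> = fiber n (op_act Q n p \<sigma>)"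
      if "a \<in> fiber n p" for a
      using that \<sigma> by (simp add: fiber_def coset_kernel act act_closed)
    then show ?thesis using fiber_nonempty [OF p] by (auto simp: quotient_operad_def)
  qed
qed

end

section \<open>Free operads\<close>

text \<open>The sum over one basis element per argument in \<open>op_comp\<close> of the free
  operad, isolated so that it can be unfolded into \<open>linear_extension\<close> one argument at a
  time.\<close>

definition multilinear_extension ::
    "('b list \<Rightarrow> ('c \<Rightarrow>\<^sub>0 'k)) \<Rightarrow> ('b \<Rightarrow>\<^sub>0 'k::field) list \<Rightarrow> ('c \<Rightarrow>\<^sub>0 'k)"
  where "multilinear_extension f qs =
    (\<Sum>bs\<in>listset (map Poly_Mapping.keys qs). scale (prod_list (map2 Poly_Mapping.lookup qs bs)) (f bs))"

lemma multilinear_extension_Nil [simp]: "multilinear_extension f [] = f []"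
  by (simp add: multilinear_extension_def)

lemma multilinear_extension_Cons:
  "multilinear_extension f (q # qs) =
    linear_extension (\<lambda>b. multilinear_extension (\<lambda>bs. f (b # bs)) qs) q"
proof -
  let ?K = "Poly_Mapping.keys q" and ?L = "listset (map Poly_Mapping.keys qs)"
  have set_Cons: "set_Cons ?K ?L = (\<lambda>(b, bs). b # bs) ` (?K \<times> ?L)"
    by (auto simp: set_Cons_def image_iff)
  have "multilinear_extension f (q # qs) = (\<Sum>(b, bs)\<in>?K \<times> ?L.
      scale (Poly_Mapping.lookup q b) (scale (prod_list (map2 Poly_Mapping.lookup qs bs)) (f (b # bs))))"
    unfolding multilinear_extension_def list.map listset.simps set_Cons
    by (subst sum.reindex) (auto simp: inj_on_def scale_scale case_prod_unfold)
  also have "\<dots> = linear_extension (\<lambda>b. multilinear_extension (\<lambda>bs. f (b # bs)) qs) q"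
    by (simp add: linear_extension_def multilinear_extension_def is_linear_sum [OF is_linear_scale_right]
        sum.cartesian_product)
  finally show ?thesis .
qed

lemma is_linear_multilinear_extension:
  fixes f :: "'b list \<Rightarrow> ('c \<Rightarrow>\<^sub>0 'k::field)"
  assumes "i < length qs"
  shows "is_linear (\<lambda>q. multilinear_extension f (qs[i := q]))"
  using assms
proof (induction qs arbitrary: f i)
  case (Cons r qs)
  show ?case
  proof (cases i)
    case 0
    then show ?thesis by (simp add: multilinear_extension_Cons is_linear_linear_extension)
  next
    case (Suc j)
    have "is_linear (\<lambda>q. multilinear_extension g (qs[j := q]))" for g :: "'b list \<Rightarrow> ('c \<Rightarrow>\<^sub>0 'k)"
      using Suc Cons by simp
    note IH = is_linear_add [OF this] is_linear_scale [OF this]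
    show ?thesis
      by (rule is_linearI)
        (simp_all add: Suc multilinear_extension_Cons IH linear_extension_fun_add linear_extension_fun_scale)
  qed
qed simp

lemma multilinear_extension_basis:
  "multilinear_extension f (map (\<lambda>b. Poly_Mapping.single b 1) bs) = f bs"
  by (induction bs arbitrary: f) (simp_all add: multilinear_extension_Cons)

lemma keys_multilinear_extension_subset:
  "(\<And>bs. list_all2 (\<lambda>q b. b \<in> Poly_Mapping.keys q) qs bs \<Longrightarrow> Poly_Mapping.keys (f bs) \<subseteq> B) \<Longrightarrow>
    Poly_Mapping.keys (multilinear_extension f qs) \<subseteq> B"
proof (induction qs arbitrary: f)
  case (Cons q qs)
  then show ?case
    unfolding multilinear_extension_Cons by (intro keys_linear_extension_subset Cons.IH) simp_all
qed simp

lemma free_operad_simps: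
  "op_space (free_operad ar) n = span_space (tree_monomials ar n)"
  "op_unit (free_operad ar) = Poly_Mapping.single (Leaf 0) 1"
  "op_comp (free_operad ar) ks p qs =
    linear_extension (\<lambda>t. multilinear_extension (\<lambda>ss. Poly_Mapping.single (tree_comp ks t ss) 1) qs) p"
  "op_act (free_operad ar) n p \<sigma> =
    linear_extension (\<lambda>t. Poly_Mapping.single (relabel (Hilbert_Choice.inv \<sigma>) t) 1) p"
  by (simp_all add: free_operad_def linear_extension_def multilinear_extension_def
      is_linear_sum [OF is_linear_scale_right] scale_single)

section \<open>Grafting and relabelling of trees, and closure of the free operad\<close>

lemma graft_cong: "(\<And>i. i \<in> set (leaves t) \<Longrightarrow> s i = s' i) \<Longrightarrow> graft s t = graft s' t"
  by (induction t) auto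

lemma leaves_graft: "leaves (graft s t) = concat (map (\<lambda>i. leaves (s i)) (leaves t))"
proof (induction t)
  case (Node g ts)
  then show ?case by (induction ts) auto
qed simp

lemma graft_graft: "graft s (graft s' t) = graft (\<lambda>i. graft s (s' i)) t"
  by (induction t) auto

lemma graft_Leaf [simp]: "graft Leaf t = t"
  by (induction t) (auto intro: map_idI)

lemma well_formed_graft:
  "well_formed ar t \<Longrightarrow> (\<And>i. i \<in> set (leaves t) \<Longrightarrow> well_formed ar (s i)) \<Longrightarrow> well_formed ar (graft s t)"
  by (induction t) auto

lemma leaves_relabel: "leaves (relabel f t) = map f (leaves t)"
proof -
  have "concat (map (\<lambda>i. [f i]) xs) = map f xs" for xs by (induction xs) simp_all
  then show ?thesis by (simp add: relabel_def leaves_graft)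
qed

lemma relabel_simps [simp]:
  "relabel f (Leaf i) = Leaf (f i)"
  "relabel f (Node g ts) = Node g (map (relabel f) ts)"
  by (simp_all add: relabel_def)

lemma well_formed_relabel: "well_formed ar t \<Longrightarrow> well_formed ar (relabel f t)"
  by (simp add: relabel_def well_formed_graft)

lemma relabel_relabel: "relabel f (relabel g t) = relabel (f \<circ> g) t"
  by (simp add: relabel_def graft_graft)

lemma relabel_cong: "(\<And>i. i \<in> set (leaves t) \<Longrightarrow> f i = g i) \<Longrightarrow> relabel f t = relabel g t"
  unfolding relabel_def by (rule graft_cong) simp

lemma relabel_ident: "(\<And>i. i \<in> set (leaves t) \<Longrightarrow> f i = i) \<Longrightarrow> relabel f t = t"
  using relabel_cong [of t f "\<lambda>i. i"] by (simp add: relabel_def)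

lemma relabel_graft: "relabel f (graft s t) = graft (\<lambda>i. relabel f (s i)) t"
  by (simp add: relabel_def graft_graft)

text \<open>The multiset form puts distinctness and range of the labels into one equation, so the
  leaves of a composite can be computed as a sum of multisets, whatever their planar order.\<close>

lemma tree_monomials_iff_mset:
  "t \<in> tree_monomials ar n \<longleftrightarrow> well_formed ar t \<and> mset (leaves t) = mset [0..<n]"
proof -
  have "distinct xs \<and> set xs = {..<n} \<longleftrightarrow> mset xs = mset [0..<n]" for xs
    using set_eq_iff_mset_eq_distinct [of xs "[0..<n]"] mset_eq_imp_distinct_iff [of xs "[0..<n]"]
      mset_eq_setD [of xs "[0..<n]"] by (auto simp: atLeast0LessThan)
  then show ?thesis by (simp add: tree_monomials_def)
qed

lemma tree_monomials_length: "t \<in> tree_monomials ar n \<Longrightarrow> length (leaves t) = n"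
  by (metis tree_monomials_iff_mset length_upt minus_nat.diff_0 size_mset)

lemma tree_monomials_set: "t \<in> tree_monomials ar n \<Longrightarrow> set (leaves t) = {..<n}"
  by (simp add: tree_monomials_def)

lemma leaves_tree_comp:
  "leaves (tree_comp ks t ss) = concat (map (\<lambda>i. map ((+) (offset ks i)) (leaves (ss ! i))) (leaves t))"
  by (simp add: tree_comp_def leaves_graft leaves_relabel)

lemma concat_map_offset_upt:
  "concat (map (\<lambda>i. map ((+) (offset ks i)) [0..<ks ! i]) [0..<length ks]) = [0..<sum_list ks]"
    (is "concat ?xss = _")
proof (rule nth_equalityI)
  have len: "map length ?xss = ks" by (intro nth_equalityI) simp_all
  then show length: "length (concat ?xss) = length [0..<sum_list ks]"
    unfolding length_concat_sum_list len by simp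
  fix x assume "x < length (concat ?xss)"
  then have "x < sum_list ks" using length by simp
  then obtain i r where "i < length ks" "r < ks ! i" "x = offset ks i + r" by (rule offsetE)
  then show "concat ?xss ! x = [0..<sum_list ks] ! x"
    using nth_concat_offset [OF _ _ len, of i r] \<open>x < sum_list ks\<close> by simp
qed

lemma mset_concat_map: "mset (concat (map f xs)) = (\<Sum>x\<in>#mset xs. mset (f x))"
  by (induction xs) simp_all

lemma tree_comp_in_tree_monomials:
  assumes t: "t \<in> tree_monomials ar (length ks)"
    and ss: "\<And>i. i < length ks \<Longrightarrow> ss ! i \<in> tree_monomials ar (ks ! i)"
  shows "tree_comp ks t ss \<in> tree_monomials ar (sum_list ks)"
  unfolding tree_monomials_iff_mset
proof
  show "well_formed ar (tree_comp ks t ss)"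
    using assms unfolding tree_comp_def
    by (intro well_formed_graft well_formed_relabel) (auto simp: tree_monomials_def)
  have "mset (leaves (tree_comp ks t ss)) =
      (\<Sum>i\<in>#mset [0..<length ks]. image_mset ((+) (offset ks i)) (mset (leaves (ss ! i))))"
    using t unfolding leaves_tree_comp mset_concat_map tree_monomials_iff_mset by simp
  also have "\<dots> = (\<Sum>i\<in>#mset [0..<length ks]. image_mset ((+) (offset ks i)) (mset [0..<ks ! i]))"
    using ss by (intro arg_cong [where f = sum_mset] image_mset_cong) (auto simp: tree_monomials_iff_mset)
  also have "\<dots> = mset (concat (map (\<lambda>i. map ((+) (offset ks i)) [0..<ks ! i]) [0..<length ks]))"
    unfolding mset_concat_map by simp
  also have "\<dots> = mset [0..<sum_list ks]"
    unfolding concat_map_offset_upt ..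
  finally show "mset (leaves (tree_comp ks t ss)) = mset [0..<sum_list ks]" .
qed

lemma relabel_in_tree_monomials:
  assumes "t \<in> tree_monomials ar n" "\<sigma> permutes {..<n}"
  shows "relabel \<sigma> t \<in> tree_monomials ar n"
  using assms permutes_image [OF assms(2)] permutes_inj_on [OF assms(2)]
  by (simp add: tree_monomials_def well_formed_relabel leaves_relabel distinct_map)

lemma free_args_iff:
  "qs \<in> op_args (free_operad ar) ks \<longleftrightarrow>
    length qs = length ks \<and> (\<forall>i<length ks. Poly_Mapping.keys (qs ! i) \<subseteq> tree_monomials ar (ks ! i))"
  by (auto simp: op_args_def free_operad_simps list_all2_conv_all_nth)

lemma free_comp_closed:
  fixes p :: "'g tree \<Rightarrow>\<^sub>0 'k::field"
  assumes p: "p \<in> op_carrier (free_operad ar) (length ks)" and qs: "qs \<in> op_args (free_operad ar) ks"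
  shows "op_comp (free_operad ar) ks p qs \<in> op_carrier (free_operad ar) (sum_list ks)"
proof -
  have "Poly_Mapping.keys (Poly_Mapping.single (tree_comp ks t ss) (1 :: 'k)) \<subseteq> tree_monomials ar (sum_list ks)"
    if "t \<in> Poly_Mapping.keys p" "list_all2 (\<lambda>q s. s \<in> Poly_Mapping.keys q) qs ss" for t ss
  proof -
    have "tree_comp ks t ss \<in> tree_monomials ar (sum_list ks)"
    proof (rule tree_comp_in_tree_monomials)
      show "t \<in> tree_monomials ar (length ks)" using p that by (auto simp: free_operad_simps)
      show "ss ! i \<in> tree_monomials ar (ks ! i)" if "i < length ks" for i
        using qs \<open>list_all2 _ _ _\<close> that unfolding free_args_iff list_all2_conv_all_nth by (metis subsetD)
    qed
    then show ?thesis by simp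
  qed
  then show ?thesis
    unfolding free_operad_simps carrier_span_space mem_Collect_eq
    by (intro keys_linear_extension_subset keys_multilinear_extension_subset) blast+
qed

lemma free_act_closed:
  assumes "p \<in> op_carrier (free_operad ar) n" "\<sigma> permutes {..<n}"
  shows "op_act (free_operad ar) n p \<sigma> \<in> op_carrier (free_operad ar) n"
  unfolding free_operad_simps carrier_span_space mem_Collect_eq
  using assms permutes_inv [OF assms(2)]
  by (intro keys_linear_extension_subset) (auto simp: free_operad_simps intro!: relabel_in_tree_monomials)

lemma is_linear_free_comp: "is_linear (\<lambda>p. op_comp (free_operad ar) ks p qs)"
  unfolding free_operad_simps by (rule is_linear_linear_extension)

lemma is_linear_free_comp_update:
  assumes "i < length qs"
  shows "is_linear (\<lambda>q. op_comp (free_operad ar) ks p (qs[i := q]))"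
  by (rule is_linearI)
    (simp_all add: free_operad_simps linear_extension_fun_add linear_extension_fun_scale
      is_linear_add [OF is_linear_multilinear_extension [OF assms]]
      is_linear_scale [OF is_linear_multilinear_extension [OF assms]])

lemma is_linear_free_act: "is_linear (\<lambda>p. op_act (free_operad ar) n p \<sigma>)"
  unfolding free_operad_simps by (rule is_linear_linear_extension)

lemma free_comp_basis:
  "op_comp (free_operad ar) ks (Poly_Mapping.single t 1) (map (\<lambda>s. Poly_Mapping.single s 1) ss) =
    Poly_Mapping.single (tree_comp ks t ss) 1"
  by (simp add: free_operad_simps multilinear_extension_basis)

lemma free_act_basis:
  "op_act (free_operad ar) n (Poly_Mapping.single t 1) \<sigma> = Poly_Mapping.single (relabel (Hilbert_Choice.inv \<sigma>) t) 1"
  by (simp add: free_operad_simps)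

section \<open>Evaluation of trees as multi-indices\<close>

text \<open>The permutation with one-line notation \<open>l\<close>, taking the planar place of a
  leaf to its label, extended by the identity as \<open>permutes\<close> demands.\<close>

definition leaf_perm :: "nat list \<Rightarrow> nat \<Rightarrow> nat"
  where "leaf_perm l i = (if i < length l then l ! i else i)"

lemma leaf_perm_permutes:
  assumes "mset l = mset [0..<n]"
  shows "leaf_perm l permutes {..<n}"
proof (rule bij_imp_permutes)
  have l: "distinct l" "set l = {..<n}" "length l = n"
    using assms mset_eq_imp_distinct_iff [OF assms] mset_eq_setD [OF assms] mset_eq_length [OF assms]
    by (auto simp: atLeast0LessThan)
  then have "bij_betw ((!) l) {..<n} {..<n}" by (intro bij_betw_nth) auto
  then show "bij_betw (leaf_perm l) {..<n} {..<n}"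
    by (rule bij_betw_cong [THEN iffD1, rotated]) (simp add: leaf_perm_def l)
  show "leaf_perm l i = i" if "i \<notin> {..<n}" for i using that l by (simp add: leaf_perm_def)
qed

lemma permute_list_leaf_perm:
  "length l = length xs \<Longrightarrow> permute_list (leaf_perm l) xs = map ((!) xs) l"
  by (intro nth_equalityI) (simp_all add: permute_list_def leaf_perm_def)

text \<open>
  \<open>planar_value t\<close> records the numbers of derivations at the leaves of \<open>t\<close> from left to right;
  \<open>tree_value\<close> rearranges them according to the labels of the leaves.
\<close>

fun planar_value :: "cda_generator tree \<Rightarrow> (nat list \<Rightarrow>\<^sub>0 'k::field)"
  where
    "planar_value (Leaf i) = indet 0"
  | "planar_value (Node g ts) =
      (case g of Deriv \<Rightarrow> D (prod_list (map planar_value ts)) | Mult \<Rightarrow> prod_list (map planar_value ts))"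

definition tree_value :: "cda_generator tree \<Rightarrow> (nat list \<Rightarrow>\<^sub>0 'k::field)"
  where "tree_value t = word_act (Hilbert_Choice.inv (leaf_perm (leaves t))) (planar_value t)"

lemma keys_planar_value: "Poly_Mapping.keys (planar_value t :: _ \<Rightarrow>\<^sub>0 'k::field) \<subseteq> words (length (leaves t))"
proof (induction t)
  case (Leaf i)
  show ?case by (simp add: keys_indet)
next
  case (Node g ts)
  then have "Poly_Mapping.keys (prod_list (map planar_value ts) :: _ \<Rightarrow>\<^sub>0 'k) \<subseteq>
      words (sum_list (map (\<lambda>t. length (leaves t)) ts))"
    by (intro keys_prod_list_words) (auto simp: list_all2_conv_all_nth)
  then show ?case by (cases g) (simp_all add: length_concat comp_def keys_D)
qed

lemma word_comp_prod_list:
  assumes "\<And>t. t \<in> set ts \<Longrightarrow> Poly_Mapping.keys (f t) \<subseteq> words (length (g t))"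
  shows "word_comp (prod_list (map f ts)) (concat (map g ts)) = prod_list (map (\<lambda>t. word_comp (f t) (g t)) ts)"
  using assms by (induction ts) (simp_all add: word_comp_one word_comp_times)

text \<open>Structural induction, with products and \<open>D\<close> passing through
  \<open>word_comp\<close>. Arguments follow the planar order of the leaves; a label serves only to
  select \<open>s i\<close>, so labels may repeat.\<close>

lemma planar_value_graft:
  "planar_value (graft s t) =
    (word_comp (planar_value t) (map (\<lambda>i. planar_value (s i)) (leaves t)) :: _ \<Rightarrow>\<^sub>0 'k::field)"
proof (induction t)
  case (Leaf i)
  show ?case by (simp add: word_comp_indet)
next
  case (Node g ts)
  let ?f = "\<lambda>t. map (\<lambda>i. planar_value (s i) :: _ \<Rightarrow>\<^sub>0 'k) (leaves t)"
  have eq: "prod_list (map (planar_value \<circ> graft s) ts) =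
      word_comp (prod_list (map planar_value ts)) (concat (map ?f ts))"
    by (subst word_comp_prod_list)
      (simp_all add: keys_planar_value Node comp_def cong: map_cong)
  have "Poly_Mapping.keys (prod_list (map planar_value ts) :: _ \<Rightarrow>\<^sub>0 'k) \<subseteq>
      words (length (concat (map ?f ts)))"
    using keys_planar_value [of "Node Mult ts"] by (simp add: length_concat comp_def)
  then show ?case
    by (cases g) (simp_all add: eq word_comp_D map_concat comp_def flip: eq)
qed

lemma planar_value_relabel: "planar_value (relabel f t) = planar_value t"
  unfolding relabel_def planar_value_graft
  using word_comp_unit_right [OF keys_planar_value, of t] by (simp add: map_replicate_const)

text \<open>Relabelling by \<open>inv \<sigma>\<close> turns the leaf permutation
  \<open>\<pi>\<close> into \<open>inv \<sigma> \<circ> \<pi>\<close>, with inverse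
  \<open>inv \<pi> \<circ> \<sigma>\<close>; acting by that is acting by \<open>inv \<pi>\<close>
  and then by \<open>\<sigma>\<close>. So the inverse in \<open>tree_value\<close> is what matches
  the right action.\<close>

lemma tree_value_act:
  assumes "t \<in> tree_monomials ar n" "\<sigma> permutes {..<n}"
  shows "tree_value (relabel (Hilbert_Choice.inv \<sigma>) t) = (word_act \<sigma> (tree_value t) :: _ \<Rightarrow>\<^sub>0 'k::field)"
proof -
  let ?l = "leaves t"
  note inv = permutes_inv [OF assms(2)]
  have len: "length ?l = n" using assms(1) by (rule tree_monomials_length)
  have perm: "leaf_perm ?l permutes {..<n}"
    using assms(1) by (intro leaf_perm_permutes) (simp add: tree_monomials_iff_mset)
  have "leaf_perm (map (Hilbert_Choice.inv \<sigma>) ?l) = Hilbert_Choice.inv \<sigma> \<circ> leaf_perm ?l"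
    using inv len by (auto simp: leaf_perm_def fun_eq_iff permutes_def)
  then have "Hilbert_Choice.inv (leaf_perm (map (Hilbert_Choice.inv \<sigma>) ?l)) =
      Hilbert_Choice.inv (leaf_perm ?l) \<circ> \<sigma>"
    using perm inv assms(2) by (simp add: o_inv_distrib permutes_bij permutes_inv_inv)
  then show ?thesis
    using word_act_comp [OF keys_planar_value, of \<sigma> t "Hilbert_Choice.inv (leaf_perm ?l)", where 'a = 'k] assms(2) len
    by (simp add: tree_value_def leaves_relabel planar_value_relabel)
qed

text \<open>The planar values agree by \<open>planar_value_graft\<close>, so only permutations are
  compared: the two equivariance laws of \<open>word_comp\<close> produce a composite of block
  permutations, which has to be the inverse of the leaf permutation of the composite tree.\<close>

lemma tree_value_comp:
  assumes t: "t \<in> tree_monomials ar (length ks)"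
    and ss: "length ss = length ks" "\<And>i. i < length ks \<Longrightarrow> ss ! i \<in> tree_monomials ar (ks ! i)"
  shows "tree_value (tree_comp ks t ss) = (word_comp (tree_value t) (map tree_value ss) :: _ \<Rightarrow>\<^sub>0 'k::field)"
proof -
  let ?l = "leaves t" and ?l' = "leaves (tree_comp ks t ss)" and ?es = "map planar_value ss :: (_ \<Rightarrow>\<^sub>0 'k) list"
  define \<sigma> where "\<sigma> = Hilbert_Choice.inv (leaf_perm ?l)"
  define \<tau> where "\<tau> i = Hilbert_Choice.inv (leaf_perm (leaves (ss ! i)))" for i
  have len: "length ?l = length ks" using t by (rule tree_monomials_length)
  have len_ss: "length (leaves (ss ! i)) = ks ! i" if "i < length ks" for i
    using ss(2) [OF that] by (rule tree_monomials_length)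
  have perm_t: "leaf_perm ?l permutes {..<length ks}"
    using t by (intro leaf_perm_permutes) (simp add: tree_monomials_iff_mset)
  have perm_ss: "leaf_perm (leaves (ss ! i)) permutes {..<ks ! i}" if "i < length ks" for i
    using ss(2) [OF that] by (intro leaf_perm_permutes) (simp add: tree_monomials_iff_mset)
  have perm': "leaf_perm ?l' permutes {..<sum_list ks}"
    using tree_comp_in_tree_monomials [OF t ss(2)]
    by (intro leaf_perm_permutes) (simp add: tree_monomials_iff_mset)
  have \<sigma>: "\<sigma> permutes {..<length ks}" and \<tau>: "\<And>i. i < length ks \<Longrightarrow> \<tau> i permutes {..<ks ! i}"
    unfolding \<sigma>_def \<tau>_def using perm_t perm_ss by (simp_all add: permutes_inv)
  have inv_\<sigma>: "Hilbert_Choice.inv \<sigma> = leaf_perm ?l"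
    unfolding \<sigma>_def using perm_t by (rule permutes_inv_inv)
  have keys_t: "Poly_Mapping.keys (planar_value t :: _ \<Rightarrow>\<^sub>0 'k) \<subseteq> words (length ks)"
    using keys_planar_value [of t] len by simp
  have keys_ss: "list_all2 (\<lambda>k q. Poly_Mapping.keys q \<subseteq> words k) ks ?es"
    using keys_planar_value len_ss ss(1) by (force simp: list_all2_conv_all_nth)
  have "map ((!) ?es) ?l = map (\<lambda>i. planar_value (ss ! i)) ?l"
    using ss(1) tree_monomials_set [OF t] by (intro map_cong) simp_all
  then have es: "permute_list (Hilbert_Choice.inv \<sigma>) ?es = map (\<lambda>i. planar_value (ss ! i)) ?l"
    unfolding inv_\<sigma> using ss(1) len by (simp add: permute_list_leaf_perm)
  have planar: "word_comp (planar_value t) (map (\<lambda>i. planar_value (ss ! i)) ?l) =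
      (planar_value (tree_comp ks t ss) :: _ \<Rightarrow>\<^sub>0 'k)"
    by (simp add: tree_comp_def planar_value_graft planar_value_relabel)
  \<comment> \<open>Input \<open>r\<close> of the tree put at leaf \<open>i\<close> goes to its
    planar place \<open>\<tau> i r\<close> inside that tree; then the whole tree goes to the planar
    place \<open>\<sigma> i\<close> of leaf \<open>i\<close>.\<close>
  let ?b = "block_perm ks \<sigma> (\<lambda>_. id) \<circ> block_perm ks id \<tau>"
  have "map length (map (\<lambda>i. map ((+) (offset ks i)) (leaves (ss ! i))) ?l) = map ((!) ks) ?l"
    using tree_monomials_set [OF t] by (simp add: len_ss)
  then have blocks: "map length (map (\<lambda>i. map ((+) (offset ks i)) (leaves (ss ! i))) ?l) =
      permute_list (Hilbert_Choice.inv \<sigma>) ks"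
    unfolding inv_\<sigma> using len by (simp add: permute_list_leaf_perm)
  \<comment> \<open>The leaf at place \<open>?b x\<close> of the composite tree carries the label
    \<open>x\<close>: a position is split into block and rest, and each part is inverted
    separately.\<close>
  have "leaf_perm ?l' (?b x) = x" for x
  proof (cases "x < sum_list ks")
    case True
    then obtain i r where x: "i < length ks" "r < ks ! i" "x = offset ks i + r" by (rule offsetE)
    have \<tau>ir: "\<tau> i r < ks ! i" "leaves (ss ! i) ! \<tau> i r = r"
    proof -
      show "\<tau> i r < ks ! i" using permutes_lessThan_iff [OF \<tau> [OF x(1)], of r] x(2) by simp
      then show "leaves (ss ! i) ! \<tau> i r = r"
        using permutes_inverses(1) [OF perm_ss [OF x(1)], of r] len_ss [OF x(1)]
        unfolding \<tau>_def leaf_perm_def [of _ "Hilbert_Choice.inv _ _"] by simp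
    qed
    have \<sigma>i: "\<sigma> i < length ks" "?l ! \<sigma> i = i"
    proof -
      show "\<sigma> i < length ks" using permutes_lessThan_iff [OF \<sigma>, of i] x(1) by simp
      then show "?l ! \<sigma> i = i"
        using permutes_inverses(1) [OF perm_t, of i] len
        unfolding \<sigma>_def leaf_perm_def [of _ "Hilbert_Choice.inv _ _"] by simp
    qed
    have "?b x = offset (permute_list (Hilbert_Choice.inv \<sigma>) ks) (\<sigma> i) + \<tau> i r"
      using x \<tau>ir by (simp add: block_perm_offset)
    moreover from this have "leaf_perm ?l' (?b x) = ?l' ! (?b x)"
    proof -
      have "?b x < sum_list ks"
        using True permutes_lessThan_iff [OF block_perm_permutes [OF \<sigma>, of "\<lambda>_. id"]]
          permutes_lessThan_iff [OF block_perm_permutes [OF permutes_id \<tau>]]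
        by (simp add: permutes_id)
      then show ?thesis
        using tree_monomials_length [OF tree_comp_in_tree_monomials [OF t ss(2)]] by (simp add: leaf_perm_def)
    qed
    ultimately show ?thesis
      using x \<tau>ir \<sigma>i len len_ss nth_concat_offset [OF _ _ blocks, of "\<sigma> i" "\<tau> i r"]
      by (simp add: leaves_tree_comp)
  next
    case False
    then show ?thesis
      using tree_monomials_length [OF tree_comp_in_tree_monomials [OF t ss(2)]]
      by (simp add: block_perm_def leaf_perm_def)
  qed
  then have b: "?b = Hilbert_Choice.inv (leaf_perm ?l')"
    by (intro ext) (simp add: permutes_inv_eq [OF perm', symmetric, THEN iffD1] eq_commute permutes_inv_eq [OF perm'])
  have "map tree_value ss = map (\<lambda>i. word_act (\<tau> i) (?es ! i)) [0..<length ks]"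
    using ss(1) by (intro nth_equalityI) (simp_all add: tree_value_def \<tau>_def)
  then have "word_comp (tree_value t) (map tree_value ss) =
      word_act (block_perm ks id \<tau>) (word_comp (word_act \<sigma> (planar_value t)) ?es)"
    using word_comp_inner [OF keys_word_act [OF keys_t] \<tau> keys_ss, of \<sigma>]
    by (simp add: tree_value_def \<sigma>_def)
  also have "\<dots> = word_act (block_perm ks id \<tau>)
      (word_act (block_perm ks \<sigma> (\<lambda>_. id)) (planar_value (tree_comp ks t ss)))"
    by (simp only: word_comp_outer [OF keys_t \<sigma> keys_ss] es planar)
  also have "\<dots> = word_act ?b (planar_value (tree_comp ks t ss))"
  proof (rule word_act_comp)
    show "Poly_Mapping.keys (planar_value (tree_comp ks t ss) :: _ \<Rightarrow>\<^sub>0 'k) \<subseteq> words (sum_list ks)"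
      using keys_planar_value tree_monomials_length [OF tree_comp_in_tree_monomials [OF t ss(2)]] by metis
    show "block_perm ks id \<tau> permutes {..<sum_list ks}"
      using \<tau> by (intro block_perm_permutes) (simp_all add: permutes_id)
  qed
  finally show ?thesis by (simp only: b tree_value_def)
qed

text \<open>Both generators have positive arity, so every tree has a leaf; this is the tree side of
  excluding the empty word.\<close>

lemma leaves_nonempty: "well_formed cda_arity t \<Longrightarrow> leaves t \<noteq> []"
proof (induction t)
  case (Node g ts)
  then obtain s where "s \<in> set ts" by (cases g; cases ts) auto
  with Node show ?case by auto
qed simp

lemma tree_value_in_carrier:
  assumes "t \<in> tree_monomials cda_arity n"
  shows "tree_value t \<in> op_carrier NMI n"
proof -
  have "n > 0" using assms leaves_nonempty [of t] tree_monomials_length [of t] by (auto simp: tree_monomials_def)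
  moreover have "Poly_Mapping.keys (planar_value t) \<subseteq> words n"
    using keys_planar_value [of t] tree_monomials_length [OF assms] by simp
  ultimately have "planar_value t \<in> op_carrier NMI n" by (auto simp: NMI_carrier_iff)
  then show ?thesis unfolding tree_value_def by (rule word_act_in_carrier)
qed

text \<open>A pair holds the label of a leaf and the number of derivations on it. Labels are
  explicit so that a comb can be reordered while each leaf keeps its derivations. The value at the
  empty list is a dummy.\<close>

fun comb :: "(nat \<times> nat) list \<Rightarrow> cda_generator tree"
  where
    "comb [] = Leaf 0"
  | "comb [(i, d)] = ((\<lambda>t. Node Deriv [t]) ^^ d) (Leaf i)"
  | "comb (x # y # ps) = Node Mult [comb [x], comb (y # ps)]"

lemma comb_Cons: "ps \<noteq> [] \<Longrightarrow> comb (x # ps) = Node Mult [comb [x], comb ps]"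
  by (cases ps) simp_all

lemma leaves_comb: "ps \<noteq> [] \<Longrightarrow> leaves (comb ps) = map fst ps"
proof (induction ps rule: comb.induct)
  case (2 i d)
  show ?case by (induction d) simp_all
qed simp_all

lemma well_formed_comb: "well_formed cda_arity (comb ps)"
proof (induction ps rule: comb.induct)
  case (2 i d)
  show ?case by (induction d) simp_all
qed (simp_all add: numeral_2_eq_2)

lemma planar_value_comb: "ps \<noteq> [] \<Longrightarrow> planar_value (comb ps) = Poly_Mapping.single (map snd ps) 1"
proof (induction ps rule: comb.induct)
  case (2 i d)
  show ?case by (induction d) (simp_all add: indet_def D_indet [unfolded indet_def])
qed (simp_all flip: single_append)

lemma comb_in_tree_monomials:
  "w \<noteq> [] \<Longrightarrow> comb (zip [0..<length w] w) \<in> tree_monomials cda_arity (length w)"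
  by (simp add: tree_monomials_iff_mset well_formed_comb leaves_comb)

text \<open>Combs with increasing labels form a section of the value map on words; they give
  surjectivity and reappear as the representatives in \<open>normal_form\<close>.\<close>

lemma tree_value_comb:
  assumes "w \<noteq> []"
  shows "tree_value (comb (zip [0..<length w] w)) = Poly_Mapping.single w 1"
proof -
  have "leaf_perm [0..<n] = id" for n by (auto simp: leaf_perm_def fun_eq_iff)
  with assms show ?thesis
    by (simp add: tree_value_def planar_value_comb leaves_comb)
qed

section \<open>The value map on the free operad\<close>

abbreviation trees_value :: "(cda_generator tree \<Rightarrow>\<^sub>0 'k::field) \<Rightarrow> (nat list \<Rightarrow>\<^sub>0 'k)"
  where "trees_value \<equiv> linear_extension tree_value"

lemma trees_value_in_carrier:
  assumes "p \<in> op_carrier (free_operad cda_arity) n"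
  shows "trees_value p \<in> op_carrier NMI n"
  using assms tree_value_in_carrier unfolding free_operad_simps NMI_simps carrier_span_space mem_Collect_eq
  by (intro keys_linear_extension_subset) blast

lemma trees_value_comp:
  fixes p :: "cda_generator tree \<Rightarrow>\<^sub>0 'k::field"
  assumes p: "p \<in> op_carrier (free_operad cda_arity) (length ks)"
    and qs: "qs \<in> op_args (free_operad cda_arity) ks"
  shows "trees_value (op_comp (free_operad cda_arity) ks p qs) = word_comp (trees_value p) (map trees_value qs)"
proof (rule is_linear_ext [where x = p])
  show "is_linear (\<lambda>p. trees_value (op_comp (free_operad cda_arity) ks p qs))"
    "is_linear (\<lambda>p. word_comp (trees_value p) (map trees_value qs))"
    by (intro is_linear_compose [OF is_linear_linear_extension] is_linear_compose [OF is_linear_word_comp]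
        is_linear_linear_extension is_linear_free_comp)+
  fix t assume "t \<in> Poly_Mapping.keys p"
  then have t: "t \<in> tree_monomials cda_arity (length ks)" using p by (auto simp: free_operad_simps)
  show "trees_value (op_comp (free_operad cda_arity) ks (Poly_Mapping.single t 1) qs) =
      word_comp (trees_value (Poly_Mapping.single t 1)) (map trees_value qs)"
  proof (rule multilinear_ext [where qs = qs and n = "length ks" and B = "\<lambda>i. tree_monomials cda_arity (ks ! i)"])
    fix rs :: "(cda_generator tree \<Rightarrow>\<^sub>0 'k) list" and i
    assume i: "length rs = length ks" "i < length ks"
    then show "is_linear (\<lambda>q. trees_value (op_comp (free_operad cda_arity) ks (Poly_Mapping.single t 1) (rs[i := q])))"
      by (intro is_linear_compose [OF is_linear_linear_extension] is_linear_free_comp_update) simp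
    have "is_linear (\<lambda>q. word_comp (trees_value (Poly_Mapping.single t 1)) ((map trees_value rs)[i := trees_value q]))"
      using i tree_value_in_carrier [OF t, where 'a = 'k]
      by (intro is_linear_compose [OF is_linear_word_comp_update is_linear_linear_extension])
        (simp_all add: NMI_carrier_iff)
    then show "is_linear (\<lambda>q. word_comp (trees_value (Poly_Mapping.single t 1)) (map trees_value (rs[i := q])))"
      by (simp add: map_update)
  next
    fix ss :: "cda_generator tree list"
    assume "length ss = length ks" "\<And>i. i < length ks \<Longrightarrow> ss ! i \<in> tree_monomials cda_arity (ks ! i)"
    then show "trees_value (op_comp (free_operad cda_arity) ks (Poly_Mapping.single t 1) (map (\<lambda>b. Poly_Mapping.single b 1) ss)) =
        word_comp (trees_value (Poly_Mapping.single t 1)) (map trees_value (map (\<lambda>b. Poly_Mapping.single b (1 :: 'k)) ss))"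
      using tree_value_comp [OF t, of ss] by (simp add: free_comp_basis comp_def)
  qed (use qs in \<open>simp_all add: free_args_iff\<close>)
qed

lemma trees_value_act:
  assumes "p \<in> op_carrier (free_operad cda_arity) n" "\<sigma> permutes {..<n}"
  shows "trees_value (op_act (free_operad cda_arity) n p \<sigma>) = word_act \<sigma> (trees_value p)"
proof (rule is_linear_ext [where x = p])
  show "is_linear (\<lambda>p. trees_value (op_act (free_operad cda_arity) n p \<sigma>))" "is_linear (\<lambda>p. word_act \<sigma> (trees_value p))"
    by (intro is_linear_compose [OF is_linear_linear_extension] is_linear_linear_extension is_linear_free_act)+
  fix t assume "t \<in> Poly_Mapping.keys p"
  then have "t \<in> tree_monomials cda_arity n" using assms by (auto simp: free_operad_simps)
  then show "trees_value (op_act (free_operad cda_arity) n (Poly_Mapping.single t 1) \<sigma>) =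
      word_act \<sigma> (trees_value (Poly_Mapping.single t 1))"
    using assms by (simp add: free_act_basis tree_value_act)
qed

theorem operad_cover_trees_value:
  "operad_cover NMI (free_operad cda_arity) (\<lambda>_. trees_value :: (_ \<Rightarrow>\<^sub>0 'k::field) \<Rightarrow> _)"
proof (intro operad_cover.intro operad_cover_axioms.intro operad_NMI)
  fix n
  show "module scalars (op_space (free_operad cda_arity :: ('k, _) operad) n)"
    by (simp add: free_operad_simps module_span_space)
  show "(trees_value :: (_ \<Rightarrow>\<^sub>0 'k) \<Rightarrow> _) \<in> linear_maps (op_space (free_operad cda_arity) n) (op_space NMI n)"
    unfolding free_operad_simps NMI_simps
    by (rule is_linear_imp_linear_maps [OF is_linear_linear_extension])
      (use trees_value_in_carrier in \<open>simp add: free_operad_simps NMI_simps\<close>)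
  show "(trees_value :: (_ \<Rightarrow>\<^sub>0 'k) \<Rightarrow> _) ` op_carrier (free_operad cda_arity) n = op_carrier NMI n"
  proof (intro equalityI subsetI)
    fix y :: "nat list \<Rightarrow>\<^sub>0 'k" assume y: "y \<in> op_carrier NMI n"
    let ?t = "\<lambda>w. comb (zip [0..<length w] w)"
    let ?x = "linear_extension (\<lambda>w. Poly_Mapping.single (?t w) 1) y"
    have "trees_value ?x = linear_extension (\<lambda>w. Poly_Mapping.single w 1) y"
      unfolding linear_extension_linear_extension [OF is_linear_linear_extension]
      using y by (intro linear_extension_cong) (auto simp: NMI_simps tree_value_comb)
    then have "trees_value ?x = y" by (simp add: linear_extension_self)
    moreover have "Poly_Mapping.keys ?x \<subseteq> tree_monomials cda_arity n"
      using y by (intro keys_linear_extension_subset) (auto simp: NMI_simps intro!: comb_in_tree_monomials)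
    ultimately show "y \<in> trees_value ` op_carrier (free_operad cda_arity) n"
      by (force simp: free_operad_simps)
  qed (use trees_value_in_carrier in blast)
  show "trees_value (op_unit (free_operad cda_arity) :: _ \<Rightarrow>\<^sub>0 'k) = op_unit NMI"
    using tree_value_comb [of "[0]"] by (simp add: free_operad_simps NMI_simps indet_def)
  show "op_unit (free_operad cda_arity) \<in> op_carrier (free_operad cda_arity :: ('k, _) operad) 1"
    by (simp add: free_operad_simps tree_monomials_iff_mset)
next
  fix p :: "cda_generator tree \<Rightarrow>\<^sub>0 'k" and ks and qs :: "(cda_generator tree \<Rightarrow>\<^sub>0 'k) list"
  assume "p \<in> op_carrier (free_operad cda_arity) (length ks)" "qs \<in> op_args (free_operad cda_arity) ks"
  moreover from this have "map2 (\<lambda>_. trees_value) ks qs = map trees_value qs"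
    by (intro nth_equalityI) (auto simp: length_op_args)
  ultimately show "trees_value (op_comp (free_operad cda_arity) ks p qs) =
      op_comp NMI ks (trees_value p) (map2 (\<lambda>_. trees_value) ks qs)"
    by (simp add: NMI_simps trees_value_comp)
qed (simp_all add: free_comp_closed free_act_closed trees_value_act NMI_simps)

section \<open>Normal forms modulo the relations\<close>

abbreviation monomial :: "'b \<Rightarrow> ('b \<Rightarrow>\<^sub>0 'k::field)"
  where "monomial b \<equiv> Poly_Mapping.single b 1"

abbreviation mult_tree :: "cda_generator tree \<Rightarrow> cda_generator tree \<Rightarrow> cda_generator tree"
  where "mult_tree a b \<equiv> Node Mult [a, b]"

abbreviation deriv_tree :: "cda_generator tree \<Rightarrow> cda_generator tree"
  where "deriv_tree a \<equiv> Node Deriv [a]"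

lemma linear_extension_fun_diff:
  "linear_extension (\<lambda>b. f b - g b) x = linear_extension f x - linear_extension g x"
  using linear_extension_fun_add [of f "\<lambda>b. scale (- 1) (g b)" x]
  by (simp add: linear_extension_fun_scale) (simp add: scale_uminus)

text \<open>Closure of an ideal concerns composites of trees labelled from \<open>0\<close> on. This
  identity turns such a composite into a graft of trees with arbitrary labels, block
  \<open>i\<close> receiving the labels \<open>lss ! i\<close>.\<close>

lemma relabel_tree_comp:
  assumes t: "t \<in> tree_monomials ar (length lss)"
    and us: "\<And>i. i < length lss \<Longrightarrow> us ! i \<in> tree_monomials ar (length (lss ! i))"
  shows "relabel ((!) (concat lss)) (tree_comp (map length lss) t us) =
    graft (\<lambda>i. relabel ((!) (lss ! i)) (us ! i)) t"
  unfolding tree_comp_def relabel_graft relabel_relabel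
proof (intro graft_cong relabel_cong)
  fix i j assume i: "i \<in> set (leaves t)" and j: "j \<in> set (leaves (us ! i))"
  have i: "i < length lss" using i tree_monomials_set [OF t] by simp
  moreover have "j < length (lss ! i)" using j tree_monomials_set [OF us [OF i]] by simp
  ultimately show "((!) (concat lss) \<circ> (\<lambda>j. offset (map length lss) i + j)) j = lss ! i ! j"
    by (simp add: nth_concat_offset)
qed

lemma corolla_in_tree_monomials: "Node g (map Leaf [0..<ar g]) \<in> tree_monomials ar (ar g)"
proof -
  have "concat (map (\<lambda>i. [i]) xs) = xs" for xs :: "nat list" by (induction xs) simp_all
  then show ?thesis by (simp add: tree_monomials_iff_mset comp_def)
qed

lemma graft_corolla: "length ts = n \<Longrightarrow> graft ((!) ts) (Node g (map Leaf [0..<n])) = Node g ts"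
  by (auto simp: comp_def intro: map_nth)

text \<open>Standardises the labels of \<open>t\<close>, which may repeat: the standardised subtrees
  are composed into the corolla at the root, and \<open>relabel_tree_comp\<close> restores the
  labels.\<close>

lemma planarE:
  assumes "well_formed ar t"
  obtains u where "u \<in> tree_monomials ar (length (leaves t))" "relabel ((!) (leaves t)) u = t"
proof -
  have "\<exists>u\<in>tree_monomials ar (length (leaves t)). relabel ((!) (leaves t)) u = t"
    using assms
  proof (induction t)
    case (Leaf i)
    show ?case by (rule bexI [of _ "Leaf 0"]) (simp_all add: tree_monomials_iff_mset)
  next
    case (Node g ts)
    let ?lss = "map leaves ts"
    have "\<forall>i<length ts. \<exists>u\<in>tree_monomials ar (length (leaves (ts ! i))). relabel ((!) (leaves (ts ! i))) u = ts ! i"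
      using Node by auto
    then obtain u where u: "\<And>i. i < length ts \<Longrightarrow> u i \<in> tree_monomials ar (length (leaves (ts ! i)))"
      "\<And>i. i < length ts \<Longrightarrow> relabel ((!) (leaves (ts ! i))) (u i) = ts ! i"
      by metis
    let ?us = "map u [0..<length ts]" and ?t = "Node g (map Leaf [0..<ar g])"
    have ts: "length ts = ar g" using Node.prems by simp
    have t: "?t \<in> tree_monomials ar (length ?lss)" using corolla_in_tree_monomials [of g ar] ts by simp
    have us: "?us ! i \<in> tree_monomials ar (length (?lss ! i))" if "i < length ?lss" for i using u that by simp
    have "relabel ((!) (concat ?lss)) (tree_comp (map length ?lss) ?t ?us) =
        graft (\<lambda>i. relabel ((!) (?lss ! i)) (?us ! i)) ?t"
      by (rule relabel_tree_comp [OF t us])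
    also have "\<dots> = graft ((!) ts) ?t"
      using u ts by (intro graft_cong) (auto simp: tree_monomials_set [OF corolla_in_tree_monomials])
    also have "\<dots> = Node g ts" by (rule graft_corolla [OF ts])
    finally show ?case
      using tree_comp_in_tree_monomials [of ?t ar "map length ?lss" ?us] t us
      by (intro bexI [of _ "tree_comp (map length ?lss) ?t ?us"]) (simp_all add: length_concat comp_def)
  qed
  then show ?thesis using that by blast
qed

lemma planar_list_exists:
  assumes "list_all (well_formed ar) ts"
  shows "\<exists>us. length us = length ts \<and>
    (\<forall>i<length ts. us ! i \<in> tree_monomials ar (length (leaves (ts ! i))) \<and>
      relabel ((!) (leaves (ts ! i))) (us ! i) = ts ! i)"
proof -
  have "\<exists>u. i < length ts \<longrightarrow> u \<in> tree_monomials ar (length (leaves (ts ! i))) \<and>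
      relabel ((!) (leaves (ts ! i))) u = ts ! i" for i
    using planarE [of ar "ts ! i"] assms unfolding list_all_length by metis
  then obtain u where "\<And>i. i < length ts \<longrightarrow> u i \<in> tree_monomials ar (length (leaves (ts ! i))) \<and>
      relabel ((!) (leaves (ts ! i))) (u i) = ts ! i"
    by metis
  then show ?thesis by (intro exI [of _ "map u [0..<length ts]"]) simp
qed

lemma cda_relations_eq:
  "cda_relations =
    {(2, monomial (mult_tree (Leaf 1) (Leaf 0)) - monomial (mult_tree (Leaf 0) (Leaf 1))),
     (3, monomial (mult_tree (mult_tree (Leaf 0) (Leaf 1)) (Leaf 2))
       - monomial (mult_tree (Leaf 0) (mult_tree (Leaf 1) (Leaf 2)))),
     (2, monomial (deriv_tree (mult_tree (Leaf 0) (Leaf 1)))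
       - (monomial (mult_tree (deriv_tree (Leaf 0)) (Leaf 1))
         + monomial (mult_tree (Leaf 0) (deriv_tree (Leaf 1)))))}"
  unfolding cda_relations_def Let_def partial_comp_def free_gen_def
  by (simp add: free_operad_simps multilinear_extension_Cons tree_comp_def offset_def
      numeral_2_eq_2 upt_rec transpose_def inv_transpose_eq)

text \<open>\<open>J\<close> is an arbitrary ideal containing the relations. The generated ideal is
  an intersection over such ideals, so membership is to be shown in each of them.\<close>

locale cda_ideal = operad_ideal "free_operad cda_arity" J
  for J :: "nat \<Rightarrow> (cda_generator tree \<Rightarrow>\<^sub>0 'k::field) set" +
  assumes relations: "(n, r) \<in> cda_relations \<Longrightarrow> r \<in> J n"
begin

context
  fixes n :: nat
begin

interpretation S: submodule "J n" scalars "span_space (tree_monomials cda_arity n)"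
  using submodule [of n] unfolding free_operad_simps .

lemma ideal_keys: "x \<in> J n \<Longrightarrow> Poly_Mapping.keys x \<subseteq> tree_monomials cda_arity n"
  using S.subset unfolding partial_object.select_convs(1) by (auto dest: subsetD)

lemma ideal_zero: "0 \<in> J n"
  using S.one_closed by simp

lemma ideal_add: "x \<in> J n \<Longrightarrow> y \<in> J n \<Longrightarrow> x + y \<in> J n"
  using S.m_closed [of x y] by simp

lemma ideal_scale: "x \<in> J n \<Longrightarrow> scale c x \<in> J n"
  using S.smult_closed [of c x] by (simp add: ring_of_type_algebra_def)

end

section \<open>Ideal elements with arbitrary leaf labels\<close>

abbreviation relabel_poly :: "(nat \<Rightarrow> nat) \<Rightarrow> (cda_generator tree \<Rightarrow>\<^sub>0 'k) \<Rightarrow> (cda_generator tree \<Rightarrow>\<^sub>0 'k)"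
  where "relabel_poly f \<equiv> linear_extension (\<lambda>t. monomial (relabel f t))"

text \<open>Rewriting inside a tree needs the ideal for arbitrary leaf labels, listed here by \<open>l\<close>.\<close>

definition labelled :: "nat list \<Rightarrow> (cda_generator tree \<Rightarrow>\<^sub>0 'k) set"
  where "labelled l = relabel_poly ((!) l) ` J (length l)"

lemma labelled_zero: "0 \<in> labelled l"
  unfolding labelled_def using ideal_zero by (force simp: image_iff)

lemma labelled_add: "x \<in> labelled l \<Longrightarrow> y \<in> labelled l \<Longrightarrow> x + y \<in> labelled l"
  unfolding labelled_def by (auto simp: image_iff ideal_add simp flip: linear_extension_add)

lemma labelled_scale: "x \<in> labelled l \<Longrightarrow> scale c x \<in> labelled l"
  unfolding labelled_def
  by (auto simp: image_iff ideal_scale simp flip: is_linear_scale [OF is_linear_linear_extension])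

lemma labelled_uminus: "x \<in> labelled l \<Longrightarrow> - x \<in> labelled l"
  using labelled_scale [of x l "- 1"] by (simp add: scale_uminus)

lemma labelled_sum:
  assumes "finite A" "\<And>a. a \<in> A \<Longrightarrow> g a \<in> labelled l"
  shows "sum g A \<in> labelled l"
  using assms
proof (induction A rule: finite_induct)
  case empty
  show ?case unfolding sum.empty by (rule labelled_zero)
next
  case (insert a A)
  then show ?case unfolding sum.insert [OF insert.hyps] by (intro labelled_add) simp_all
qed

lemma labelled_linear_extension:
  assumes "\<And>b. b \<in> Poly_Mapping.keys x \<Longrightarrow> f b \<in> labelled l"
  shows "linear_extension f x \<in> labelled l"
  unfolding linear_extension_def
proof (rule labelled_sum)
  show "scale (Poly_Mapping.lookup x b) (f b) \<in> labelled l" if "b \<in> Poly_Mapping.keys x" for b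
    using that by (intro labelled_scale assms)
qed simp

text \<open>Two lists with the same multiset differ by a permutation of positions, and
  \<open>J\<close> is stable under the symmetric group.\<close>

lemma labelled_mset:
  assumes "mset l = mset l'"
  shows "labelled l \<subseteq> labelled l'"
proof
  fix x assume "x \<in> labelled l"
  then obtain y where y: "y \<in> J (length l)" "x = relabel_poly ((!) l) y" by (auto simp: labelled_def)
  obtain \<sigma> where \<sigma>: "\<sigma> permutes {..<length l'}" "permute_list \<sigma> l' = l"
    using mset_eq_permutation [OF assms] by blast
  have len: "length l = length l'" using assms by (rule mset_eq_length)
  let ?z = "op_act (free_operad cda_arity) (length l') y (Hilbert_Choice.inv \<sigma>)"
  have "?z \<in> J (length l')"
    using act_in [of y "length l'"] y len permutes_inv [OF \<sigma>(1)] by simp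
  moreover have "relabel_poly ((!) l') ?z = x"
    unfolding y free_operad_simps
      linear_extension_linear_extension [OF is_linear_linear_extension] linear_extension_basis
      permutes_inv_inv [OF \<sigma>(1)] relabel_relabel
  proof (intro linear_extension_cong arg_cong [where f = monomial] relabel_cong)
    fix t i assume "t \<in> Poly_Mapping.keys y" "i \<in> set (leaves t)"
    then have "i < length l'" using ideal_keys [OF y(1)] len by (auto simp: tree_monomials_def)
    then show "((!) l' \<circ> \<sigma>) i = l ! i"
      using permute_list_nth [OF \<sigma>(1), of i] unfolding \<sigma>(2) comp_def by simp
  qed
  ultimately show "x \<in> labelled l'" unfolding labelled_def by blast
qed

text \<open>Substituting trees into the leaves of an ideal element: \<open>comp_in_left\<close> is
  applied to the standardised trees, and the original labels are restored by one relabelling of the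
  composite.\<close>

lemma labelled_graft:
  assumes x: "x \<in> J (length ss)" and ss: "list_all (well_formed cda_arity) ss"
  shows "linear_extension (\<lambda>t. monomial (graft ((!) ss) t)) x \<in> labelled (concat (map leaves ss))"
proof -
  let ?lss = "map leaves ss"
  let ?ks = "map length ?lss"
  obtain us where "length us = length ss \<and>
      (\<forall>i<length ss. us ! i \<in> tree_monomials cda_arity (length (leaves (ss ! i))) \<and>
        relabel ((!) (leaves (ss ! i))) (us ! i) = ss ! i)"
    using planar_list_exists [OF ss] ..
  then have us: "length us = length ss"
      "\<And>i. i < length ss \<Longrightarrow> us ! i \<in> tree_monomials cda_arity (length (leaves (ss ! i)))"
      "\<And>i. i < length ss \<Longrightarrow> relabel ((!) (leaves (ss ! i))) (us ! i) = ss ! i"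
    by simp_all
  let ?y = "op_comp (free_operad cda_arity) ?ks x (map monomial us)"
  have y: "?y \<in> J (sum_list ?ks)"
    using x us by (intro comp_in_left) (simp_all add: free_args_iff)
  have eq: "relabel_poly ((!) (concat ?lss)) ?y = linear_extension (\<lambda>t. monomial (graft ((!) ss) t)) x"
  proof (rule is_linear_ext [where x = x])
    show "is_linear (\<lambda>x. relabel_poly ((!) (concat ?lss)) (op_comp (free_operad cda_arity) ?ks x (map monomial us)))"
      by (intro is_linear_compose [OF is_linear_linear_extension] is_linear_free_comp)
    fix t assume "t \<in> Poly_Mapping.keys x"
    then have t: "t \<in> tree_monomials cda_arity (length ?lss)" using ideal_keys [OF x] by auto
    have "relabel ((!) (concat ?lss)) (tree_comp ?ks t us) = graft (\<lambda>i. relabel ((!) (?lss ! i)) (us ! i)) t"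
      using us by (intro relabel_tree_comp [OF t]) simp
    also have "\<dots> = graft ((!) ss) t"
      using us tree_monomials_set [OF t] by (intro graft_cong) simp
    finally show "relabel_poly ((!) (concat ?lss))
        (op_comp (free_operad cda_arity) ?ks (monomial t) (map monomial us)) =
      linear_extension (\<lambda>t. monomial (graft ((!) ss) t)) (monomial t)"
      by (simp add: free_comp_basis)
  qed (rule is_linear_linear_extension)
  show ?thesis
    unfolding labelled_def length_concat_sum_list [of ?lss] by (rule image_eqI, rule eq [symmetric], rule y)
qed

text \<open>Congruence of a subtree implies congruence of the whole tree:
  \<open>comp_in_right\<close> puts the ideal element into position \<open>i\<close> of a corolla
  with standardised neighbours, followed by one relabelling.\<close>

lemma labelled_Node:
  assumes x: "x \<in> labelled l" and ss: "length ss = cda_arity g" "list_all (well_formed cda_arity) ss"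
    and i: "i < length ss"
  shows "linear_extension (\<lambda>u. monomial (Node g (ss[i := u]))) x \<in> labelled (concat ((map leaves ss)[i := l]))"
proof -
  let ?lss = "(map leaves ss)[i := l]" and ?t = "Node g (map Leaf [0..<length ss])"
  let ?ks = "map length ?lss"
  obtain y where y: "y \<in> J (length l)" "x = relabel_poly ((!) l) y" using x by (auto simp: labelled_def)
  obtain us where "length us = length ss \<and>
      (\<forall>i<length ss. us ! i \<in> tree_monomials cda_arity (length (leaves (ss ! i))) \<and>
        relabel ((!) (leaves (ss ! i))) (us ! i) = ss ! i)"
    using planar_list_exists [OF ss(2)] ..
  then have us: "length us = length ss"
      "\<And>i. i < length ss \<Longrightarrow> us ! i \<in> tree_monomials cda_arity (length (leaves (ss ! i)))"
      "\<And>i. i < length ss \<Longrightarrow> relabel ((!) (leaves (ss ! i))) (us ! i) = ss ! i"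
    by simp_all
  note len = us(1)
  have t: "?t \<in> tree_monomials cda_arity (length ?lss)"
    using corolla_in_tree_monomials [of g cda_arity] ss by simp
  let ?qs = "\<lambda>y. (map monomial us)[i := y]"
  let ?z = "\<lambda>y. op_comp (free_operad cda_arity) ?ks (monomial ?t) (?qs y)"
  have z: "?z y \<in> J (sum_list ?ks)"
  proof (rule comp_in_right [where i = i])
    show "?qs y \<in> op_args (free_operad cda_arity) ?ks"
      using us ideal_keys [OF y(1)] i by (auto simp: free_args_iff nth_list_update)
    show "monomial ?t \<in> op_carrier (free_operad cda_arity) (length ?ks)"
      using t by (simp add: free_operad_simps)
  qed (use i len y in simp_all)
  have eq: "relabel_poly ((!) (concat ?lss)) (?z y) =
      linear_extension (\<lambda>u. monomial (Node g (ss[i := u]))) (relabel_poly ((!) l) y)"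
  proof (rule is_linear_ext [where x = y])
    show "is_linear (\<lambda>y. relabel_poly ((!) (concat ?lss)) (?z y))"
      using i len by (intro is_linear_compose [OF is_linear_linear_extension] is_linear_free_comp_update) simp
    show "is_linear (\<lambda>y. linear_extension (\<lambda>u. monomial (Node g (ss[i := u]))) (relabel_poly ((!) l) y))"
      by (intro is_linear_compose [OF is_linear_linear_extension] is_linear_linear_extension)
    fix v assume "v \<in> Poly_Mapping.keys y"
    then have v: "v \<in> tree_monomials cda_arity (length l)" using ideal_keys [OF y(1)] by auto
    have "relabel ((!) (concat ?lss)) (tree_comp ?ks ?t (us[i := v])) =
        graft (\<lambda>j. relabel ((!) (?lss ! j)) (us[i := v] ! j)) ?t"
      using us v i by (intro relabel_tree_comp [OF t]) (auto simp: nth_list_update)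
    also have "\<dots> = graft ((!) (ss[i := relabel ((!) l) v])) ?t"
      using us i by (intro graft_cong) (auto simp: nth_list_update)
    also have "\<dots> = Node g (ss[i := relabel ((!) l) v])"
      by (rule graft_corolla) simp
    finally show "relabel_poly ((!) (concat ?lss)) (?z (monomial v)) =
        linear_extension (\<lambda>u. monomial (Node g (ss[i := u]))) (relabel_poly ((!) l) (monomial v))"
      by (simp only: map_update [of monomial us i v, symmetric] free_comp_basis linear_extension_basis)
  qed
  show ?thesis
    unfolding labelled_def length_concat_sum_list [of ?lss] y(2) by (rule image_eqI, rule eq [symmetric], rule z)
qed

lemma labelled_mult_left:
  assumes "x \<in> labelled l" "well_formed cda_arity b"
  shows "linear_extension (\<lambda>u. monomial (mult_tree u b)) x \<in> labelled (l @ leaves b)"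
  \<comment> \<open>\<open>Leaf 0\<close> only holds the place of the varying factor and is
    overwritten.\<close>
  using labelled_Node [OF assms(1), of "[Leaf 0, b]" Mult 0] assms(2) by simp

lemma labelled_mult_right:
  assumes "x \<in> labelled l" "well_formed cda_arity a"
  shows "linear_extension (\<lambda>u. monomial (mult_tree a u)) x \<in> labelled (leaves a @ l)"
  using labelled_Node [OF assms(1), of "[a, Leaf 0]" Mult 1] assms(2) by simp

lemma labelled_deriv:
  assumes "x \<in> labelled l"
  shows "linear_extension (\<lambda>u. monomial (deriv_tree u)) x \<in> labelled l"
  using labelled_Node [OF assms, of "[Leaf 0]" Deriv 0] by simp

lemmas linear_extension_diff = is_linear_diff [OF is_linear_linear_extension]

section \<open>The three relations for arbitrary subtrees, and reordering of combs\<close>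

lemma labelled_commute:
  assumes "well_formed cda_arity a" "well_formed cda_arity b"
  shows "monomial (mult_tree b a) - monomial (mult_tree a b) \<in> labelled (leaves a @ leaves b)"
proof -
  have "monomial (mult_tree (Leaf 1) (Leaf 0)) - monomial (mult_tree (Leaf 0) (Leaf 1)) \<in> J (length [a, b])"
    by (rule relations) (simp add: cda_relations_eq numeral_2_eq_2)
  from labelled_graft [OF this] show ?thesis
    using assms by (simp add: linear_extension_diff)
qed

lemma labelled_assoc:
  assumes "well_formed cda_arity a" "well_formed cda_arity b" "well_formed cda_arity c"
  shows "monomial (mult_tree (mult_tree a b) c) - monomial (mult_tree a (mult_tree b c)) \<in>
    labelled (leaves a @ leaves b @ leaves c)"
proof -
  have "monomial (mult_tree (mult_tree (Leaf 0) (Leaf 1)) (Leaf 2))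
      - monomial (mult_tree (Leaf 0) (mult_tree (Leaf 1) (Leaf 2))) \<in> J (length [a, b, c])"
    by (rule relations) (simp add: cda_relations_eq numeral_3_eq_3)
  from labelled_graft [OF this] show ?thesis
    using assms by (simp add: linear_extension_diff)
qed

lemma labelled_Leibniz:
  assumes "well_formed cda_arity a" "well_formed cda_arity b"
  shows "monomial (deriv_tree (mult_tree a b))
      - (monomial (mult_tree (deriv_tree a) b) + monomial (mult_tree a (deriv_tree b))) \<in>
    labelled (leaves a @ leaves b)"
proof -
  have "monomial (deriv_tree (mult_tree (Leaf 0) (Leaf 1)))
      - (monomial (mult_tree (deriv_tree (Leaf 0)) (Leaf 1))
        + monomial (mult_tree (Leaf 0) (deriv_tree (Leaf 1)))) \<in> J (length [a, b])"
    by (rule relations) (simp add: cda_relations_eq numeral_2_eq_2)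
  from labelled_graft [OF this] show ?thesis
    using assms by (simp add: linear_extension_diff linear_extension_add)
qed

definition equiv_trees :: "nat list \<Rightarrow> cda_generator tree \<Rightarrow> cda_generator tree \<Rightarrow> bool"
  where "equiv_trees l s t \<longleftrightarrow> monomial s - monomial t \<in> labelled l"

lemma equiv_trees_refl: "equiv_trees l t t"
  by (simp add: equiv_trees_def labelled_zero)

lemma equiv_trees_sym: "equiv_trees l s t \<Longrightarrow> equiv_trees l t s"
  using labelled_uminus [of "monomial s - monomial t" l] by (simp add: equiv_trees_def)

lemma equiv_trees_trans: "equiv_trees l s t \<Longrightarrow> equiv_trees l t u \<Longrightarrow> equiv_trees l s u"
  using labelled_add [of "monomial s - monomial t" l "monomial t - monomial u"] by (simp add: equiv_trees_def)

lemma equiv_trees_mset: "equiv_trees l s t \<Longrightarrow> mset l = mset l' \<Longrightarrow> equiv_trees l' s t"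
  using labelled_mset by (auto simp: equiv_trees_def)

lemma equiv_trees_mult_left:
  "equiv_trees l s t \<Longrightarrow> well_formed cda_arity b \<Longrightarrow> equiv_trees (l @ leaves b) (mult_tree s b) (mult_tree t b)"
  using labelled_mult_left [of "monomial s - monomial t" l b] by (simp add: equiv_trees_def linear_extension_diff)

lemma equiv_trees_mult_right:
  "equiv_trees l s t \<Longrightarrow> well_formed cda_arity a \<Longrightarrow> equiv_trees (leaves a @ l) (mult_tree a s) (mult_tree a t)"
  using labelled_mult_right [of "monomial s - monomial t" l a] by (simp add: equiv_trees_def linear_extension_diff)

text \<open>Associativity moves the brackets to the right, one leading factor of \<open>ps\<close>
  at a time, and keeps the order of the leaves.\<close>

lemma mult_comb:
  assumes "ps \<noteq> []" "qs \<noteq> []"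
  shows "equiv_trees (map fst ps @ map fst qs) (mult_tree (comb ps) (comb qs)) (comb (ps @ qs))"
  using assms(1)
proof (induction ps rule: list_nonempty_induct)
  case (single x)
  show ?case using assms(2) by (simp add: comb_Cons [of qs x] equiv_trees_refl)
next
  case (cons x ps)
  have leaves: "leaves (comb [x]) = [fst x]" "leaves (comb ps) = map fst ps" "leaves (comb qs) = map fst qs"
    using leaves_comb [of "[x]"] leaves_comb [OF cons.hyps] leaves_comb [OF assms(2)] by simp_all
  have "equiv_trees (map fst (x # ps) @ map fst qs)
      (mult_tree (mult_tree (comb [x]) (comb ps)) (comb qs)) (mult_tree (comb [x]) (comb (ps @ qs)))"
  proof (rule equiv_trees_trans)
    show "equiv_trees (map fst (x # ps) @ map fst qs)
        (mult_tree (mult_tree (comb [x]) (comb ps)) (comb qs)) (mult_tree (comb [x]) (mult_tree (comb ps) (comb qs)))"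
      using labelled_assoc [of "comb [x]" "comb ps" "comb qs"] well_formed_comb
      unfolding equiv_trees_def leaves by (simp del: comb.simps)
    show "equiv_trees (map fst (x # ps) @ map fst qs)
        (mult_tree (comb [x]) (mult_tree (comb ps) (comb qs))) (mult_tree (comb [x]) (comb (ps @ qs)))"
      using equiv_trees_mult_right [OF cons.IH well_formed_comb, of "[x]"] unfolding leaves by simp
  qed
  then show ?case
    using cons.hyps by (simp add: comb_Cons [of ps x] comb_Cons [of "ps @ qs" x])
qed

text \<open>Commutativity swaps only the two factors of a product. So \<open>xs\<close> followed by
  \<open>y\<close> is isolated as a left factor by \<open>mult_comb\<close>, swapped there as two
  blocks, and rejoined with \<open>zs\<close>.\<close>

lemma comb_move_to_front:
  "equiv_trees (map fst (xs @ y # zs)) (comb (xs @ y # zs)) (comb (y # xs @ zs))"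
proof (cases "xs = []")
  case False
  have last: "equiv_trees (map fst xs @ [fst y]) (comb (xs @ [y])) (comb (y # xs))"
  proof -
    have "equiv_trees (map fst xs @ [fst y]) (comb (xs @ [y])) (mult_tree (comb xs) (comb [y]))"
      using equiv_trees_sym [OF mult_comb [OF False, of "[y]"]] by simp
    moreover have "equiv_trees (map fst xs @ [fst y]) (comb (y # xs)) (mult_tree (comb xs) (comb [y]))"
      using labelled_commute [of "comb xs" "comb [y]"] well_formed_comb False leaves_comb [of "[y]"]
      by (simp add: equiv_trees_def comb_Cons leaves_comb)
    ultimately show ?thesis by (rule equiv_trees_trans [OF _ equiv_trees_sym])
  qed
  show ?thesis
  proof (cases "zs = []")
    case True
    then show ?thesis using last by simp
  next
    case zs: False
    let ?l = "map fst (xs @ y # zs)"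
    have 1: "equiv_trees ?l (comb (xs @ y # zs)) (mult_tree (comb (xs @ [y])) (comb zs))"
      using equiv_trees_sym [OF mult_comb [of "xs @ [y]" zs]] zs by simp
    have 2: "equiv_trees ?l (mult_tree (comb (xs @ [y])) (comb zs)) (mult_tree (comb (y # xs)) (comb zs))"
      using equiv_trees_mult_left [OF last well_formed_comb, of zs] zs by (simp add: leaves_comb)
    have 3: "equiv_trees ?l (mult_tree (comb (y # xs)) (comb zs)) (comb (y # xs @ zs))"
    proof (rule equiv_trees_mset)
      show "equiv_trees (map fst (y # xs) @ map fst zs) (mult_tree (comb (y # xs)) (comb zs)) (comb (y # xs @ zs))"
        using mult_comb [of "y # xs" zs] zs by simp
    qed simp
    show ?thesis by (rule equiv_trees_trans [OF 1 equiv_trees_trans [OF 2 3]])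
  qed
qed (simp add: equiv_trees_refl)

text \<open>Sorting by extraction: the head of \<open>ps\<close> is brought to the front of
  \<open>qs\<close>, and the remaining lists are compared under this common first factor.\<close>

lemma comb_mset:
  assumes "mset ps = mset qs"
  shows "equiv_trees (map fst ps) (comb ps) (comb qs)"
  using assms
proof (induction ps arbitrary: qs)
  case Nil
  then show ?case by (simp add: equiv_trees_refl)
next
  case (Cons p ps)
  then have "p \<in> set qs" by (metis list.set_intros(1) mset_eq_setD)
  then obtain xs zs where qs: "qs = xs @ p # zs" by (meson split_list)
  with Cons.prems have ps: "mset ps = mset (xs @ zs)" by simp
  have "equiv_trees (map fst (p # ps)) (comb (p # ps)) (comb (p # xs @ zs))"
  proof (cases "ps = []")
    case True
    then show ?thesis using ps by (simp add: equiv_trees_refl)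
  next
    case False
    then have "xs @ zs \<noteq> []" using ps by auto
    then show ?thesis
      using equiv_trees_mult_right [OF Cons.IH [OF ps] well_formed_comb, of "[p]"] False leaves_comb [of "[p]"]
      by (simp add: comb_Cons [of ps p] comb_Cons [of "xs @ zs" p])
  qed
  moreover have "equiv_trees (map fst (p # ps)) (comb (p # xs @ zs)) (comb qs)"
  proof (rule equiv_trees_mset [OF equiv_trees_sym])
    show "equiv_trees (map fst (xs @ p # zs)) (comb qs) (comb (p # xs @ zs))"
      unfolding qs by (rule comb_move_to_front)
    show "mset (map fst (xs @ p # zs)) = mset (map fst (p # ps))"
      using ps by simp
  qed
  ultimately show ?case by (rule equiv_trees_trans)
qed

section \<open>Reduction of every tree to combs\<close>

abbreviation comb_poly :: "nat list \<Rightarrow> (nat list \<Rightarrow>\<^sub>0 'k) \<Rightarrow> (cda_generator tree \<Rightarrow>\<^sub>0 'k)"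
  where "comb_poly l \<equiv> linear_extension (\<lambda>w. monomial (comb (zip l w)))"

text \<open>With \<open>l\<close> nonempty, prepending a letter creates a product node, so
  multiplication by a letter on words is multiplication by a one-leaf comb on trees.\<close>

lemma comb_poly_indet_times:
  assumes "Poly_Mapping.keys q \<subseteq> words (length l)" "l \<noteq> []"
  shows "comb_poly (i # l) (indet d * q) = linear_extension (\<lambda>u. monomial (mult_tree (comb [(i, d)]) u)) (comb_poly l q)"
proof (rule is_linear_ext [where x = q])
  fix w assume "w \<in> Poly_Mapping.keys q"
  then have "zip l w \<noteq> []" using assms by (cases l; cases w) auto
  then show "comb_poly (i # l) (indet d * monomial w) =
      linear_extension (\<lambda>u. monomial (mult_tree (comb [(i, d)]) u)) (comb_poly l (monomial w))"
    by (simp add: comb_Cons flip: single_Cons del: comb.simps)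
qed (intro is_linear_compose [OF is_linear_linear_extension] is_linear_linear_extension is_linear_mult_right)+

text \<open>The Leibniz relation at the root distributes the derivation: on the first factor it
  raises the exponent exactly, on the remaining comb the induction hypothesis applies. A comb with a
  single leaf has no product at its root and is settled by an equality.\<close>

lemma deriv_comb:
  assumes "length l = length w" "l \<noteq> []"
  shows "monomial (deriv_tree (comb (zip l w))) - comb_poly l (D_word w) \<in> labelled l"
  using assms
proof (induction l w rule: list_induct2)
  case (Cons i l d w)
  show ?case
  proof (cases "l = []")
    case True
    then show ?thesis
      using Cons by (simp add: indet_def single_Nil labelled_zero)
  next
    case False
    let ?c = "comb [(i, d)]" and ?t = "comb (zip l w)"
    have zip: "zip l w \<noteq> []" using False Cons.hyps by (cases l; cases w) auto
    have leaves: "leaves ?c = [i]" "leaves ?t = l"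
      using leaves_comb [of "[(i, d)]"] leaves_comb [OF zip] Cons.hyps by simp_all
    have keys: "Poly_Mapping.keys (D_word w :: _ \<Rightarrow>\<^sub>0 'k) \<subseteq> words (length l)"
      using keys_D_word [of w] Cons.hyps by simp
    have "linear_extension (\<lambda>u. monomial (mult_tree ?c u)) (monomial (deriv_tree ?t) - comb_poly l (D_word w)) \<in>
        labelled (leaves ?c @ l)"
      using Cons.IH False by (intro labelled_mult_right well_formed_comb) simp
    then have "monomial (mult_tree ?c (deriv_tree ?t)) - comb_poly (i # l) (indet d * D_word w) \<in> labelled (i # l)"
      using leaves unfolding comb_poly_indet_times [OF keys False]
      by (simp add: linear_extension_diff del: comb.simps)
    moreover have "monomial (deriv_tree (mult_tree ?c ?t))
        - (monomial (mult_tree (deriv_tree ?c) ?t) + monomial (mult_tree ?c (deriv_tree ?t))) \<in> labelled (i # l)"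
      using labelled_Leibniz [of ?c ?t] well_formed_comb leaves by (simp del: comb.simps)
    moreover have "deriv_tree ?c = comb [(i, Suc d)]" by simp
    moreover have "comb_poly (i # l) (indet (Suc d) * monomial w) = monomial (mult_tree (comb [(i, Suc d)]) ?t)"
      using zip by (simp add: comb_Cons flip: single_Cons del: comb.simps)
    moreover have "comb (zip (i # l) (d # w)) = mult_tree ?c ?t"
      using zip by (simp add: comb_Cons del: comb.simps)
    ultimately show ?thesis
      using labelled_add by (fastforce simp: linear_extension_add algebra_simps simp del: comb.simps)
  qed
qed simp

text \<open>Asymmetric by design: the left factor is already a combination of combs, the right one a
  tree known modulo the ideal. For each comb on the left, \<open>b\<close> is replaced by its normal
  form and \<open>mult_comb\<close> joins the two.\<close>

lemma mult_comb_poly: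
  assumes p: "Poly_Mapping.keys p \<subseteq> words (length l)" "l \<noteq> []"
    and q: "Poly_Mapping.keys q \<subseteq> words (length (leaves b))"
    and b: "well_formed cda_arity b" "monomial b - comb_poly (leaves b) q \<in> labelled (leaves b)"
  shows "linear_extension (\<lambda>u. monomial (mult_tree u b)) (comb_poly l p) - comb_poly (l @ leaves b) (p * q) \<in>
    labelled (l @ leaves b)"
proof -
  let ?l' = "leaves b"
  have "monomial (mult_tree (comb (zip l w)) b) - comb_poly (l @ ?l') (monomial w * q) \<in> labelled (l @ ?l')"
    if w: "w \<in> Poly_Mapping.keys p" for w
  proof -
    let ?c = "comb (zip l w)"
    have len: "length w = length l" using w p by auto
    then have zip: "zip l w \<noteq> []" "map fst (zip l w) = l" using p(2) by (cases l; cases w; simp)+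
    have "linear_extension (\<lambda>u. monomial (mult_tree ?c u)) (monomial b - comb_poly ?l' q) \<in> labelled (leaves ?c @ ?l')"
      by (intro labelled_mult_right b well_formed_comb)
    then have "monomial (mult_tree ?c b) - linear_extension (\<lambda>v. monomial (mult_tree ?c (comb (zip ?l' v)))) q \<in>
        labelled (l @ ?l')"
      using zip by (simp add: linear_extension_diff leaves_comb
          linear_extension_linear_extension [OF is_linear_linear_extension])
    moreover have "linear_extension (\<lambda>v. monomial (mult_tree ?c (comb (zip ?l' v)))
        - monomial (comb (zip (l @ ?l') (w @ v)))) q \<in> labelled (l @ ?l')"
    proof (rule labelled_linear_extension)
      fix v assume "v \<in> Poly_Mapping.keys q"
      then have v: "length v = length ?l'" using q by auto
      then have "zip ?l' v \<noteq> []" using leaves_nonempty [OF b(1)] by (cases ?l'; cases v) auto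
      then show "monomial (mult_tree ?c (comb (zip ?l' v))) - monomial (comb (zip (l @ ?l') (w @ v))) \<in> labelled (l @ ?l')"
        using mult_comb [OF zip(1), of "zip ?l' v"] zip len v by (simp add: equiv_trees_def)
    qed
    moreover have "comb_poly (l @ ?l') (monomial w * q) =
        linear_extension (\<lambda>v. monomial (comb (zip (l @ ?l') (w @ v)))) q"
      by (rule is_linear_ext [where x = q])
        (intro is_linear_compose [OF is_linear_linear_extension] is_linear_linear_extension is_linear_mult_right
          | simp flip: single_append)+
    ultimately show ?thesis
      using labelled_add by (fastforce simp: linear_extension_fun_diff)
  qed
  then have "linear_extension (\<lambda>w. monomial (mult_tree (comb (zip l w)) b) - comb_poly (l @ ?l') (monomial w * q)) p
      \<in> labelled (l @ ?l')"
    by (rule labelled_linear_extension)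
  moreover have "linear_extension (\<lambda>w. comb_poly (l @ ?l') (monomial w * q)) p = comb_poly (l @ ?l') (p * q)"
    by (rule is_linear_conv_linear_extension [symmetric])
      (intro is_linear_compose [OF is_linear_linear_extension] is_linear_mult_left)
  ultimately show ?thesis
    by (simp add: linear_extension_fun_diff linear_extension_linear_extension [OF is_linear_linear_extension])
qed

text \<open>With labels listed in planar order, products concatenate the lists of pairs and
  derivations raise single exponents. Nothing is reordered here; commutativity enters in
  \<open>normal_form\<close>.\<close>

lemma planar_normal_form:
  "well_formed cda_arity t \<Longrightarrow> monomial t - comb_poly (leaves t) (planar_value t) \<in> labelled (leaves t)"
proof (induction t)
  case (Leaf i)
  show ?case by (simp add: indet_def labelled_zero)
next
  case (Node g ts)
  show ?case
  proof (cases g)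
    case Deriv
    then obtain t where ts: "ts = [t]" using Node.prems by (auto simp: length_Suc_conv)
    then have t: "well_formed cda_arity t" using Node.prems by simp
    let ?l = "leaves t"
    have "linear_extension (\<lambda>u. monomial (deriv_tree u)) (monomial t - comb_poly ?l (planar_value t)) \<in> labelled ?l"
      using Node.IH [of t] t ts by (intro labelled_deriv) simp
    then have "monomial (deriv_tree t) - linear_extension (\<lambda>w. monomial (deriv_tree (comb (zip ?l w)))) (planar_value t)
        \<in> labelled ?l"
      by (simp add: linear_extension_diff linear_extension_linear_extension [OF is_linear_linear_extension])
    moreover have "linear_extension (\<lambda>w. monomial (deriv_tree (comb (zip ?l w))) - comb_poly ?l (D_word w)) (planar_value t)
        \<in> labelled ?l"
      using keys_planar_value [of t] leaves_nonempty [OF t]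
      by (intro labelled_linear_extension deriv_comb) auto
    moreover have "comb_poly ?l (D (planar_value t)) = linear_extension (\<lambda>w. comb_poly ?l (D_word w)) (planar_value t)"
      by (simp add: D_def linear_extension_linear_extension [OF is_linear_linear_extension])
    ultimately show ?thesis
      using labelled_add by (fastforce simp: Deriv ts linear_extension_fun_diff)
  next
    case Mult
    then obtain a b where ts: "ts = [a, b]" using Node.prems by (auto simp: length_Suc_conv numeral_2_eq_2)
    then have wf: "well_formed cda_arity a" "well_formed cda_arity b" using Node.prems by simp_all
    let ?l = "leaves a @ leaves b"
    have "linear_extension (\<lambda>u. monomial (mult_tree u b)) (monomial a - comb_poly (leaves a) (planar_value a)) \<in> labelled ?l"
      using Node.IH [of a] wf ts by (intro labelled_mult_left) simp_all
    moreover have "linear_extension (\<lambda>u. monomial (mult_tree u b)) (comb_poly (leaves a) (planar_value a))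
        - comb_poly ?l (planar_value a * planar_value b) \<in> labelled ?l"
      using Node.IH [of b] wf ts leaves_nonempty keys_planar_value by (intro mult_comb_poly) simp_all
    ultimately show ?thesis
      using labelled_add by (fastforce simp: Mult ts linear_extension_diff)
  qed
qed

text \<open>Going from planar order to increasing labels reorders each comb, which
  \<open>comb_mset\<close> permits; on words the same reordering is the action inside
  \<open>tree_value\<close>.\<close>

lemma normal_form:
  assumes t: "t \<in> tree_monomials cda_arity n"
  shows "monomial t - comb_poly [0..<n] (tree_value t) \<in> labelled [0..<n]"
proof -
  let ?l = "leaves t" and ?\<sigma> = "Hilbert_Choice.inv (leaf_perm (leaves t))"
  have mset: "mset ?l = mset [0..<n]" using t by (simp add: tree_monomials_iff_mset)
  have len: "length ?l = n" using t by (rule tree_monomials_length)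
  note perm = leaf_perm_permutes [OF mset]
  note \<sigma> = permutes_inv [OF perm]
  have "monomial t - comb_poly ?l (planar_value t) \<in> labelled [0..<n]"
    using planar_normal_form [of t] labelled_mset [OF mset] t by (auto simp: tree_monomials_def)
  moreover have "linear_extension (\<lambda>w. monomial (comb (zip ?l w))
      - monomial (comb (zip [0..<n] (permute_list ?\<sigma> w)))) (planar_value t) \<in> labelled [0..<n]"
  proof (rule labelled_linear_extension)
    fix w :: "nat list" assume "w \<in> Poly_Mapping.keys (planar_value t :: _ \<Rightarrow>\<^sub>0 'k)"
    then have w: "length w = n" using keys_planar_value [of t, where 'k = 'k] len by auto
    \<comment> \<open>The inverse of the leaf permutation is the one that sorts the labels.\<close>
    have "permute_list ?\<sigma> ?l = [0..<n]"
    proof (rule nth_equalityI)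
      fix i assume "i < length (permute_list ?\<sigma> ?l)"
      then have i: "i < n" using len by simp
      have "?\<sigma> i < n" using permutes_lessThan_iff [OF \<sigma>] i by blast
      then have "?l ! ?\<sigma> i = leaf_perm ?l (?\<sigma> i)" by (simp add: leaf_perm_def [of ?l "?\<sigma> i"] len)
      also have "\<dots> = i" by (rule permutes_inverses(1) [OF perm])
      finally show "permute_list ?\<sigma> ?l ! i = [0..<n] ! i"
        using i len \<sigma> by (simp add: permute_list_nth)
    qed (simp add: len)
    then have "zip [0..<n] (permute_list ?\<sigma> w) = permute_list ?\<sigma> (zip ?l w)"
      using permute_list_zip [OF \<sigma>, of ?l w] w len by simp
    moreover have "mset (permute_list ?\<sigma> (zip ?l w)) = mset (zip ?l w)"
      using \<sigma> w len by (intro mset_permute_list) simp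
    ultimately have "equiv_trees (map fst (zip ?l w)) (comb (zip ?l w)) (comb (zip [0..<n] (permute_list ?\<sigma> w)))"
      by (intro comb_mset) simp
    then have "equiv_trees [0..<n] (comb (zip ?l w)) (comb (zip [0..<n] (permute_list ?\<sigma> w)))"
      by (rule equiv_trees_mset) (use w len mset in simp)
    then show "monomial (comb (zip ?l w)) - monomial (comb (zip [0..<n] (permute_list ?\<sigma> w))) \<in> labelled [0..<n]"
      by (simp add: equiv_trees_def)
  qed
  ultimately show ?thesis
    using labelled_add
    by (fastforce simp: tree_value_def linear_extension_fun_diff
        linear_extension_linear_extension [OF is_linear_linear_extension])
qed

text \<open>Summing \<open>normal_form\<close> over \<open>x\<close> gives a normal form that
  depends linearly on the value, so it vanishes here and leaves \<open>x\<close> itself. Relabelling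
  by \<open>[0..<n]\<close> then changes nothing on tree monomials.\<close>

theorem kernel_subset:
  assumes x: "Poly_Mapping.keys x \<subseteq> tree_monomials cda_arity n" and zero: "trees_value x = 0"
  shows "x \<in> J n"
proof -
  have "linear_extension (\<lambda>t. monomial t - comb_poly [0..<n] (tree_value t)) x \<in> labelled [0..<n]"
    using x by (intro labelled_linear_extension normal_form) auto
  then have "x - comb_poly [0..<n] (trees_value x) \<in> labelled [0..<n]"
    by (simp add: linear_extension_fun_diff linear_extension_self
        linear_extension_linear_extension [OF is_linear_linear_extension])
  then obtain y where y: "y \<in> J n" "x = relabel_poly ((!) [0..<n]) y"
    using zero by (auto simp: labelled_def)
  have "relabel_poly ((!) [0..<n]) y = linear_extension (\<lambda>t. monomial t) y"
    using ideal_keys [OF y(1)]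
    by (intro linear_extension_cong arg_cong [where f = monomial] relabel_ident) (auto simp: tree_monomials_def)
  then show ?thesis using y by (simp add: linear_extension_self)
qed

end

section \<open>The isomorphism\<close>

lemma tree_value_sorted:
  assumes "leaves t = [0..<length (leaves t)]"
  shows "tree_value t = planar_value t"
proof -
  have "leaf_perm [0..<n] = id" for n by (auto simp: leaf_perm_def fun_eq_iff)
  then have "leaf_perm (leaves t) = id" using assms by metis
  then show ?thesis by (simp add: tree_value_def linear_extension_self)
qed

lemma trees_value_relations:
  assumes "(n, r) \<in> (cda_relations :: (nat \<times> (cda_generator tree \<Rightarrow>\<^sub>0 'k::field)) set)"
  shows "Poly_Mapping.keys r \<subseteq> tree_monomials cda_arity n" "trees_value r = 0"
proof -
  \<comment> \<open>The word \<open>X_0 X_0\<close> is fixed by every permutation of its letters, so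
    the leaf permutation of the swapped product does not have to be computed.\<close>
  have "permute_list \<sigma> [0, 0] = [0 :: nat, 0]" if "\<sigma> permutes {..<2}" for \<sigma> :: "nat \<Rightarrow> nat"
  proof -
    have "set (permute_list \<sigma> [0 :: nat, 0]) = {0}" using that by (subst set_permute_list) (simp_all add: numeral_2_eq_2)
    then have "permute_list \<sigma> [0 :: nat, 0] = replicate 2 0" by (intro replicate_eqI) simp_all
    then show ?thesis by (simp add: numeral_2_eq_2)
  qed
  moreover have "Hilbert_Choice.inv (leaf_perm [Suc 0, 0]) permutes {..<2}"
    by (intro permutes_inv leaf_perm_permutes) (simp add: upt_rec)
  ultimately have swap: "tree_value (mult_tree (Leaf (Suc 0)) (Leaf 0)) = (indet 0 * indet 0 :: _ \<Rightarrow>\<^sub>0 'k)"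
    by (simp add: tree_value_def indet_def mult_single plus_list_def)
  show "trees_value r = 0"
    using assms unfolding cda_relations_eq
    by (auto simp: is_linear_diff [OF is_linear_linear_extension] linear_extension_add swap
        tree_value_sorted D_mult D_indet mult.assoc)
  show "Poly_Mapping.keys r \<subseteq> tree_monomials cda_arity n"
    using assms unfolding cda_relations_eq insert_iff empty_iff prod.inject simp_thms
    by (elim disjE conjE; hypsubst; intro keys_diff_subset keys_add_subset;
      simp add: tree_monomials_iff_mset numeral_2_eq_2 numeral_3_eq_3)
qed

lemma generated_ideal_eq_kernel:
  "generated_ideal (free_operad cda_arity) (cda_relations :: (nat \<times> (cda_generator tree \<Rightarrow>\<^sub>0 'k::field)) set) =
    operad_cover.kernel NMI (free_operad cda_arity) (\<lambda>_. trees_value)"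
proof (intro ext equalityI subsetI)
  interpret cover: operad_cover NMI "free_operad cda_arity" "\<lambda>_. trees_value :: (_ \<Rightarrow>\<^sub>0 'k) \<Rightarrow> _"
    by (rule operad_cover_trees_value)
  have kernel: "x \<in> cover.kernel n \<longleftrightarrow> Poly_Mapping.keys x \<subseteq> tree_monomials cda_arity n \<and> trees_value x = 0"
    for n x by (simp add: cover.kernel_def cover.fiber_def free_operad_simps NMI_simps)
  fix n and x :: "cda_generator tree \<Rightarrow>\<^sub>0 'k"
  show "x \<in> cover.kernel n" if "x \<in> generated_ideal (free_operad cda_arity) cda_relations n"
  proof -
    have "\<forall>(m, r)\<in>cda_relations. (r :: _ \<Rightarrow>\<^sub>0 'k) \<in> cover.kernel m"
      using trees_value_relations by (auto simp: kernel)
    then show ?thesis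
      using that cover.operad_ideal_kernel unfolding generated_ideal_def by blast
  qed
  show "x \<in> generated_ideal (free_operad cda_arity) cda_relations n" if x: "x \<in> cover.kernel n"
  proof -
    have "x \<in> I n" if "operad_ideal (free_operad cda_arity) I" "\<forall>(m, r)\<in>cda_relations. r \<in> I m" for I
    proof -
      interpret cda_ideal I
        using that by (intro cda_ideal.intro cda_ideal_axioms.intro) auto
      show ?thesis using x by (intro kernel_subset) (simp_all add: kernel)
    qed
    then show ?thesis using x by (simp add: generated_ideal_def kernel free_operad_simps)
  qed
qed

text \<open>Every element of \<open>NMI\<close> receives a preimage on which \<open>\<theta>\<close>
  and \<open>\<theta>'\<close> agree, built from \<open>d\<close>, \<open>m\<close> and the operad
  operations of \<open>P\<close>. For \<open>x\<close> in \<open>P\<close>, the one built for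
  \<open>\<theta> n x\<close> equals \<open>x\<close> by injectivity of \<open>\<theta>\<close>, so
  \<open>\<theta>'\<close> agrees with \<open>\<theta>\<close> at \<open>x\<close>.\<close>

lemma hom_NMI_unique:
  assumes iso: "operad_iso P (NMI :: ('k::field, _) operad) \<theta>" and hom: "operad_hom P NMI \<theta>'"
    and d: "d \<in> op_carrier P 1" "\<theta> 1 d = indet 1" "\<theta>' 1 d = indet 1"
    and m: "m \<in> op_carrier P 2" "\<theta> 2 m = indet 0 * indet 0" "\<theta>' 2 m = indet 0 * indet 0"
  shows "\<theta>' = \<theta>"
proof -
  interpret \<theta>: operad_iso P NMI \<theta> by (rule iso)
  interpret \<theta>': operad_hom P NMI \<theta>' by (rule hom)
  \<comment> \<open>\<open>X_1\<close> composed with \<open>X_i\<close> is \<open>D X_i\<close>, the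
    next letter.\<close>
  have letter: "\<exists>x\<in>op_carrier P 1. \<theta> 1 x = indet i \<and> \<theta>' 1 x = indet i" for i
  proof (induction i)
    case 0
    show ?case
      using \<theta>.P.unit_closed \<theta>.hom_unit \<theta>'.hom_unit by (intro bexI [of _ "op_unit P"]) (simp_all add: NMI_simps)
  next
    case (Suc i)
    then obtain x where x: "x \<in> op_carrier P 1" "\<theta> 1 x = indet i" "\<theta>' 1 x = indet i" by blast
    then have args: "[x] \<in> op_args P [1]" by (simp add: op_args_def)
    show ?case
      using d x \<theta>.P.comp_closed [OF _ args, of d] \<theta>.hom_comp [OF _ args, of d] \<theta>'.hom_comp [OF _ args, of d]
      by (intro bexI [of _ "op_comp P [1] d [x]"]) (simp_all add: NMI_simps word_comp_indet D_indet)
  qed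
  have word: "\<exists>x\<in>op_carrier P (length w). \<theta> (length w) x = Poly_Mapping.single w 1 \<and>
      \<theta>' (length w) x = Poly_Mapping.single w 1" if "w \<noteq> []" for w
    using that
  proof (induction w rule: list_nonempty_induct)
    case (single i)
    show ?case using letter [of i] by (simp add: indet_def)
  next
    case (cons i w)
    obtain x where x: "x \<in> op_carrier P 1" "\<theta> 1 x = indet i" "\<theta>' 1 x = indet i" using letter by blast
    obtain y where y: "y \<in> op_carrier P (length w)" "\<theta> (length w) y = Poly_Mapping.single w 1"
      "\<theta>' (length w) y = Poly_Mapping.single w 1" using cons.IH by blast
    have args: "[x, y] \<in> op_args P [1, length w]" using x y by (simp add: op_args_def)
    have m': "m \<in> op_carrier P (length [1, length w])" using m by (simp add: numeral_2_eq_2)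
    \<comment> \<open>Composing \<open>X_0 X_0\<close> with a letter and a word prepends the letter
      to the word.\<close>
    have "word_comp (indet 0 * indet 0) [indet i, Poly_Mapping.single w 1] =
        (Poly_Mapping.single (i # w) 1 :: _ \<Rightarrow>\<^sub>0 'k)"
      using word_comp_times [of "indet 0" "[indet i]" "indet 0" "[Poly_Mapping.single w (1 :: 'k)]"]
      by (simp add: keys_indet word_comp_indet single_Cons)
    then show ?case
      using m x y \<theta>.P.comp_closed [OF m' args] \<theta>.hom_comp [OF m' args] \<theta>'.hom_comp [OF m' args]
      by (intro bexI [of _ "op_comp P [1, length w] m [x, y]"]) (simp_all add: NMI_simps numeral_2_eq_2)
  qed
  have span: "\<exists>x\<in>op_carrier P n. \<theta> n x = p \<and> \<theta>' n x = p" if p: "p \<in> op_carrier NMI n" for n p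
  proof -
    have "\<exists>x\<in>op_carrier P n. \<theta> n x = (\<Sum>w\<in>A. scale (Poly_Mapping.lookup p w) (Poly_Mapping.single w 1)) \<and>
        \<theta>' n x = (\<Sum>w\<in>A. scale (Poly_Mapping.lookup p w) (Poly_Mapping.single w 1))"
      if "finite A" "A \<subseteq> {w. length w = n \<and> w \<noteq> []}" for A
      using that
    proof (induction A rule: finite_induct)
      case empty
      have "\<zero>\<^bsub>op_space P n\<^esub> \<in> op_carrier P n"
        using \<theta>.P.space [of n] by (simp add: module_def abelian_group_def abelian_monoid.zero_closed)
      then show ?case
        using linear_maps_zero [OF \<theta>.hom_linear \<theta>.P.space \<theta>.Q.space, of n]
          linear_maps_zero [OF \<theta>'.hom_linear \<theta>.P.space \<theta>.Q.space, of n]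
        by (intro bexI) (simp_all add: NMI_simps)
    next
      case (insert w A)
      then obtain x where x: "x \<in> op_carrier P n"
          "\<theta> n x = (\<Sum>w\<in>A. scale (Poly_Mapping.lookup p w) (Poly_Mapping.single w 1))"
          "\<theta>' n x = (\<Sum>w\<in>A. scale (Poly_Mapping.lookup p w) (Poly_Mapping.single w 1))"
        by auto
      obtain y where y: "y \<in> op_carrier P n" "\<theta> n y = Poly_Mapping.single w 1" "\<theta>' n y = Poly_Mapping.single w 1"
        using word [of w] insert.prems by auto
      let ?y = "Poly_Mapping.lookup p w \<odot>\<^bsub>op_space P n\<^esub> y"
      have cy: "?y \<in> op_carrier P n"
        using \<theta>.P.space [of n] y(1) unfolding module_scalars_iff_abelian_group by blast
      then have "?y \<oplus>\<^bsub>op_space P n\<^esub> x \<in> op_carrier P n"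
        using \<theta>.P.space [of n] x(1) by (simp add: module_def abelian_group_def abelian_monoid.a_closed)
      then show ?case
        using linear_mapsD [OF \<theta>.hom_linear] linear_mapsD [OF \<theta>'.hom_linear] x y cy insert.hyps
        by (intro bexI [of _ "?y \<oplus>\<^bsub>op_space P n\<^esub> x"]) (simp_all add: NMI_simps)
    qed
    from this [of "Poly_Mapping.keys p"] p show ?thesis
      using linear_extension_self [of p] by (simp add: linear_extension_def NMI_simps)
  qed
  have "\<theta>' n x = \<theta> n x" for n x
  proof (cases "x \<in> op_carrier P n")
    case True
    then have "\<theta> n x \<in> op_carrier NMI n" using linear_mapsD(1) [OF \<theta>.hom_linear] by blast
    then obtain z where z: "z \<in> op_carrier P n" "\<theta> n z = \<theta> n x" "\<theta>' n z = \<theta> n x" using span by metis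
    have "inj_on (\<theta> n) (op_carrier P n)" using \<theta>.iso_bij by (rule bij_betw_imp_inj_on)
    then have "z = x" using z(2,1) True by (rule inj_onD)
    then show ?thesis using z by simp
  next
    case False
    then show ?thesis
      using \<theta>.hom_extensional [of n] \<theta>'.hom_extensional [of n] by (simp add: extensional_def)
  qed
  then show ?thesis by (intro ext)
qed

theorem theorem2p8:
  shows "\<exists>!\<theta>. operad_iso (CDA :: ('k::field_char_0, (cda_generator tree \<Rightarrow>\<^sub>0 'k) set) operad) NMI \<theta> \<and>
    \<theta> 1 CDA_deriv = indet 1 \<and> \<theta> 2 CDA_mult = indet 0 * indet 0"
proof -
  interpret cover: operad_cover NMI "free_operad cda_arity" "\<lambda>_. trees_value :: (_ \<Rightarrow>\<^sub>0 'k) \<Rightarrow> _"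
    by (rule operad_cover_trees_value)
  have CDA: "CDA = quotient_operad (free_operad cda_arity) cover.kernel"
    by (simp add: CDA_def presented_operad_def generated_ideal_eq_kernel)
  \<comment> \<open>The class of each generator is the fiber of its value, so the inverse of
    \<open>fiber\<close> sends it to that value.\<close>
  have gen: "presented_gen cda_arity cda_relations g = cover.fiber (cda_arity g) (trees_value (free_gen cda_arity g))"
    for g :: cda_generator
    unfolding presented_gen_def generated_ideal_eq_kernel
    using corolla_in_tree_monomials [of g cda_arity]
    by (intro cover.coset_kernel) (simp add: free_operad_simps free_gen_def)
  have images: "trees_value (free_gen cda_arity Deriv) = (indet 1 :: _ \<Rightarrow>\<^sub>0 'k)"
    "trees_value (free_gen cda_arity Mult) = (indet 0 * indet 0 :: _ \<Rightarrow>\<^sub>0 'k)"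
    by (simp_all add: free_gen_def tree_value_sorted D_indet numeral_2_eq_2)
  have deriv: "CDA_deriv = cover.fiber 1 (indet 1)" and mult: "CDA_mult = cover.fiber 2 (indet 0 * indet 0)"
    unfolding CDA_deriv_def CDA_mult_def gen images by simp_all
  have X: "indet 1 \<in> op_carrier (NMI :: ('k, _) operad) 1" "indet 0 * indet 0 \<in> op_carrier (NMI :: ('k, _) operad) 2"
    by (simp_all add: NMI_simps indet_def mult_single plus_list_def)
  \<comment> \<open>\<open>fiber\<close> goes from \<open>NMI\<close> to the quotient; the
    isomorphism sought is its inverse.\<close>
  let ?\<theta> = "cover.quotient.inverse"
  have \<theta>: "operad_iso CDA NMI ?\<theta>" "?\<theta> 1 CDA_deriv = indet 1" "?\<theta> 2 CDA_mult = indet 0 * indet 0"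
    using cover.quotient.operad_iso_inverse cover.quotient.inverse_image X by (simp_all add: CDA deriv mult)
  have carrier: "CDA_deriv \<in> op_carrier (CDA :: ('k, _) operad) 1" "CDA_mult \<in> op_carrier (CDA :: ('k, _) operad) 2"
    using cover.quotient.closed X unfolding CDA deriv mult by blast+
  show ?thesis
  proof (intro ex1I [of _ ?\<theta>] conjI)
    fix \<theta>' assume *: "operad_iso (CDA :: ('k, _) operad) NMI \<theta>' \<and>
      \<theta>' 1 CDA_deriv = indet 1 \<and> \<theta>' 2 CDA_mult = indet 0 * indet 0"
    then show "\<theta>' = ?\<theta>"
      using \<theta> carrier by (intro hom_NMI_unique) (auto simp: operad_iso_def)
  qed (use \<theta> in simp_all)
qed

end
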